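(* Let $(h,\alpha,k,K)$ be an admissible reward structure and let $\Gamma>0$, $\sigma>0$ be constants such that $\Gamma<\alpha/2$. Set $$A:=\frac{\sqrt{2\Gamma}}{\sigma},\qquad B:=\frac{\sqrt{2(\alpha+\Gamma)}}{\sigma}.$$ Consider the diffusion process $$dX_t=\sigma^2A\tanh(AX_t)\,dt+\sigma\,dW_t,\qquad X_0=0,$$ where $(W_t)_{t\geq 0}$ is a standard Wiener process. Then its Gittins index $M_{\alpha,\Gamma}$ is, for every $x\in\mathbb{R}$, $$M_{\alpha,\Gamma}(x)=\rho_-(x)S_-(x)+\rho_+(x)S_+(x),$$ where $$\rho_\pm(x):=\frac{2}{2\alpha+\sigma^2[B\pm A]^2e^{\pm2Ax}},\qquad S_\pm(x):=\int_0^\infty h\!\left[x+\frac{s}{B\pm A}\right]e^{-s}\,ds.$$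
   Context: Admissible reward structure: a 4-tuple $(h,\alpha,k,K)$ where $\alpha>0$ (the discounting factor) and $h:\mathbb{R}\to[\alpha k,\alpha K]$ is a strictly increasing function with bounded first and second derivatives such that $\lim_{x\to-\infty}h(x)=\alpha k$, $\lim_{x\to+\infty}h(x)=\alpha K$ and $\lim_{|x|\to\infty}|h'(x)|=0$. Gittins index: for a real-valued diffusion $X$ adapted to a filtration $(\mathcal{F}_t)_{t\ge0}$ (with respect to which the driving Wiener process is a Brownian motion), the Gittins index at $x\in\mathbb{R}$ is $$M(x):=\sup_\tau\frac{\mathbb{E}_x\int_0^\tau h(X_s)e^{-\alpha s}\,ds}{1-\mathbb{E}_x e^{-\alpha\tau}},$$ where $\mathbb{E}_x$ is expectation for the process (with the same SDE) started at $x$ and the supremum is over all stopping times $\tau$ with respect to $(\mathcal{F}_t)$. *)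

theory Defs
  imports "HOL-Probability.Probability"
begin

definition admissible_reward :: "(real \<Rightarrow> real) \<Rightarrow> real \<Rightarrow> real \<Rightarrow> real \<Rightarrow> bool" where
  "admissible_reward h \<alpha> k K \<longleftrightarrow>
     0 < \<alpha> \<and>
     range h \<subseteq> {\<alpha> * k..\<alpha> * K} \<and>
     strict_mono h \<and>
     (\<forall>x. h field_differentiable at x) \<and>
     (\<forall>x. deriv h field_differentiable at x) \<and>
     bounded (range (deriv h)) \<and>
     bounded (range (deriv (deriv h))) \<and>
     (h \<longlongrightarrow> \<alpha> * k) at_bot \<and>
     (h \<longlongrightarrow> \<alpha> * K) at_top \<and>
     ((\<lambda>x. \<bar>deriv h x\<bar>) \<longlongrightarrow> 0) at_infinity"

text \<open>
  Filtrations are indexed by \<^typ>\<open>ennreal\<close>, so that the library's \<^const>\<open>stopping_time\<close> covers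
  stopping times with values in \<open>[0, \<infinity>]\<close>: the condition at \<open>t = \<infinity>\<close> is void, hence the choice
  of \<open>F \<infinity>\<close> is irrelevant. Processes are indexed by real times and only used for \<open>t \<ge> 0\<close>.
\<close>

locale filtered_prob_space = prob_space M + filtration "space M" F
  for M :: "'a measure" and F :: "ennreal \<Rightarrow> 'a measure" +
  assumes subalgebra_F: "subalgebra M (F t)"

locale wiener_process = filtered_prob_space M F
  for M :: "'a measure" and F :: "ennreal \<Rightarrow> 'a measure" +
  fixes W :: "real \<Rightarrow> 'a \<Rightarrow> real"
  assumes adapted_W: "0 \<le> t \<Longrightarrow> W t \<in> borel_measurable (F (ennreal t))"
    and continuous_W: "\<omega> \<in> space M \<Longrightarrow> continuous_on {0..} (\<lambda>t. W t \<omega>)"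
    and W_0: "AE \<omega> in M. W 0 \<omega> = 0"
    and normal_increments: "0 \<le> s \<Longrightarrow> s < t \<Longrightarrow>
          distributed M lborel (\<lambda>\<omega>. W t \<omega> - W s \<omega>) (normal_density 0 (sqrt (t - s)))"
    and indep_increments: "0 \<le> s \<Longrightarrow> s < t \<Longrightarrow>
          indep_set (sets (F (ennreal s)))
            {(\<lambda>\<omega>. W t \<omega> - W s \<omega>) -` A \<inter> space M | A. A \<in> sets borel}"

text \<open>
  \<open>X\<close> solves \<open>dX = b(X) dt + \<sigma> dW\<close> with \<open>X\<^sub>0 = x\<close>. As \<open>\<sigma>\<close> is constant, the stochastic
  integral \<open>\<integral>\<^sub>0\<^sup>t \<sigma> dW\<close> is \<open>\<sigma> W\<^sub>t\<close>.
\<close>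

locale diffusion = wiener_process M F W
  for M :: "'a measure" and F :: "ennreal \<Rightarrow> 'a measure" and W :: "real \<Rightarrow> 'a \<Rightarrow> real" +
  fixes b :: "real \<Rightarrow> real" and \<sigma> :: real and x :: real and X :: "real \<Rightarrow> 'a \<Rightarrow> real"
  assumes adapted_X: "0 \<le> t \<Longrightarrow> X t \<in> borel_measurable (F (ennreal t))"
    and continuous_X: "\<omega> \<in> space M \<Longrightarrow> continuous_on {0..} (\<lambda>t. X t \<omega>)"
    and sde: "AE \<omega> in M. \<forall>t\<ge>0.
          set_integrable lborel {0..t} (\<lambda>s. b (X s \<omega>)) \<and>
          X t \<omega> = x + (LBINT s:{0..t}. b (X s \<omega>)) + \<sigma> * W t \<omega>"

definition discount :: "real \<Rightarrow> ennreal \<Rightarrow> real" where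
  "discount \<alpha> t = (if t = \<infinity> then 0 else exp (- \<alpha> * enn2real t))"

text \<open>
  \<open>P x\<close>, \<open>F x\<close> and \<open>X x\<close> are the probability space, the filtration and the process started
  at \<open>x\<close>; the expectation written \<open>E\<^sub>x\<close> is the one under \<open>P x\<close>. Stopping times vanishing almost
  surely are excluded, since the quotient is then \<open>0/0\<close>. For \<open>h\<close> with values in
  \<open>[\<alpha>k, \<alpha>K]\<close> all quotients lie in \<open>[k, K]\<close>, and \<open>\<tau> = \<infinity>\<close> is allowed, so this is the supremum
  of a nonempty bounded set of reals.
\<close>

definition gittins_index ::
  "(real \<Rightarrow> 'a measure) \<Rightarrow> (real \<Rightarrow> ennreal \<Rightarrow> 'a measure) \<Rightarrow> (real \<Rightarrow> real \<Rightarrow> 'a \<Rightarrow> real) \<Rightarrow>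
   (real \<Rightarrow> real) \<Rightarrow> real \<Rightarrow> real \<Rightarrow> real" where
  "gittins_index P F X h \<alpha> x =
     (SUP \<tau> \<in> {\<tau>. stopping_time (F x) \<tau> \<and> \<not> (AE \<omega> in P x. \<tau> \<omega> = 0)}.
        (LINT \<omega>|P x. (LBINT s:{s. 0 \<le> s \<and> ennreal s \<le> \<tau> \<omega>}. h (X x s \<omega>) * exp (- \<alpha> * s)))
        / (1 - (LINT \<omega>|P x. discount \<alpha> (\<tau> \<omega>))))"

end

theory Submission
  imports Defs "HOL-Real_Asymp.Real_Asymp"
begin

text \<open>
  The generator \<open>L\<close> of the diffusion is conjugate, through multiplication by \<open>cosh (A y)\<close>, to
  \<open>\<sigma>\<^sup>2/2 d\<^sup>2/dy\<^sup>2\<close> minus a constant. The right-hand side of the claim is therefore \<open>1/\<alpha>\<close> times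
  the average of \<open>h\<close> over \<open>(x, \<infinity>)\<close> for the weight \<open>exp (- B y) cosh (A y)\<close>.
  Denote this average by \<open>\<lambda>\<close>. The function \<open>w\<close> with \<open>L w - \<alpha> w = - (h - \<alpha> \<lambda>)\<close> on \<open>(x, \<infinity>)\<close> and
  \<open>w = 0\<close> on \<open>(-\<infinity>, x]\<close> is continuously differentiable, bounded and nonnegative, because the integral of
  \<open>h - \<alpha> \<lambda>\<close> against the weight vanishes and \<open>h\<close> is increasing. Dynkin's formula for \<open>w + \<lambda>\<close>
  then bounds the quotient of every stopping time by \<open>\<lambda>\<close>, and the first passage
  times below \<open>x - e\<close> approach this bound as \<open>e\<close> tends to \<open>0\<close>.

  As \<open>w\<close> has a jump in its second derivative at \<open>x\<close>, the source \<open>h - \<alpha> \<lambda>\<close> is switched on by a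
  ramp of width \<open>e\<close>. This makes the second derivative Lipschitz, so that Dynkin's formula follows
  from a Taylor expansion over short time steps, without stochastic integration: the increments of \<open>W\<close>
  are independent of the past, and the errors of order \<open>(t - s)\<^sup>3\<^sup>/\<^sup>2\<close> disappear on
  passing to the time derivative of \<open>E f(X\<^sub>t)\<close>.
\<close>

text \<open>The constant \<open>\<lambda>\<close> is the retirement reward at which stopping and
  continuing are equally good at \<open>x\<close>, and \<open>w + \<lambda>\<close> is the value
  function of the stopping problem that pays \<open>\<lambda>\<close> on stopping. Its free boundary
  is fixed by smooth fit: \<open>w\<close> and \<open>w'\<close> both vanish at \<open>x\<close>.
  The solution with these data is bounded only if the source is centered, so boundedness, on which
  Dynkin's formula relies for possibly infinite stopping times, determines \<open>\<lambda>\<close>.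
  Ramping the source falsifies the reward near the boundary, and each of the two inequalities needs
  its own ramp. For the upper bound the ramp rises on [x, x + e], where the centered reward is
  negative for small e, so that damping it only raises the reward. For the lower bound it rises on
  [x - 2e, x - e], below every state visited before the passage, so that the reward is exact. Both
  choices rest on the strict inequality between h x and \<alpha> \<lambda>, which survives small
  perturbations. The passage level cannot be \<open>x\<close> itself: the process starts there, and
  the passage time would vanish almost surely.\<close>

section \<open>Measurability and Fubini for continuous processes\<close>

lemma floor_quotient_tendsto:
  fixes t :: real
  assumes "0 \<le> t"
  shows "(\<lambda>n. real (nat \<lfloor>real (Suc n) * t\<rfloor>) / real (Suc n)) \<longlonglongrightarrow> t"
proof (rule LIM_zero_cancel, rule Lim_null_comparison[OF _ LIMSEQ_inverse_real_of_nat], intro always_eventually allI)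
  fix n
  have "real (nat \<lfloor>real (Suc n) * t\<rfloor>) = of_int \<lfloor>real (Suc n) * t\<rfloor>" using assms by simp
  then have "\<bar>real (nat \<lfloor>real (Suc n) * t\<rfloor>) - real (Suc n) * t\<bar> \<le> 1" by linarith
  then have "\<bar>real (nat \<lfloor>real (Suc n) * t\<rfloor>) - real (Suc n) * t\<bar> / real (Suc n) \<le> 1 / real (Suc n)"
    by (intro divide_right_mono) auto
  moreover have "a / real (Suc n) - t = (a - real (Suc n) * t) / real (Suc n)" for a
    by (simp add: diff_divide_distrib del: of_nat_Suc)
  ultimately show "norm (real (nat \<lfloor>real (Suc n) * t\<rfloor>) / real (Suc n) - t) \<le> inverse (real (Suc n))"
    by (simp add: inverse_eq_divide del: of_nat_Suc)
qed

text \<open>A continuous path is the limit of its values at grid points below \<open>t\<close>, and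
  for a fixed mesh only countably many times occur. Paths are controlled for nonnegative times only;
  \<open>max 0 t\<close> extends them to the whole line, on which \<open>lborel\<close>
  lives.\<close>

lemma borel_measurable_continuous_paths:
  fixes Z :: "real \<Rightarrow> 'a \<Rightarrow> real"
  assumes meas: "\<And>t. 0 \<le> t \<Longrightarrow> Z t \<in> borel_measurable N"
    and cont: "\<And>\<omega>. \<omega> \<in> space N \<Longrightarrow> continuous_on {0..} (\<lambda>t. Z t \<omega>)"
  shows "(\<lambda>(\<omega>, t). Z (max 0 t) \<omega>) \<in> borel_measurable (N \<Otimes>\<^sub>M lborel)"
proof -
  let ?q = "\<lambda>n t. real (nat \<lfloor>real (Suc n) * max 0 t\<rfloor>) / real (Suc n)"
  have "(\<lambda>p. Z (max 0 (snd p)) (fst p)) \<in> borel_measurable (N \<Otimes>\<^sub>M lborel)"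
  proof (rule borel_measurable_LIMSEQ_real)
    fix p assume p: "p \<in> space (N \<Otimes>\<^sub>M (lborel :: real measure))"
    define t where "t = max 0 (snd p)"
    have "(\<lambda>n. ?q n (snd p)) \<longlonglongrightarrow> t"
      unfolding t_def by (rule floor_quotient_tendsto) simp
    moreover have "continuous (at t within {0..}) (\<lambda>t. Z t (fst p))"
      using cont[of "fst p"] p by (auto simp: continuous_on_eq_continuous_within space_pair_measure t_def)
    ultimately have "(\<lambda>n. Z (?q n (snd p)) (fst p)) \<longlonglongrightarrow> Z t (fst p)"
      by (rule continuous_within_tendsto_compose'[rotated 2]) simp
    then show "(\<lambda>n. Z (?q n (snd p)) (fst p)) \<longlonglongrightarrow> Z (max 0 (snd p)) (fst p)"
      unfolding t_def .
  next
    fix n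
    have "(\<lambda>p. Z (real (nat \<lfloor>real (Suc n) * max 0 (snd p)\<rfloor>) / real (Suc n)) (fst p)) \<in> borel_measurable (N \<Otimes>\<^sub>M lborel)"
    proof (rule measurable_compose_countable[where f="\<lambda>i p. Z (real i / real (Suc n)) (fst p)"])
      show "(\<lambda>p. Z (real i / real (Suc n)) (fst p)) \<in> borel_measurable (N \<Otimes>\<^sub>M (lborel :: real measure))" for i :: nat
        using meas[of "real i / real (Suc n)"] by measurable
    qed measurable
    then show "(\<lambda>p. Z (?q n (snd p)) (fst p)) \<in> borel_measurable (N \<Otimes>\<^sub>M lborel)" .
  qed
  then show ?thesis by (simp add: case_prod_beta')
qed

text \<open>Fubini on the strip \<open>space M \<times> {s..t}\<close>: its product measure is
  finite, so the bound \<open>C\<close> on the strip yields integrability.\<close>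

lemma (in prob_space) expectation_set_integral_swap:
  fixes \<phi> :: "'a \<Rightarrow> real \<Rightarrow> real"
  assumes m: "(\<lambda>(\<omega>, u). \<phi> \<omega> u) \<in> borel_measurable (M \<Otimes>\<^sub>M lborel)"
    and b: "\<And>\<omega> u. \<omega> \<in> space M \<Longrightarrow> s \<le> u \<Longrightarrow> u \<le> t \<Longrightarrow> \<bar>\<phi> \<omega> u\<bar> \<le> C"
  shows "expectation (\<lambda>\<omega>. LBINT u:{s..t}. \<phi> \<omega> u) = (LBINT u:{s..t}. expectation (\<lambda>\<omega>. \<phi> \<omega> u))"
    and "integrable M (\<lambda>\<omega>. LBINT u:{s..t}. \<phi> \<omega> u)"
proof -
  interpret pair_sigma_finite M lborel
    by (intro pair_sigma_finite.intro sigma_finite_measure_axioms lborel.sigma_finite_measure_axioms)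
  let ?f = "\<lambda>\<omega> u. indicator {s..t} u * \<phi> \<omega> u"
  have mf: "(\<lambda>(\<omega>, u). ?f \<omega> u) \<in> borel_measurable (M \<Otimes>\<^sub>M lborel)"
    using m by (simp add: case_prod_beta')
  have int: "integrable (M \<Otimes>\<^sub>M lborel) (\<lambda>(\<omega>, u). ?f \<omega> u)"
  proof (rule Bochner_Integration.integrable_bound[OF _ mf])
    have "integrable (M \<Otimes>\<^sub>M lborel) (\<lambda>p. indicator (space M \<times> {s..t}) p * C)"
    proof (rule integrable_mult_left)
      have "emeasure (M \<Otimes>\<^sub>M lborel) (space M \<times> {s..t}) = emeasure M (space M) * emeasure lborel {s..t}"
        by (subst lborel.emeasure_pair_measure_Times) auto
      then show "C \<noteq> 0 \<Longrightarrow> integrable (M \<Otimes>\<^sub>M lborel) (indicator (space M \<times> {s..t}) :: _ \<Rightarrow> real)"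
        by (auto simp: integrable_indicator_iff emeasure_space_1 emeasure_lborel_Icc_eq)
    qed
    then show "integrable (M \<Otimes>\<^sub>M lborel) (\<lambda>p. indicator (space M \<times> {s..t}) p * C)" .
    show "AE p in M \<Otimes>\<^sub>M lborel. norm (case p of (\<omega>, u) \<Rightarrow> ?f \<omega> u) \<le> norm (indicator (space M \<times> {s..t}) p * C)"
      by (rule AE_I2) (use b in \<open>fastforce simp: space_pair_measure indicator_def abs_mult\<close>)
  qed
  have eq: "(LBINT u:{s..t}. \<phi> \<omega> u) = (LBINT u. ?f \<omega> u)" for \<omega>
    by (simp add: set_lebesgue_integral_def)
  have eq2: "expectation (\<lambda>\<omega>. ?f \<omega> u) = indicator {s..t} u * expectation (\<lambda>\<omega>. \<phi> \<omega> u)" for u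
    by (rule Bochner_Integration.integral_mult_right_zero)
  show "expectation (\<lambda>\<omega>. LBINT u:{s..t}. \<phi> \<omega> u) = (LBINT u:{s..t}. expectation (\<lambda>\<omega>. \<phi> \<omega> u))"
    using Fubini_integral[OF int] unfolding eq
    by (simp add: eq2 set_lebesgue_integral_def)
  show "integrable M (\<lambda>\<omega>. LBINT u:{s..t}. \<phi> \<omega> u)"
    unfolding eq using integrable_fst[of ?f, OF int] .
qed

section \<open>Increments of the Wiener process\<close>

context wiener_process
begin

lemma F_measurable: "Y \<in> borel_measurable (F t) \<Longrightarrow> Y \<in> borel_measurable M"
  using measurable_from_subalg[OF subalgebra_F] .

lemma F_mono: "s \<le> t \<Longrightarrow> Y \<in> borel_measurable (F s) \<Longrightarrow> Y \<in> borel_measurable (F t)"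
  using sets_F_mono[of s t] space_F by (auto simp: measurable_def)

lemma measurable_W [measurable]: "0 \<le> t \<Longrightarrow> W t \<in> borel_measurable M"
  using adapted_W F_measurable by blast

lemma indep_increment:
  assumes st: "0 \<le> s" "s < t" and Y: "Y \<in> borel_measurable (F (ennreal s))"
  shows "indep_var borel Y borel (\<lambda>\<omega>. W t \<omega> - W s \<omega>)"
proof -
  let ?Z = "\<lambda>\<omega>. W t \<omega> - W s \<omega>"
  have Z: "?Z \<in> borel_measurable M" using measurable_W[of s] measurable_W[of t] st by simp
  have 1: "sigma_sets (space M) {Y -` A \<inter> space M |A. A \<in> sets borel} \<subseteq> sets (F (ennreal s))"
  proof -
    have "sigma_sets (space (F (ennreal s))) {Y -` A \<inter> space M |A. A \<in> sets borel} \<subseteq> sets (F (ennreal s))"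
      using measurable_sets[OF Y] by (intro sets.sigma_sets_subset) (auto simp: space_F)
    then show ?thesis by (simp add: space_F)
  qed
  \<comment> \<open>The preimages of Borel sets under a single function already form a
    sigma-algebra, so the family in \<open>indep_increments\<close> generates nothing new.\<close>
  have 2: "sigma_sets (space M) {?Z -` A \<inter> space M |A. A \<in> sets borel} = {?Z -` A \<inter> space M |A. A \<in> sets borel}"
    using sets.sigma_sets_eq[of "vimage_algebra (space M) ?Z borel"] by (simp add: sets_vimage_algebra2)
  show ?thesis
    unfolding indep_var_eq 2
  proof (intro conjI)
    show "indep_set (sigma_sets (space M) {Y -` A \<inter> space M |A. A \<in> sets borel})
       {?Z -` A \<inter> space M |A. A \<in> sets borel}"
      unfolding indep_set_def
      by (rule indep_sets_mono_sets[OF indep_increments[OF st, unfolded indep_set_def]])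
        (use 1 in \<open>auto split: bool.splits\<close>)
  qed (use Z F_measurable[OF Y] in auto)
qed

lemma increment_moments:
  assumes st: "0 \<le> s" "s < t"
  defines "Z \<equiv> \<lambda>\<omega>. W t \<omega> - W s \<omega>"
  shows "integrable M (\<lambda>\<omega>. Z \<omega> ^ n)"
    and "expectation Z = 0"
    and "expectation (\<lambda>\<omega>. (Z \<omega>)\<^sup>2) = t - s"
    and "expectation (\<lambda>\<omega>. Z \<omega> ^ 4) = 3 * (t - s)\<^sup>2"
proof -
  have pos: "0 < sqrt (t - s)" using st by simp
  note D = normal_increments[OF st, folded Z_def]
  show "integrable M (\<lambda>\<omega>. Z \<omega> ^ n)"
    using integrable_normal_moment[OF pos, of 0 n] distributed_integrable[OF D, of "\<lambda>x. x ^ n"]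
    by (simp add: mult.commute)
  have E: "expectation (\<lambda>\<omega>. Z \<omega> ^ n) = (LBINT x. normal_density 0 (sqrt (t - s)) x * x ^ n)" for n
    using distributed_integral[OF D, of "\<lambda>x. x ^ n"] by simp
  show "expectation Z = 0"
    using E[of 1] integral_normal_moment_odd[OF pos, of 0 0] by simp
  show "expectation (\<lambda>\<omega>. (Z \<omega>)\<^sup>2) = t - s"
    using E[of 2] integral_normal_moment_even[OF pos, of 0 1] st by simp
  show "expectation (\<lambda>\<omega>. Z \<omega> ^ 4) = 3 * (t - s)\<^sup>2"
    using E[of 4] integral_normal_moment_even[OF pos, of 0 2] st
    by (simp add: fact_numeral power2_eq_square field_simps)
qed

text \<open>The inequality \<open>\<bar>z\<bar> \<le> (r + z\<^sup>2 / r) / 2\<close> takes the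
  place of Jensen's inequality. With \<open>r\<close> the standard deviation, both summands
  contribute \<open>r / 2\<close> in expectation.\<close>

lemma expectation_abs_increment:
  assumes st: "0 \<le> s" "s \<le> t"
  shows "integrable M (\<lambda>\<omega>. \<bar>W t \<omega> - W s \<omega>\<bar>)"
    and "expectation (\<lambda>\<omega>. \<bar>W t \<omega> - W s \<omega>\<bar>) \<le> sqrt (t - s)"
proof -
  have "integrable M (\<lambda>\<omega>. \<bar>W t \<omega> - W s \<omega>\<bar>) \<and> expectation (\<lambda>\<omega>. \<bar>W t \<omega> - W s \<omega>\<bar>) \<le> sqrt (t - s)"
  proof (cases "s = t")
    case False
    then have lt: "s < t" using st by simp
    define r where "r = sqrt (t - s)"
    have r: "0 < r" "r\<^sup>2 = t - s" using lt by (auto simp: r_def)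
    note m = increment_moments[OF st(1) lt]
    have int: "integrable M (\<lambda>\<omega>. \<bar>W t \<omega> - W s \<omega>\<bar>)" using integrable_abs[OF m(1)[of 1]] by simp
    have "expectation (\<lambda>\<omega>. \<bar>W t \<omega> - W s \<omega>\<bar>) \<le> expectation (\<lambda>\<omega>. (r + ((W t \<omega> - W s \<omega>))\<^sup>2 / r) / 2)"
    proof (rule integral_mono)
      show "integrable M (\<lambda>\<omega>. (r + ((W t \<omega> - W s \<omega>))\<^sup>2 / r) / 2)" using m(1)[of 2] by simp
      show "\<bar>W t \<omega> - W s \<omega>\<bar> \<le> (r + ((W t \<omega> - W s \<omega>))\<^sup>2 / r) / 2" for \<omega>
      proof -
        have "0 \<le> (\<bar>W t \<omega> - W s \<omega>\<bar> - r)\<^sup>2" by simp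
        then show ?thesis using r(1) by (simp add: field_simps power2_eq_square)
      qed
    qed fact
    also have "\<dots> = (r + r\<^sup>2 / r) / 2"
      using m(1)[of 2] m(3) r by (simp add: prob_space)
    also have "\<dots> = r" using r(1) by (simp add: power2_eq_square)
    finally show ?thesis using int r_def by simp
  qed auto
  then show "integrable M (\<lambda>\<omega>. \<bar>W t \<omega> - W s \<omega>\<bar>)"
    and "expectation (\<lambda>\<omega>. \<bar>W t \<omega> - W s \<omega>\<bar>) \<le> sqrt (t - s)" by auto
qed

text \<open>The same device multiplied by the square of the increment. The Gaussian moments
  \<open>r\<^sup>2\<close> and \<open>3 * r ^ 4\<close> turn the majorant into
  \<open>2 * r ^ 3\<close>.\<close>

lemma expectation_abs_increment_cubed:
  assumes st: "0 \<le> s" "s < t"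
  shows "integrable M (\<lambda>\<omega>. \<bar>W t \<omega> - W s \<omega>\<bar> ^ 3)"
    and "expectation (\<lambda>\<omega>. \<bar>W t \<omega> - W s \<omega>\<bar> ^ 3) \<le> 2 * sqrt (t - s) ^ 3"
proof -
  define r where "r = sqrt (t - s)"
  have r: "0 < r" "t - s = r\<^sup>2" using st by (auto simp: r_def)
  note m = increment_moments[OF st]
  have int: "integrable M (\<lambda>\<omega>. \<bar>W t \<omega> - W s \<omega>\<bar> ^ 3)" using integrable_abs[OF m(1)[of 3]] unfolding power_abs .
  have "expectation (\<lambda>\<omega>. \<bar>W t \<omega> - W s \<omega>\<bar> ^ 3) \<le> expectation (\<lambda>\<omega>. (r * ((W t \<omega> - W s \<omega>))\<^sup>2 + (W t \<omega> - W s \<omega>) ^ 4 / r) / 2)"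
  proof (rule integral_mono)
    show "integrable M (\<lambda>\<omega>. (r * ((W t \<omega> - W s \<omega>))\<^sup>2 + (W t \<omega> - W s \<omega>) ^ 4 / r) / 2)" using m(1)[of 2] m(1)[of 4] by simp
    show "\<bar>W t \<omega> - W s \<omega>\<bar> ^ 3 \<le> (r * ((W t \<omega> - W s \<omega>))\<^sup>2 + (W t \<omega> - W s \<omega>) ^ 4 / r) / 2" for \<omega>
    proof -
      define z where "z = \<bar>W t \<omega> - W s \<omega>\<bar>"
      have e: "((W t \<omega> - W s \<omega>))\<^sup>2 = z\<^sup>2" "(W t \<omega> - W s \<omega>) ^ 4 = z ^ 4" by (auto simp: z_def power_even_abs)
      have "0 \<le> (z * (z - r))\<^sup>2" by simp
      then have "2 * r * z ^ 3 \<le> r\<^sup>2 * z\<^sup>2 + z ^ 4" by (simp add: power2_eq_square power4_eq_xxxx power3_eq_cube algebra_simps)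
      then show ?thesis unfolding e z_def[symmetric] using r(1) by (simp add: field_simps power2_eq_square)
    qed
  qed fact
  also have "\<dots> = (r * r\<^sup>2 + 3 * r ^ 4 / r) / 2"
    using m(1)[of 2] m(1)[of 4] m(3,4) r by (simp add: power2_eq_square power4_eq_xxxx)
  also have "\<dots> = 2 * r ^ 3" using r(1) by (simp add: power2_eq_square power3_eq_cube power4_eq_xxxx)
  finally show "integrable M (\<lambda>\<omega>. \<bar>W t \<omega> - W s \<omega>\<bar> ^ 3)"
    and "expectation (\<lambda>\<omega>. \<bar>W t \<omega> - W s \<omega>\<bar> ^ 3) \<le> 2 * sqrt (t - s) ^ 3"
    using int by (auto simp: r_def)
qed

text \<open>These two orthogonality relations stand in for stochastic integration: the first removes
  the term of a Taylor expansion that is linear in the noise, the second replaces the squared noise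
  by \<open>t - s\<close>. Both come from independence of the past.\<close>

lemma expectation_mult_increment:
  assumes st: "0 \<le> s" "s < t" and Y: "Y \<in> borel_measurable (F (ennreal s))"
    and b: "\<And>\<omega>. \<omega> \<in> space M \<Longrightarrow> \<bar>Y \<omega>\<bar> \<le> C"
  shows "integrable M (\<lambda>\<omega>. Y \<omega> * (W t \<omega> - W s \<omega>))"
    and "expectation (\<lambda>\<omega>. Y \<omega> * (W t \<omega> - W s \<omega>)) = 0"
    and "integrable M (\<lambda>\<omega>. Y \<omega> * ((W t \<omega> - W s \<omega>)\<^sup>2 - (t - s)))"
    and "expectation (\<lambda>\<omega>. Y \<omega> * ((W t \<omega> - W s \<omega>)\<^sup>2 - (t - s))) = 0"
proof -
  note m = increment_moments[OF st]
  have iY: "integrable M Y"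
    by (rule integrable_const_bound[where B=C]) (use b F_measurable[OF Y] in auto)
  have i1: "integrable M (\<lambda>\<omega>. W t \<omega> - W s \<omega>)" using m(1)[of 1] by simp
  have i2: "integrable M (\<lambda>\<omega>. (W t \<omega> - W s \<omega>)\<^sup>2 - (t - s))" using m(1)[of 2] by simp
  have e2: "expectation (\<lambda>\<omega>. (W t \<omega> - W s \<omega>)\<^sup>2 - (t - s)) = 0"
    using m(1)[of 2] m(3) by (simp add: prob_space)
  note I1 = indep_increment[OF st Y]
  have I2: "indep_var borel Y borel (\<lambda>\<omega>. (W t \<omega> - W s \<omega>)\<^sup>2 - (t - s))"
    using indep_var_compose[OF I1, of "\<lambda>x. x" borel "\<lambda>z. z\<^sup>2 - (t - s)" borel] by (simp add: comp_def)
  show "integrable M (\<lambda>\<omega>. Y \<omega> * (W t \<omega> - W s \<omega>))"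
    by (rule indep_var_integrable[OF I1 iY i1])
  show "expectation (\<lambda>\<omega>. Y \<omega> * (W t \<omega> - W s \<omega>)) = 0"
    using indep_var_lebesgue_integral[OF I1 iY i1] m(2) by simp
  show "integrable M (\<lambda>\<omega>. Y \<omega> * ((W t \<omega> - W s \<omega>)\<^sup>2 - (t - s)))"
    by (rule indep_var_integrable[OF I2 iY i2])
  show "expectation (\<lambda>\<omega>. Y \<omega> * ((W t \<omega> - W s \<omega>)\<^sup>2 - (t - s))) = 0"
    using indep_var_lebesgue_integral[OF I2 iY i2] e2 by simp
qed

end

section \<open>Adapted solutions and hitting times\<close>

lemma lipschitz_of_bounded_derivative:
  fixes f f' :: "real \<Rightarrow> real"
  assumes "\<And>y. (f has_real_derivative f' y) (at y)" and "\<And>y. \<bar>f' y\<bar> \<le> C"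
  shows "\<bar>f y - f z\<bar> \<le> C * \<bar>y - z\<bar>"
  using field_differentiable_bound[of UNIV f f' C y z] assms by auto

lemma set_lebesgue_integral_combine_Icc:
  fixes f :: "real \<Rightarrow> real"
  assumes "continuous_on {a..c} f" "a \<le> b" "b \<le> c"
  shows "(LBINT u:{a..b}. f u) + (LBINT u:{b..c}. f u) = (LBINT u:{a..c}. f u)"
proof -
  have i: "set_integrable lborel {a..c} f" "set_integrable lborel {a..b} f" "set_integrable lborel {b..c} f"
    using assms by (auto intro!: borel_integrable_atLeastAtMost' continuous_on_subset[OF assms(1)])
  show ?thesis
    using i[THEN set_borel_integral_eq_integral(2)] i(1)[THEN set_borel_integral_eq_integral(1)]
      Henstock_Kurzweil_Integration.integral_combine[OF assms(2,3)] by simp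
qed

text \<open>A non-integrable function has integral 0 by convention, and \<open>C\<close> is
  nonnegative as it bounds an absolute value at \<open>a\<close>; so the estimate needs no case
  distinction where it is applied. With \<open>a = b\<close> it says that the integral over a point
  vanishes.\<close>

lemma abs_set_integral_le:
  fixes f :: "real \<Rightarrow> real"
  assumes "a \<le> b" and "\<And>u. a \<le> u \<Longrightarrow> u \<le> b \<Longrightarrow> \<bar>f u\<bar> \<le> C"
  shows "\<bar>LBINT u:{a..b}. f u\<bar> \<le> C * (b - a)"
proof (cases "set_integrable lborel {a..b} f")
  case True
  have "\<bar>LBINT u:{a..b}. f u\<bar> \<le> (LBINT u:{a..b}. \<bar>f u\<bar>)"
    using set_integral_norm_bound[OF True] by simp
  also have "\<dots> \<le> (LBINT u:{a..b}. C)"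
    using assms by (intro set_integral_mono set_integrable_abs True) (auto simp: set_integrable_def)
  also have "\<dots> = C * (b - a)"
    using assms(1) by (simp add: set_lebesgue_integral_def mult.commute)
  finally show ?thesis .
next
  case False
  have "0 \<le> C" using assms(2)[of a] assms(1) by auto
  then show ?thesis using False assms(1)
    by (simp add: set_lebesgue_integral_def set_integrable_def not_integrable_integral_eq)
qed

lemma set_integral_exp_Ici:
  fixes a c :: real
  assumes "0 < a"
  shows "set_integrable lborel {c..} (\<lambda>u. exp (- a * u))"
    and "(LBINT u:{c..}. exp (- a * u)) = exp (- a * c) / a"
proof -
  have "has_bochner_integral lborel (\<lambda>u. indicator {c..} u * exp (- a * u)) (exp (- a * c) / a)"
  proof (rule has_bochner_integral_nn_integral)
    show "(\<integral>\<^sup>+ u. ennreal (indicator {c..} u * exp (- a * u)) \<partial>lborel) = ennreal (exp (- a * c) / a)"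
      by (rule nn_integral_has_integral_lebesgue[OF _ has_integral_exp_minus_to_infinity[OF assms]]) simp
  qed (use assms in auto)
  then show "set_integrable lborel {c..} (\<lambda>u. exp (- a * u))"
    and "(LBINT u:{c..}. exp (- a * u)) = exp (- a * c) / a"
    by (auto simp: has_bochner_integral_iff set_integrable_def set_lebesgue_integral_def)
qed

context diffusion
begin

lemma measurable_X: "0 \<le> t \<Longrightarrow> X t \<in> borel_measurable M"
  using adapted_X F_measurable by blast

lemma measurable_X_joint [measurable]:
  "(\<lambda>(\<omega>, t). X (max 0 t) \<omega>) \<in> borel_measurable (M \<Otimes>\<^sub>M lborel)"
  by (rule borel_measurable_continuous_paths[OF measurable_X continuous_X])

lemma X_0: "AE \<omega> in M. X 0 \<omega> = x"
  using sde W_0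
proof eventually_elim
  case (elim \<omega>)
  have "(LBINT u:{0..0::real}. g u) = 0" for g :: "real \<Rightarrow> real"
    using abs_set_integral_le[of 0 0 g "\<bar>g 0\<bar>"] by simp
  with elim(1)[rule_format, of 0] elim(2) show "X 0 \<omega> = x" by simp
qed

section \<open>Discounted integrals along a path\<close>

lemma continuous_path_integrand:
  assumes "continuous_on UNIV \<phi>" "\<omega> \<in> space M"
  shows "continuous_on A (\<lambda>u. exp (- \<alpha> * u) * \<phi> (X (max 0 u) \<omega>))"
  by (intro continuous_on_mult continuous_on_compose2[OF assms(1)]
      continuous_on_compose2[OF continuous_X[OF assms(2)]] continuous_intros) auto

text \<open>\<open>D * exp (- \<alpha> * u)\<close> on the half-line is a majorant, uniformly in the
  path. The set \<open>A\<close> is kept general so that it may be a random time interval.\<close>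

lemma path_integrand_integrable:
  fixes \<phi> :: "real \<Rightarrow> real"
  assumes a: "0 < \<alpha>" and cont: "continuous_on UNIV \<phi>" and bd: "\<And>y. \<bar>\<phi> y\<bar> \<le> D"
    and w: "\<omega> \<in> space M" and A: "A \<in> sets borel" "A \<subseteq> {0..}"
  shows "set_integrable lborel A (\<lambda>u. exp (- \<alpha> * u) * \<phi> (X (max 0 u) \<omega>))"
    and "\<bar>LBINT u:A. exp (- \<alpha> * u) * \<phi> (X (max 0 u) \<omega>)\<bar> \<le> D / \<alpha>"
proof -
  let ?g = "\<lambda>u. indicator A u * (exp (- \<alpha> * u) * \<phi> (X (max 0 u) \<omega>))"
  let ?w = "\<lambda>u. D * (indicator {0..} u * exp (- \<alpha> * u))"
  have D: "0 \<le> D" using bd[of 0] by simp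
  have iw: "integrable lborel ?w"
    using set_integral_exp_Ici(1)[OF a, of 0] by (simp add: set_integrable_def)
  have m: "?g \<in> borel_measurable lborel"
    using borel_measurable_continuous_onI[OF continuous_path_integrand[OF cont w]] A(1) by simp
  have le: "\<bar>?g u\<bar> \<le> ?w u" for u
  proof -
    have "\<bar>exp (- \<alpha> * u) * \<phi> (X (max 0 u) \<omega>)\<bar> \<le> exp (- \<alpha> * u) * D"
      unfolding abs_mult using bd by (intro mult_mono) auto
    then show ?thesis using A(2) D by (auto simp: indicator_def mult.commute)
  qed
  have i: "integrable lborel ?g"
    by (rule Bochner_Integration.integrable_bound[OF iw m]) (use le D in \<open>auto intro!: AE_I2 simp: abs_mult\<close>)
  then show "set_integrable lborel A (\<lambda>u. exp (- \<alpha> * u) * \<phi> (X (max 0 u) \<omega>))"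
    by (simp add: set_integrable_def)
  have "\<bar>LBINT u. ?g u\<bar> \<le> (LBINT u. \<bar>?g u\<bar>)" by (rule integral_abs_bound)
  also have "\<dots> \<le> (LBINT u. ?w u)"
    by (rule integral_mono[OF integrable_abs[OF i] iw le])
  also have "\<dots> = D / \<alpha>"
    using set_integral_exp_Ici(2)[OF a, of 0] by (simp add: set_lebesgue_integral_def)
  finally show "\<bar>LBINT u:A. exp (- \<alpha> * u) * \<phi> (X (max 0 u) \<omega>)\<bar> \<le> D / \<alpha>"
    by (simp add: set_lebesgue_integral_def)
qed

text \<open>On the domain of integration \<open>max 0 u\<close> is \<open>u\<close>; it is written
  out to make the integrand jointly measurable on the whole line. An infinite value of
  \<open>\<tau>\<close> gives the full half-line.\<close>

definition discounted_integral :: "real \<Rightarrow> (real \<Rightarrow> real) \<Rightarrow> ('a \<Rightarrow> ennreal) \<Rightarrow> 'a \<Rightarrow> real" where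
  "discounted_integral \<alpha> \<phi> \<tau> \<omega> =
    (LBINT u:{u. 0 \<le> u \<and> ennreal u \<le> \<tau> \<omega>}. exp (- \<alpha> * u) * \<phi> (X (max 0 u) \<omega>))"

lemma measurable_stopping: "stopping_time F \<tau> \<Longrightarrow> \<tau> \<in> borel_measurable M"
  by (rule measurable_stopping_time[where F=F]) (use subalgebra_F in \<open>auto simp: subalgebra_def\<close>)

lemma discounted_integral_integrable:
  assumes \<tau>: "stopping_time F \<tau>" and "0 < \<alpha>" and cont: "continuous_on UNIV \<phi>" and "\<And>y. \<bar>\<phi> y\<bar> \<le> D"
  shows "integrable M (discounted_integral \<alpha> \<phi> \<tau>)"
proof (rule integrable_const_bound)
  note [measurable] = measurable_stopping[OF \<tau>] borel_measurable_continuous_onI[OF cont]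
  show "discounted_integral \<alpha> \<phi> \<tau> \<in> borel_measurable M"
    unfolding discounted_integral_def[abs_def] set_lebesgue_integral_def by measurable
  have "{u. 0 \<le> u \<and> ennreal u \<le> \<tau> \<omega>} \<in> sets borel" for \<omega> by measurable
  then show "AE \<omega> in M. norm (discounted_integral \<alpha> \<phi> \<tau> \<omega>) \<le> D / \<alpha>"
    unfolding discounted_integral_def real_norm_def
    by (intro AE_I2 path_integrand_integrable(2)[OF assms(2-4)]) auto
qed

text \<open>The integrands are compared only at states visited up to \<open>\<tau>\<close>. This is
  what makes a ramp invisible before a first passage.\<close>

lemma discounted_integral_mono:
  assumes "0 < \<alpha>" and w: "\<omega> \<in> space M"
    and "continuous_on UNIV \<phi>" "\<And>y. \<bar>\<phi> y\<bar> \<le> D" and "continuous_on UNIV \<psi>" "\<And>y. \<bar>\<psi> y\<bar> \<le> E"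
    and le: "\<And>u. 0 \<le> u \<Longrightarrow> ennreal u \<le> \<tau> \<omega> \<Longrightarrow> \<phi> (X u \<omega>) \<le> \<psi> (X u \<omega>)"
  shows "discounted_integral \<alpha> \<phi> \<tau> \<omega> \<le> discounted_integral \<alpha> \<psi> \<tau> \<omega>"
proof -
  have "{u. 0 \<le> u \<and> ennreal u \<le> \<tau> \<omega>} \<in> sets borel" by measurable
  then show ?thesis unfolding discounted_integral_def
    by (intro set_integral_mono path_integrand_integrable(1)[OF assms(1,3,4) w] path_integrand_integrable(1)[OF assms(1,5,6) w])
      (use le in auto)
qed

section \<open>First passage times below a level\<close>

definition hit :: "real \<Rightarrow> 'a \<Rightarrow> ennreal" where
  "hit c \<omega> = (if \<exists>t\<ge>0. X t \<omega> \<le> c then ennreal (Inf {t. 0 \<le> t \<and> X t \<omega> \<le> c}) else \<infinity>)"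

text \<open>By continuity the times at which the path is at or below \<open>c\<close> form a closed
  set, so that the infimum is attained.\<close>

lemma hit_finite:
  assumes w: "\<omega> \<in> space M" and "0 \<le> t" "X t \<omega> \<le> c"
  obtains T where "0 \<le> T" "T \<le> t" "hit c \<omega> = ennreal T" "X T \<omega> \<le> c" "\<And>s. 0 \<le> s \<Longrightarrow> s < T \<Longrightarrow> c < X s \<omega>"
proof -
  let ?S = "{t. 0 \<le> t \<and> X t \<omega> \<le> c}"
  have "closed ({0..} \<inter> (\<lambda>t. X t \<omega>) -` {..c})"
    by (rule continuous_closed_preimage[OF continuous_X[OF w]]) auto
  moreover have "{0..} \<inter> (\<lambda>t. X t \<omega>) -` {..c} = ?S" by auto
  ultimately have cl: "closed ?S" by simp
  have ne: "?S \<noteq> {}" using assms by auto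
  have bb: "bdd_below ?S" by (rule bdd_belowI[of _ 0]) auto
  have T: "Inf ?S \<in> ?S" by (rule closed_contains_Inf[OF ne bb cl])
  show ?thesis
  proof (rule that[of "Inf ?S"])
    show "Inf ?S \<le> t" using assms by (intro cInf_lower bb) auto
    show "hit c \<omega> = ennreal (Inf ?S)" unfolding hit_def using assms by auto
    show "c < X s \<omega>" if "0 \<le> s" "s < Inf ?S" for s
    proof (rule ccontr)
      assume "\<not> c < X s \<omega>"
      then have "Inf ?S \<le> s" using that by (intro cInf_lower bb) auto
      then show False using that by simp
    qed
  qed (use T in auto)
qed

lemma hit_le_iff:
  assumes w: "\<omega> \<in> space M" and r: "0 \<le> r"
  shows "hit c \<omega> \<le> ennreal r \<longleftrightarrow> (\<exists>s\<in>{0..r}. X s \<omega> \<le> c)"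
proof
  assume le: "hit c \<omega> \<le> ennreal r"
  then obtain t where t: "0 \<le> t" "X t \<omega> \<le> c" by (auto simp: hit_def top_unique split: if_splits)
  obtain T where "0 \<le> T" "hit c \<omega> = ennreal T" "X T \<omega> \<le> c" using hit_finite[OF w t] by metis
  then show "\<exists>s\<in>{0..r}. X s \<omega> \<le> c" using le r by (auto simp: ennreal_le_iff)
next
  assume "\<exists>s\<in>{0..r}. X s \<omega> \<le> c"
  then obtain s where s: "0 \<le> s" "s \<le> r" "X s \<omega> \<le> c" by auto
  obtain T where "T \<le> s" "hit c \<omega> = ennreal T" using hit_finite[OF w s(1,3)] by metis
  then show "hit c \<omega> \<le> ennreal r" using s by (auto intro: ennreal_leI)
qed

text \<open>Membership in the filtration at time \<open>r\<close> itself requires countably many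
  path values at times up to \<open>r\<close>. The times \<open>r * (j / Suc k)\<close> are dense in
  [0, r], and the slack \<open>1 / Suc n\<close> compensates for missing the exact time. Conversely,
  the minimum over the compact interval lies below \<open>c\<close> plus every slack, hence is at
  most \<open>c\<close>.\<close>

lemma path_reaches_iff:
  assumes w: "\<omega> \<in> space M" and r: "0 \<le> r"
  shows "(\<exists>s\<in>{0..r}. X s \<omega> \<le> c) \<longleftrightarrow>
    (\<forall>n. \<exists>k. \<exists>j\<le>Suc k. X (r * (real j / real (Suc k))) \<omega> < c + 1 / real (Suc n))"
proof
  assume "\<exists>s\<in>{0..r}. X s \<omega> \<le> c"
  then obtain s where s: "0 \<le> s" "s \<le> r" "X s \<omega> \<le> c" by auto
  \<comment> \<open>The fraction of [0, r] elapsed when the level is reached. For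
    \<open>r = 0\<close> the only time is 0, and the fraction 0 serves.\<close>
  define p where "p = (if r = 0 then 0 else s / r)"
  have p: "0 \<le> p" "p \<le> 1" "r * p = s" using s r by (auto simp: p_def divide_le_eq)
  let ?p = "\<lambda>k. real (nat \<lfloor>real (Suc k) * p\<rfloor>) / real (Suc k)"
  have "continuous_on {0..} (\<lambda>t. X t \<omega>)" by (rule continuous_X[OF w])
  then have lim: "(\<lambda>k. X (r * ?p k) \<omega>) \<longlonglongrightarrow> X (r * p) \<omega>"
    by (rule continuous_on_tendsto_compose[OF _ tendsto_mult[OF tendsto_const floor_quotient_tendsto[OF p(1)]]])
      (use p r in auto)
  show "\<forall>n. \<exists>k. \<exists>j\<le>Suc k. X (r * (real j / real (Suc k))) \<omega> < c + 1 / real (Suc n)"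
  proof
    fix n
    have "0 < 1 / real (Suc n)" by simp
    then have "X (r * p) \<omega> < c + 1 / real (Suc n)" unfolding p(3) using s(3) by linarith
    from order_tendstoD(2)[OF lim this] obtain k where k: "X (r * ?p k) \<omega> < c + 1 / real (Suc n)"
      by (auto simp: eventually_sequentially)
    have "real (Suc k) * p \<le> real (Suc k)" using p by (intro mult_left_le) auto
    then have "\<lfloor>real (Suc k) * p\<rfloor> \<le> int (Suc k)" by linarith
    then have "nat \<lfloor>real (Suc k) * p\<rfloor> \<le> Suc k" by linarith
    then show "\<exists>k. \<exists>j\<le>Suc k. X (r * (real j / real (Suc k))) \<omega> < c + 1 / real (Suc n)" using k by blast
  qed
next
  assume R: "\<forall>n. \<exists>k. \<exists>j\<le>Suc k. X (r * (real j / real (Suc k))) \<omega> < c + 1 / real (Suc n)"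
  have "continuous_on {0..r} (\<lambda>t. X t \<omega>)" by (rule continuous_on_subset[OF continuous_X[OF w]]) auto
  then obtain s where s: "s \<in> {0..r}" and min: "\<And>v. v \<in> {0..r} \<Longrightarrow> X s \<omega> \<le> X v \<omega>"
    using continuous_attains_inf[of "{0..r}" "\<lambda>t. X t \<omega>"] r by auto
  have "X s \<omega> \<le> c + 1 / real (Suc n)" for n
  proof -
    obtain k j where kj: "j \<le> Suc k" "X (r * (real j / real (Suc k))) \<omega> < c + 1 / real (Suc n)" using R by blast
    have "real j / real (Suc k) \<le> 1" using kj(1) by (simp add: divide_le_eq del: of_nat_Suc)
    then have "r * (real j / real (Suc k)) \<le> r" using r by (rule mult_left_le)
    then have "r * (real j / real (Suc k)) \<in> {0..r}" using r by simp
    with min[OF this] kj(2) show ?thesis by simp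
  qed
  moreover have "(\<lambda>n. c + 1 / real (Suc n)) \<longlonglongrightarrow> c + 0"
    by (intro tendsto_add tendsto_const) (simp add: LIMSEQ_inverse_real_of_nat inverse_eq_divide[symmetric] del: of_nat_Suc)
  ultimately have "X s \<omega> \<le> c" by (intro LIMSEQ_le_const[of "\<lambda>n. c + 1 / real (Suc n)"]) auto
  then show "\<exists>s\<in>{0..r}. X s \<omega> \<le> c" using s by blast
qed

lemma hit_stopping_time: "stopping_time F (hit c)"
proof
  fix t :: ennreal
  show "Measurable.pred (F t) (\<lambda>\<omega>. hit c \<omega> \<le> t)"
  proof (cases t)
    case (real r)
    have mX: "(\<lambda>\<omega>. X (r * (real j / real (Suc k))) \<omega>) \<in> borel_measurable (F t)" if "j \<le> Suc k" for j k
    proof (rule F_mono)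
      have "real j / real (Suc k) \<le> 1" using that by (simp add: divide_le_eq del: of_nat_Suc)
      then have "r * (real j / real (Suc k)) \<le> r" using real(1) by (intro mult_left_le) auto
      then show "ennreal (r * (real j / real (Suc k))) \<le> t" unfolding real(2) by (rule ennreal_leI)
      show "X (r * (real j / real (Suc k))) \<in> borel_measurable (F (ennreal (r * (real j / real (Suc k)))))"
        using real(1) by (intro adapted_X) simp
    qed
    have "Measurable.pred (F t) (\<lambda>\<omega>. \<forall>n. \<exists>k. \<exists>j\<le>Suc k. X (r * (real j / real (Suc k))) \<omega> < c + 1 / real (Suc n))"
    proof (rule pred_intros_countable(1), rule pred_intros_countable(2), rule pred_intros_countable(2))
      fix n k j :: nat
      show "Measurable.pred (F t) (\<lambda>\<omega>. j \<le> Suc k \<and> X (r * (real j / real (Suc k))) \<omega> < c + 1 / real (Suc n))"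
      proof (cases "j \<le> Suc k")
        case True
        have "Measurable.pred (F t) (\<lambda>\<omega>. X (r * (real j / real (Suc k))) \<omega> < c + 1 / real (Suc n))"
          by (rule borel_measurable_pred_less[OF mX[OF True] borel_measurable_const])
        then show ?thesis using True by simp
      qed simp
    qed
    moreover have "hit c \<omega> \<le> t \<longleftrightarrow> (\<forall>n. \<exists>k. \<exists>j\<le>Suc k. X (r * (real j / real (Suc k))) \<omega> < c + 1 / real (Suc n))"
      if "\<omega> \<in> space (F t)" for \<omega>
      using hit_le_iff[of \<omega> r c] path_reaches_iff[of \<omega> r c] that real by (simp add: space_F)
    ultimately show ?thesis by (subst measurable_cong)
  qed simp
qed

text \<open>The path starts strictly above \<open>c\<close>, so by the intermediate value theorem it
  takes the value \<open>c\<close> exactly at the passage. This exact value is what allows a test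
  function to be evaluated at the stopped process.\<close>

lemma hit_facts:
  assumes w: "\<omega> \<in> space M" and c: "c < X 0 \<omega>"
  shows "hit c \<omega> \<noteq> 0"
    and "hit c \<omega> \<noteq> \<infinity> \<Longrightarrow> X (enn2real (hit c \<omega>)) \<omega> = c"
    and "0 \<le> s \<Longrightarrow> ennreal s \<le> hit c \<omega> \<Longrightarrow> c \<le> X s \<omega>"
proof -
  have fin: "\<exists>T>0. hit c \<omega> = ennreal T \<and> X T \<omega> = c \<and> (\<forall>s. 0 \<le> s \<longrightarrow> s < T \<longrightarrow> c < X s \<omega>)"
    if "hit c \<omega> \<noteq> \<infinity>"
  proof -
    from that obtain t where t: "0 \<le> t" "X t \<omega> \<le> c" by (auto simp: hit_def split: if_splits)
    obtain T where T: "0 \<le> T" "hit c \<omega> = ennreal T" "X T \<omega> \<le> c" "\<And>s. 0 \<le> s \<Longrightarrow> s < T \<Longrightarrow> c < X s \<omega>"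
      using hit_finite[OF w t] by metis
    have pos: "0 < T" using T c by (cases "T = 0") auto
    have "\<exists>s\<ge>0. s \<le> T \<and> X s \<omega> = c"
      by (rule IVT2'[of "\<lambda>t. X t \<omega>"]) (use T c in \<open>auto intro: continuous_on_subset[OF continuous_X[OF w]]\<close>)
    then obtain s where s: "0 \<le> s" "s \<le> T" "X s \<omega> = c" by auto
    then have "s = T" using T(4)[of s] by (cases "s < T") auto
    then show ?thesis using s T pos by auto
  qed
  show "hit c \<omega> \<noteq> 0" using fin by (cases "hit c \<omega> = \<infinity>") auto
  show "X (enn2real (hit c \<omega>)) \<omega> = c" if "hit c \<omega> \<noteq> \<infinity>" using fin[OF that] by auto
  show "c \<le> X s \<omega>" if s: "0 \<le> s" "ennreal s \<le> hit c \<omega>"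
  proof (cases "hit c \<omega> = \<infinity>")
    case True
    then have "\<not> (\<exists>t\<ge>0. X t \<omega> \<le> c)" by (auto simp: hit_def split: if_splits)
    then show ?thesis using s by force
  next
    case False
    then obtain T where T: "0 < T" "hit c \<omega> = ennreal T" "X T \<omega> = c" "\<forall>s. 0 \<le> s \<longrightarrow> s < T \<longrightarrow> c < X s \<omega>"
      using fin by blast
    have "s \<le> T" using s T by (simp add: ennreal_le_iff)
    then show ?thesis using T s by (cases "s < T") (auto intro: less_imp_le)
  qed
qed

end

section \<open>The one-step Taylor estimate\<close>

locale regular_diffusion = diffusion M F W b \<sigma> x X
  for M :: "'a measure" and F :: "ennreal \<Rightarrow> 'a measure" and W :: "real \<Rightarrow> 'a \<Rightarrow> real"
    and b :: "real \<Rightarrow> real" and \<sigma> x :: real and X :: "real \<Rightarrow> 'a \<Rightarrow> real" +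
  fixes \<beta> \<Lambda> :: real
  assumes b_bounded: "\<bar>b y\<bar> \<le> \<beta>" and b_lipschitz: "\<bar>b y - b z\<bar> \<le> \<Lambda> * \<bar>y - z\<bar>"
begin

lemma \<beta>_nonneg: "0 \<le> \<beta>" using b_bounded[of 0] by simp

lemma \<Lambda>_nonneg: "0 \<le> \<Lambda>" using b_lipschitz[of 0 1] by simp

lemma continuous_b: "continuous_on A b"
  by (rule lipschitz_on_continuous_on[of \<Lambda>])
    (auto intro!: lipschitz_onI b_lipschitz \<Lambda>_nonneg simp: dist_real_def)

lemma measurable_b [measurable]: "b \<in> borel_measurable borel"
  using continuous_b by (rule borel_measurable_continuous_onI)

lemma increment_X:
  "AE \<omega> in M. \<forall>s t. 0 \<le> s \<longrightarrow> s \<le> t \<longrightarrow>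
    X t \<omega> - X s \<omega> = (LBINT u:{s..t}. b (X u \<omega>)) + \<sigma> * (W t \<omega> - W s \<omega>)"
  using sde AE_space
proof eventually_elim
  case (elim \<omega>)
  show ?case
  proof (intro allI impI)
    fix s t :: real assume st: "0 \<le> s" "s \<le> t"
    show "X t \<omega> - X s \<omega> = (LBINT u:{s..t}. b (X u \<omega>)) + \<sigma> * (W t \<omega> - W s \<omega>)"
    proof -
      have "continuous_on {0..t} (\<lambda>u. b (X u \<omega>))"
        by (intro continuous_on_compose2[OF continuous_b[of UNIV]] continuous_on_subset[OF continuous_X[OF elim(2)]]) auto
      from set_lebesgue_integral_combine_Icc[OF this st] 
      show ?thesis using elim(1)[rule_format, of s] elim(1)[rule_format, of t] st by (simp add: algebra_simps)
    qed
  qed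
qed

text \<open>The drift contributes order \<open>t - s\<close> and the noise order
  \<open>sqrt (t - s)\<close>; on steps of length at most one the square root absorbs the
  drift.\<close>

lemma expectation_abs_increment_X:
  assumes "0 \<le> s" "s \<le> t" "t \<le> s + 1"
  shows "integrable M (\<lambda>\<omega>. \<bar>X t \<omega> - X s \<omega>\<bar>)"
    and "expectation (\<lambda>\<omega>. \<bar>X t \<omega> - X s \<omega>\<bar>) \<le> (\<beta> + \<bar>\<sigma>\<bar>) * sqrt (t - s)"
proof -
  have t: "0 \<le> t" using assms by simp
  note [measurable] = measurable_X[OF assms(1)] measurable_X[OF t]
  note W = expectation_abs_increment[OF assms(1,2)]
  let ?B = "\<lambda>\<omega>. \<beta> * (t - s) + \<bar>\<sigma>\<bar> * \<bar>W t \<omega> - W s \<omega>\<bar>"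
  have iB: "integrable M ?B" using W(1) by simp
  have le: "AE \<omega> in M. \<bar>X t \<omega> - X s \<omega>\<bar> \<le> ?B \<omega>"
    using increment_X
  proof eventually_elim
    case (elim \<omega>)
    have "\<bar>LBINT u:{s..t}. b (X u \<omega>)\<bar> \<le> \<beta> * (t - s)"
      by (rule abs_set_integral_le) (use assms b_bounded in auto)
    moreover have "\<bar>\<sigma> * (W t \<omega> - W s \<omega>)\<bar> = \<bar>\<sigma>\<bar> * \<bar>W t \<omega> - W s \<omega>\<bar>" by (simp add: abs_mult)
    ultimately show ?case using elim assms by fastforce
  qed
  show i: "integrable M (\<lambda>\<omega>. \<bar>X t \<omega> - X s \<omega>\<bar>)"
    by (rule Bochner_Integration.integrable_bound[OF iB]) (use le in \<open>auto\<close>)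
  have "expectation (\<lambda>\<omega>. \<bar>X t \<omega> - X s \<omega>\<bar>) \<le> expectation ?B"
    using i iB le by (rule integral_mono_AE)
  also have "\<dots> = \<beta> * (t - s) + \<bar>\<sigma>\<bar> * expectation (\<lambda>\<omega>. \<bar>W t \<omega> - W s \<omega>\<bar>)"
    using W(1) by (simp add: prob_space)
  also have "\<dots> \<le> \<beta> * sqrt (t - s) + \<bar>\<sigma>\<bar> * sqrt (t - s)"
  proof (intro add_mono mult_left_mono W(2) \<beta>_nonneg)
    have "(t - s)\<^sup>2 \<le> t - s" using assms mult_left_le[of "t - s" "t - s"] by (simp add: power2_eq_square)
    then show "t - s \<le> sqrt (t - s)" by (rule real_le_rsqrt)
  qed simp
  finally show "expectation (\<lambda>\<omega>. \<bar>X t \<omega> - X s \<omega>\<bar>) \<le> (\<beta> + \<bar>\<sigma>\<bar>) * sqrt (t - s)"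
    by (simp add: algebra_simps)
qed

end

section \<open>Test functions with Lipschitz second derivative\<close>

locale smooth_test = regular_diffusion M F W b \<sigma> x X \<beta> \<Lambda>
  for M :: "'a measure" and F :: "ennreal \<Rightarrow> 'a measure" and W :: "real \<Rightarrow> 'a \<Rightarrow> real"
    and b :: "real \<Rightarrow> real" and \<sigma> x :: real and X :: "real \<Rightarrow> 'a \<Rightarrow> real" and \<beta> \<Lambda> +
  fixes f f' f'' :: "real \<Rightarrow> real" and C :: real
  assumes f_deriv: "(f has_real_derivative f' y) (at y)"
    and f'_deriv: "(f' has_real_derivative f'' y) (at y)"
    and f_bounded: "\<bar>f y\<bar> \<le> C" and f'_bounded: "\<bar>f' y\<bar> \<le> C" and f''_bounded: "\<bar>f'' y\<bar> \<le> C"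
    and f''_lipschitz: "\<bar>f'' y - f'' z\<bar> \<le> C * \<bar>y - z\<bar>"
begin

text \<open>\<open>G\<close> is the generator of the diffusion applied to \<open>f\<close>.\<close>

definition G :: "real \<Rightarrow> real" where
  "G y = b y * f' y + \<sigma>\<^sup>2 / 2 * f'' y"

lemma C_nonneg: "0 \<le> C" using f_bounded[of 0] by simp

lemma continuous_f: "continuous_on A f" "continuous_on A f'" "continuous_on A f''"
proof -
  show "continuous_on A f" "continuous_on A f'"
    using f_deriv f'_deriv by (auto intro!: continuous_at_imp_continuous_on DERIV_isCont)
  show "continuous_on A f''"
    by (rule lipschitz_on_continuous_on[of C])
      (auto intro!: lipschitz_onI f''_lipschitz C_nonneg simp: dist_real_def)
qed

lemma measurable_f [measurable]:
  "f \<in> borel_measurable borel" "f' \<in> borel_measurable borel" "f'' \<in> borel_measurable borel"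
  using continuous_f by (auto intro: borel_measurable_continuous_onI)

lemma measurable_G [measurable]: "G \<in> borel_measurable borel"
  unfolding G_def[abs_def] by measurable

lemma G_bounded: "\<bar>G y\<bar> \<le> \<beta> * C + \<sigma>\<^sup>2 / 2 * C"
proof -
  have "\<bar>b y * f' y\<bar> \<le> \<beta> * C" "\<bar>\<sigma>\<^sup>2 / 2 * f'' y\<bar> \<le> \<sigma>\<^sup>2 / 2 * C"
    unfolding abs_mult using b_bounded f'_bounded f''_bounded \<beta>_nonneg
    by (auto intro!: mult_mono)
  then show ?thesis unfolding G_def by linarith
qed

lemma G_lipschitz: "\<bar>G y - G z\<bar> \<le> (\<Lambda> * C + \<beta> * C + \<sigma>\<^sup>2 / 2 * C) * \<bar>y - z\<bar>"
proof -
  have "G y - G z = (b y - b z) * f' y + b z * (f' y - f' z) + \<sigma>\<^sup>2 / 2 * (f'' y - f'' z)"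
    unfolding G_def by (simp add: field_simps)
  moreover have "\<bar>(b y - b z) * f' y\<bar> \<le> (\<Lambda> * \<bar>y - z\<bar>) * C"
    unfolding abs_mult using \<Lambda>_nonneg by (intro mult_mono b_lipschitz f'_bounded) auto
  moreover have "\<bar>b z * (f' y - f' z)\<bar> \<le> \<beta> * (C * \<bar>y - z\<bar>)"
    unfolding abs_mult using \<beta>_nonneg
    by (intro mult_mono b_bounded lipschitz_of_bounded_derivative[OF f'_deriv f''_bounded]) auto
  moreover have "\<bar>\<sigma>\<^sup>2 / 2 * (f'' y - f'' z)\<bar> \<le> \<sigma>\<^sup>2 / 2 * (C * \<bar>y - z\<bar>)"
    unfolding abs_mult by (intro mult_mono f''_lipschitz) auto
  moreover have "(\<Lambda> * C + \<beta> * C + \<sigma>\<^sup>2 / 2 * C) * \<bar>y - z\<bar>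
      = (\<Lambda> * \<bar>y - z\<bar>) * C + \<beta> * (C * \<bar>y - z\<bar>) + \<sigma>\<^sup>2 / 2 * (C * \<bar>y - z\<bar>)"
    by (simp add: algebra_simps)
  ultimately show ?thesis by linarith
qed

text \<open>Lagrange's remainder of second order contains \<open>f''\<close> at an intermediate
  point; moving it to \<open>y\<close> costs one more factor \<open>\<bar>z - y\<bar>\<close> by
  Lipschitz continuity. The constant is not optimized.\<close>

lemma taylor_bound: "\<bar>f z - f y - f' y * (z - y) - f'' y / 2 * (z - y)\<^sup>2\<bar> \<le> C * \<bar>z - y\<bar> ^ 3"
proof (cases "z = y")
  case False
  define d where "d = (\<lambda>m::nat. if m = 0 then f else if m = 1 then f' else f'')"
  have "\<exists>t. (if z < y then z < t \<and> t < y else y < t \<and> t < z) \<and>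
      f z = (\<Sum>m<2. d m y / fact m * (z - y) ^ m) + d 2 t / fact 2 * (z - y) ^ 2"
    using False f_deriv f'_deriv
    by (intro Taylor[where a="min y z" and b="max y z"]) (auto simp: d_def less_2_cases_iff)
  then obtain t where t: "if z < y then z < t \<and> t < y else y < t \<and> t < z"
    and e: "f z = (\<Sum>m<2. d m y / fact m * (z - y) ^ m) + d 2 t / fact 2 * (z - y) ^ 2" by blast
  have "f z - f y - f' y * (z - y) - f'' y / 2 * (z - y)\<^sup>2 = (f'' t - f'' y) / 2 * (z - y)\<^sup>2"
    unfolding e by (simp add: d_def numeral_2_eq_2 field_simps)
  also have "\<bar>\<dots>\<bar> \<le> C * \<bar>z - y\<bar> * \<bar>z - y\<bar>\<^sup>2"
    unfolding abs_mult power_abs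
  proof (intro mult_right_mono)
    have "\<bar>t - y\<bar> \<le> \<bar>z - y\<bar>" using t by (auto split: if_splits)
    then have "C * \<bar>t - y\<bar> \<le> C * \<bar>z - y\<bar>" using C_nonneg by (rule mult_left_mono)
    with f''_lipschitz[of t y] show "\<bar>(f'' t - f'' y) / 2\<bar> \<le> C * \<bar>z - y\<bar>" by simp
  qed simp
  finally show ?thesis by (simp add: power2_eq_square power3_eq_cube mult.assoc)
qed simp

text \<open>A short-time Ito formula, tested against a bounded \<open>Y\<close> from the past
  instead of stated with conditional expectations. The three summands of the constant come from
  freezing the drift at time \<open>s\<close>, from the cubic Taylor remainder, and from replacing
  the squared increment of \<open>X\<close> by that of \<open>\<sigma> * W\<close>. Later only the
  order 3/2 in \<open>t - s\<close> matters.\<close>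

lemma one_step:
  assumes st: "0 \<le> s" "s < t" "t \<le> s + 1"
    and Y: "Y \<in> borel_measurable (F (ennreal s))" and Y1: "\<And>\<omega>. \<omega> \<in> space M \<Longrightarrow> \<bar>Y \<omega>\<bar> \<le> 1"
  shows "\<bar>expectation (\<lambda>\<omega>. Y \<omega> * (f (X t \<omega>) - f (X s \<omega>) - (t - s) * G (X s \<omega>)))\<bar>
    \<le> (C * \<Lambda> * (\<beta> + \<bar>\<sigma>\<bar>) + 4 * C * (\<beta> ^ 3 + 2 * \<bar>\<sigma>\<bar> ^ 3) + C / 2 * (\<beta>\<^sup>2 + 2 * \<beta> * \<bar>\<sigma>\<bar>)) * sqrt (t - s) ^ 3"
proof -
  define r where "r = sqrt (t - s)"
  have r: "0 < r" "r\<^sup>2 = t - s" "r \<le> 1" using st by (auto simp: r_def)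
  have t: "0 \<le> t" using st by simp
  note [measurable] = measurable_X[OF st(1)] measurable_X[OF t] F_measurable[OF Y]
    measurable_W[OF st(1)] measurable_W[OF t]
  note aX = adapted_X[OF st(1)]
  let ?Z = "\<lambda>\<omega>. W t \<omega> - W s \<omega>"
  let ?R = "\<lambda>\<omega>. LBINT u:{s..t}. b (X (max 0 u) \<omega>)"
  let ?\<phi> = "\<lambda>\<omega> u. Y \<omega> * f' (X s \<omega>) * (b (X (max 0 u) \<omega>) - b (X s \<omega>))"
  have mR [measurable]: "?R \<in> borel_measurable M"
    unfolding set_lebesgue_integral_def by measurable
  have Rmax: "(LBINT u:{s..t}. b (X u \<omega>)) = ?R \<omega>" for \<omega>
    using st by (intro set_lebesgue_integral_cong) auto
  have Rb: "\<bar>?R \<omega>\<bar> \<le> \<beta> * r\<^sup>2" for \<omega>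
    unfolding r by (rule abs_set_integral_le) (use st b_bounded in auto)
  have m\<phi>: "(\<lambda>(\<omega>, u). ?\<phi> \<omega> u) \<in> borel_measurable (M \<Otimes>\<^sub>M lborel)" by measurable
  have b\<phi>: "\<bar>?\<phi> \<omega> u\<bar> \<le> C * (\<Lambda> * \<bar>X (max 0 u) \<omega> - X s \<omega>\<bar>)" if "\<omega> \<in> space M" for \<omega> u
  proof -
    have "\<bar>Y \<omega> * f' (X s \<omega>)\<bar> \<le> 1 * C"
      unfolding abs_mult using Y1[OF that] f'_bounded by (intro mult_mono) auto
    then show ?thesis unfolding abs_mult[of _ "b _ - b _"] using b_lipschitz C_nonneg by (intro mult_mono) auto
  qed
  have b\<phi>2: "\<bar>?\<phi> \<omega> u\<bar> \<le> C * (2 * \<beta>)" if "\<omega> \<in> space M" for \<omega> u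
  proof -
    have "\<bar>Y \<omega> * f' (X s \<omega>)\<bar> \<le> 1 * C"
      unfolding abs_mult using Y1[OF that] f'_bounded by (intro mult_mono) auto
    moreover have "\<bar>b (X (max 0 u) \<omega>) - b (X s \<omega>)\<bar> \<le> 2 * \<beta>"
      using b_bounded[of "X (max 0 u) \<omega>"] b_bounded[of "X s \<omega>"] by linarith
    ultimately show ?thesis unfolding abs_mult[of _ "b _ - b _"] using C_nonneg by (intro mult_mono) auto
  qed
  have swap: "expectation (\<lambda>\<omega>. LBINT u:{s..t}. ?\<phi> \<omega> u) = (LBINT u:{s..t}. expectation (\<lambda>\<omega>. ?\<phi> \<omega> u))"
    "integrable M (\<lambda>\<omega>. LBINT u:{s..t}. ?\<phi> \<omega> u)"
    using expectation_set_integral_swap[OF m\<phi>, where C="C * (2 * \<beta>)"] b\<phi>2 by auto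
  have \<phi>int: "(LBINT u:{s..t}. ?\<phi> \<omega> u) = Y \<omega> * f' (X s \<omega>) * (?R \<omega> - r\<^sup>2 * b (X s \<omega>))" if "\<omega> \<in> space M" for \<omega>
  proof -
    have "continuous_on {s..t} (\<lambda>u. b (X (max 0 u) \<omega>))"
      by (intro continuous_on_compose2[OF continuous_b[of UNIV]] continuous_on_compose2[OF continuous_X[OF that]] continuous_intros) auto
    then have "set_integrable lborel {s..t} (\<lambda>u. b (X (max 0 u) \<omega>))" by (rule borel_integrable_atLeastAtMost')
    moreover have "set_integrable lborel {s..t} (\<lambda>u. b (X s \<omega>))"
      by (intro borel_integrable_atLeastAtMost' continuous_on_const)
    ultimately have "(LBINT u:{s..t}. b (X (max 0 u) \<omega>) - b (X s \<omega>)) = ?R \<omega> - (LBINT u:{s..t}. b (X s \<omega>))"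
      by (rule set_integral_diff)
    also have "(LBINT u:{s..t}. b (X s \<omega>)) = r\<^sup>2 * b (X s \<omega>)"
      using st r by (simp add: set_lebesgue_integral_def)
    finally show ?thesis by simp
  qed
  \<comment> \<open>\<open>T1\<close> and \<open>T3\<close> have mean zero by
    \<open>expectation_mult_increment\<close>. \<open>T2\<close> collects the variation of the drift
    during the step, \<open>T4\<close> the Taylor remainder with the squared increment of
    \<open>X\<close> replaced by that of \<open>\<sigma> * W\<close>.\<close>
  define T1 where "T1 = (\<lambda>\<omega>. Y \<omega> * f' (X s \<omega>) * ?Z \<omega>)"
  define T2 where "T2 = (\<lambda>\<omega>. LBINT u:{s..t}. ?\<phi> \<omega> u)"
  define T3 where "T3 = (\<lambda>\<omega>. Y \<omega> * f'' (X s \<omega>) * ((?Z \<omega>)\<^sup>2 - (t - s)))"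
  define T4 where "T4 = (\<lambda>\<omega>. Y \<omega> * (f (X t \<omega>) - f (X s \<omega>) - f' (X s \<omega>) * (?R \<omega> + \<sigma> * ?Z \<omega>)
      - f'' (X s \<omega>) / 2 * (\<sigma> * ?Z \<omega>)\<^sup>2))"
  have T1: "integrable M T1" "expectation T1 = 0"
    unfolding T1_def
    by (intro expectation_mult_increment[OF st(1,2), where C=C];
        use aX Y f'_bounded Y1 mult_mono[OF Y1 f'_bounded] in \<open>simp add: abs_mult\<close>)+
  have T3: "integrable M T3" "expectation T3 = 0"
    unfolding T3_def
    by (intro expectation_mult_increment[OF st(1,2), where C=C];
        use aX Y f''_bounded Y1 mult_mono[OF Y1 f''_bounded] in \<open>simp add: abs_mult\<close>)+
  have T2i: "integrable M T2" unfolding T2_def by (rule swap(2))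
  \<comment> \<open>After exchanging expectation and time integral, the Lipschitz drift costs
    \<open>sqrt (u - s)\<close> in mean at each \<open>u\<close>; this is the extra half
    power.\<close>
  have T2e: "\<bar>expectation T2\<bar> \<le> C * \<Lambda> * (\<beta> + \<bar>\<sigma>\<bar>) * r * (t - s)"
    unfolding T2_def swap(1)
  proof (rule abs_set_integral_le)
    fix u assume u: "s \<le> u" "u \<le> t"
    have X: "integrable M (\<lambda>\<omega>. \<bar>X u \<omega> - X s \<omega>\<bar>)"
      "expectation (\<lambda>\<omega>. \<bar>X u \<omega> - X s \<omega>\<bar>) \<le> (\<beta> + \<bar>\<sigma>\<bar>) * sqrt (u - s)"
      using expectation_abs_increment_X[of s u] u st by auto
    have "\<bar>expectation (\<lambda>\<omega>. ?\<phi> \<omega> u)\<bar> \<le> expectation (\<lambda>\<omega>. \<bar>?\<phi> \<omega> u\<bar>)"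
      by (rule integral_abs_bound)
    also have "\<dots> \<le> expectation (\<lambda>\<omega>. C * (\<Lambda> * \<bar>X u \<omega> - X s \<omega>\<bar>))"
    proof (rule integral_mono')
      show "integrable M (\<lambda>\<omega>. C * (\<Lambda> * \<bar>X u \<omega> - X s \<omega>\<bar>))" using X by simp
    qed (use b\<phi>[of _ u] u st C_nonneg \<Lambda>_nonneg in auto)
    also have "\<dots> = C * \<Lambda> * expectation (\<lambda>\<omega>. \<bar>X u \<omega> - X s \<omega>\<bar>)" by simp
    also have "\<dots> \<le> C * \<Lambda> * ((\<beta> + \<bar>\<sigma>\<bar>) * r)"
    proof (intro mult_left_mono order.trans[OF X(2)])
      show "sqrt (u - s) \<le> r" unfolding r_def using u by simp
    qed (use C_nonneg \<Lambda>_nonneg \<beta>_nonneg in auto)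
    finally show "\<bar>expectation (\<lambda>\<omega>. ?\<phi> \<omega> u)\<bar> \<le> C * \<Lambda> * (\<beta> + \<bar>\<sigma>\<bar>) * r" by (simp add: mult.assoc)
  qed (use st in simp)
  \<comment> \<open>A majorant of \<open>T4\<close>: the first part is the Taylor remainder, with
    the cube of the displacement split into drift and noise, the second the change of the square.
    Powers of \<open>r\<close> above the third are lowered to \<open>r ^ 3\<close> by
    \<open>r \<le> 1\<close>.\<close>
  let ?H = "\<lambda>\<omega>. 4 * C * (\<beta> ^ 3 * r ^ 3 + \<bar>\<sigma>\<bar> ^ 3 * \<bar>?Z \<omega>\<bar> ^ 3) + C / 2 * (\<beta>\<^sup>2 * r ^ 3 + 2 * \<beta> * r\<^sup>2 * \<bar>\<sigma>\<bar> * \<bar>?Z \<omega>\<bar>)"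
  note Z1 = expectation_abs_increment[OF st(1) less_imp_le[OF st(2)], folded r_def]
  note Z3 = expectation_abs_increment_cubed[OF st(1,2), folded r_def]
  have iH: "integrable M ?H" using Z1 Z3 by simp
  have T4b: "AE \<omega> in M. \<bar>T4 \<omega>\<bar> \<le> ?H \<omega>"
    using increment_X AE_space
  proof eventually_elim
    case (elim \<omega>)
    let ?D = "X t \<omega> - X s \<omega>"
    have D: "?D = ?R \<omega> + \<sigma> * ?Z \<omega>" using elim(1) st by (simp add: Rmax)
    have z: "\<bar>\<sigma> * ?Z \<omega>\<bar> = \<bar>\<sigma>\<bar> * \<bar>?Z \<omega>\<bar>" by (simp add: abs_mult)
    have rr: "r ^ 4 \<le> r ^ 3" "r ^ 6 \<le> r ^ 3" using r by (auto intro!: power_decreasing)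
    have "\<bar>?D\<bar> ^ 3 \<le> (\<beta> * r\<^sup>2 + \<bar>\<sigma>\<bar> * \<bar>?Z \<omega>\<bar>) ^ 3"
      unfolding D using Rb[of \<omega>] z abs_triangle_ineq[of "?R \<omega>" "\<sigma> * ?Z \<omega>"] by (intro power_mono) auto
    also have "\<dots> \<le> 4 * ((\<beta> * r\<^sup>2) ^ 3 + (\<bar>\<sigma>\<bar> * \<bar>?Z \<omega>\<bar>) ^ 3)"
    proof -
      have "(p + q) ^ 3 \<le> 4 * (p ^ 3 + q ^ 3)" if "0 \<le> p" "0 \<le> q" for p q :: real
      proof -
        have "0 \<le> 3 * ((p + q) * (p - q)\<^sup>2)" using that by simp
        also have "\<dots> = 4 * (p ^ 3 + q ^ 3) - (p + q) ^ 3"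
          by (simp add: power2_eq_square power3_eq_cube algebra_simps)
        finally show ?thesis by simp
      qed
      then show ?thesis using \<beta>_nonneg by simp
    qed
    also have "(\<beta> * r\<^sup>2) ^ 3 \<le> \<beta> ^ 3 * r ^ 3"
      using rr \<beta>_nonneg by (auto simp: power_mult_distrib power_mult[symmetric] intro!: mult_left_mono)
    finally have D3: "\<bar>?D\<bar> ^ 3 \<le> 4 * (\<beta> ^ 3 * r ^ 3 + \<bar>\<sigma>\<bar> ^ 3 * \<bar>?Z \<omega>\<bar> ^ 3)" by (simp add: power_mult_distrib)
    have "\<bar>?D\<^sup>2 - (\<sigma> * ?Z \<omega>)\<^sup>2\<bar> = \<bar>(?R \<omega>)\<^sup>2 + 2 * ?R \<omega> * (\<sigma> * ?Z \<omega>)\<bar>"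
      unfolding D by (simp add: power2_eq_square algebra_simps)
    also have "\<dots> \<le> \<bar>?R \<omega>\<bar>\<^sup>2 + 2 * \<bar>?R \<omega>\<bar> * (\<bar>\<sigma>\<bar> * \<bar>?Z \<omega>\<bar>)"
      using abs_triangle_ineq[of "(?R \<omega>)\<^sup>2" "2 * ?R \<omega> * (\<sigma> * ?Z \<omega>)"] by (simp add: abs_mult power_abs)
    also have "\<dots> \<le> (\<beta> * r\<^sup>2)\<^sup>2 + 2 * (\<beta> * r\<^sup>2) * (\<bar>\<sigma>\<bar> * \<bar>?Z \<omega>\<bar>)"
      using Rb[of \<omega>] by (intro add_mono power_mono mult_right_mono) auto
    also have "\<dots> \<le> \<beta>\<^sup>2 * r ^ 3 + 2 * \<beta> * r\<^sup>2 * \<bar>\<sigma>\<bar> * \<bar>?Z \<omega>\<bar>"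
      using mult_left_mono[OF rr(1), of "\<beta>\<^sup>2"] by (simp add: power_mult_distrib power_mult[symmetric] mult_ac)
    finally have D2: "\<bar>?D\<^sup>2 - (\<sigma> * ?Z \<omega>)\<^sup>2\<bar> \<le> \<beta>\<^sup>2 * r ^ 3 + 2 * \<beta> * r\<^sup>2 * \<bar>\<sigma>\<bar> * \<bar>?Z \<omega>\<bar>" .
    let ?q = "f'' (X s \<omega>) / 2"
    let ?e = "f (X t \<omega>) - f (X s \<omega>) - f' (X s \<omega>) * ?D - ?q * ?D\<^sup>2"
    have e1: "\<bar>?e\<bar> \<le> C * (4 * (\<beta> ^ 3 * r ^ 3 + \<bar>\<sigma>\<bar> ^ 3 * \<bar>?Z \<omega>\<bar> ^ 3))"
      using taylor_bound[of "X t \<omega>" "X s \<omega>"] mult_left_mono[OF D3 C_nonneg] by linarith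
    have e2: "\<bar>?q * (?D\<^sup>2 - (\<sigma> * ?Z \<omega>)\<^sup>2)\<bar> \<le> C / 2 * (\<beta>\<^sup>2 * r ^ 3 + 2 * \<beta> * r\<^sup>2 * \<bar>\<sigma>\<bar> * \<bar>?Z \<omega>\<bar>)"
      unfolding abs_mult[of ?q] using f''_bounded C_nonneg by (intro mult_mono D2) auto
    define e0 where "e0 = ?e"
    define q0 where "q0 = ?q * (?D\<^sup>2 - (\<sigma> * ?Z \<omega>)\<^sup>2)"
    have T4eq: "T4 \<omega> = Y \<omega> * (e0 + q0)"
    proof -
      have "p - q * z = (p - q * d) + q * (d - z)" for p q d z :: real by (simp add: algebra_simps)
      then show ?thesis unfolding T4_def e0_def q0_def D by (intro arg_cong[where f="(*) (Y \<omega>)"])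
    qed
    have "\<bar>T4 \<omega>\<bar> \<le> 1 * \<bar>e0 + q0\<bar>"
      unfolding T4eq abs_mult using Y1[OF elim(2)] by (intro mult_right_mono) auto
    then have "\<bar>T4 \<omega>\<bar> \<le> \<bar>e0\<bar> + \<bar>q0\<bar>" using abs_triangle_ineq[of e0 q0] by simp
    from order.trans[OF this add_mono[OF e1[folded e0_def] e2[folded q0_def]]]
    show ?case by (simp only: mult.assoc mult.left_commute[of C 4])
  qed
  have mT4: "T4 \<in> borel_measurable M" unfolding T4_def by measurable
  have T4i: "integrable M T4"
    by (rule Bochner_Integration.integrable_bound[OF iH mT4]) (use T4b in \<open>auto\<close>)
  have "\<bar>expectation T4\<bar> \<le> expectation (\<lambda>\<omega>. \<bar>T4 \<omega>\<bar>)" by (rule integral_abs_bound)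
  also have "\<dots> \<le> expectation ?H" using T4i iH T4b by (intro integral_mono_AE) auto
  also have "\<dots> = 4 * C * (\<beta> ^ 3 * r ^ 3 + \<bar>\<sigma>\<bar> ^ 3 * expectation (\<lambda>\<omega>. \<bar>?Z \<omega>\<bar> ^ 3))
      + C / 2 * (\<beta>\<^sup>2 * r ^ 3 + 2 * \<beta> * r\<^sup>2 * \<bar>\<sigma>\<bar> * expectation (\<lambda>\<omega>. \<bar>?Z \<omega>\<bar>))"
    using Z1(1) Z3(1) by (simp add: prob_space)
  also have "\<dots> \<le> 4 * C * (\<beta> ^ 3 * r ^ 3 + \<bar>\<sigma>\<bar> ^ 3 * (2 * r ^ 3))
      + C / 2 * (\<beta>\<^sup>2 * r ^ 3 + 2 * \<beta> * r\<^sup>2 * \<bar>\<sigma>\<bar> * r)"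
    using C_nonneg \<beta>_nonneg by (intro add_mono mult_left_mono order_refl Z1(2) Z3(2)) auto
  also have "\<dots> = (4 * C * (\<beta> ^ 3 + 2 * \<bar>\<sigma>\<bar> ^ 3) + C / 2 * (\<beta>\<^sup>2 + 2 * \<beta> * \<bar>\<sigma>\<bar>)) * r ^ 3"
    by (simp add: power2_eq_square power3_eq_cube algebra_simps)
  finally have T4e: "\<bar>expectation T4\<bar> \<le> (4 * C * (\<beta> ^ 3 + 2 * \<bar>\<sigma>\<bar> ^ 3) + C / 2 * (\<beta>\<^sup>2 + 2 * \<beta> * \<bar>\<sigma>\<bar>)) * r ^ 3" .
  have "expectation (\<lambda>\<omega>. Y \<omega> * (f (X t \<omega>) - f (X s \<omega>) - (t - s) * G (X s \<omega>)))
      = expectation (\<lambda>\<omega>. \<sigma> * T1 \<omega> + T2 \<omega> + \<sigma>\<^sup>2 / 2 * T3 \<omega> + T4 \<omega>)"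
  proof (rule Bochner_Integration.integral_cong[OF refl])
    fix \<omega> assume w: "\<omega> \<in> space M"
    show "Y \<omega> * (f (X t \<omega>) - f (X s \<omega>) - (t - s) * G (X s \<omega>)) = \<sigma> * T1 \<omega> + T2 \<omega> + \<sigma>\<^sup>2 / 2 * T3 \<omega> + T4 \<omega>"
      unfolding T1_def T2_def T3_def T4_def \<phi>int[OF w] G_def r(2)[symmetric]
      by (simp add: field_simps power2_eq_square)
  qed
  also have "\<dots> = expectation T2 + expectation T4"
    using T1 T2i T3 T4i by simp
  finally have "\<bar>expectation (\<lambda>\<omega>. Y \<omega> * (f (X t \<omega>) - f (X s \<omega>) - (t - s) * G (X s \<omega>)))\<bar>
      \<le> C * \<Lambda> * (\<beta> + \<bar>\<sigma>\<bar>) * r * (t - s)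
        + (4 * C * (\<beta> ^ 3 + 2 * \<bar>\<sigma>\<bar> ^ 3) + C / 2 * (\<beta>\<^sup>2 + 2 * \<beta> * \<bar>\<sigma>\<bar>)) * r ^ 3"
    using T2e T4e by linarith
  also have "\<dots> = (C * \<Lambda> * (\<beta> + \<bar>\<sigma>\<bar>) + 4 * C * (\<beta> ^ 3 + 2 * \<bar>\<sigma>\<bar> ^ 3) + C / 2 * (\<beta>\<^sup>2 + 2 * \<beta> * \<bar>\<sigma>\<bar>)) * r ^ 3"
    unfolding r(2)[symmetric] by (simp add: power2_eq_square power3_eq_cube algebra_simps)
  finally show ?thesis unfolding r_def .
qed

end

section \<open>Dynkin's formula\<close>

context smooth_test
begin

lemma measurable_compose_X: "\<phi> \<in> borel_measurable borel \<Longrightarrow> 0 \<le> t \<Longrightarrow> (\<lambda>\<omega>. \<phi> (X t \<omega>)) \<in> borel_measurable M"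
  using measurable_compose[OF measurable_X] by blast

lemma integrable_mult_X:
  fixes \<phi> :: "real \<Rightarrow> real" and D :: real
  assumes "Y \<in> borel_measurable M" "\<And>\<omega>. \<omega> \<in> space M \<Longrightarrow> \<bar>Y \<omega>\<bar> \<le> 1"
    and "\<phi> \<in> borel_measurable borel" "\<And>y. \<bar>\<phi> y\<bar> \<le> D" and t: "0 \<le> t"
  shows "integrable M (\<lambda>\<omega>. Y \<omega> * \<phi> (X t \<omega>))"
proof (rule integrable_const_bound[where B="1 * D"])
  show "AE \<omega> in M. norm (Y \<omega> * \<phi> (X t \<omega>)) \<le> 1 * D"
    using assms(2,4) by (intro AE_I2) (auto simp: abs_mult intro!: mult_mono[of _ 1 _ D, simplified])
  show "(\<lambda>\<omega>. Y \<omega> * \<phi> (X t \<omega>)) \<in> borel_measurable M"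
    using assms(1) measurable_compose_X[OF assms(3) t] by measurable
qed

text \<open>Lipschitz continuity of \<open>G\<close> turns the mean displacement of \<open>X\<close>
  into a modulus of order 1/2 in time. It serves both the left-hand derivative and the continuity of
  the derivative.\<close>

lemma expectation_G_X_modulus:
  assumes Y: "Y \<in> borel_measurable M" "\<And>\<omega>. \<omega> \<in> space M \<Longrightarrow> \<bar>Y \<omega>\<bar> \<le> 1"
    and "0 \<le> s" "s \<le> t" "t \<le> s + 1"
  shows "\<bar>expectation (\<lambda>\<omega>. Y \<omega> * G (X t \<omega>)) - expectation (\<lambda>\<omega>. Y \<omega> * G (X s \<omega>))\<bar>
    \<le> (\<Lambda> * C + \<beta> * C + \<sigma>\<^sup>2 / 2 * C) * (\<beta> + \<bar>\<sigma>\<bar>) * sqrt (t - s)"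
proof -
  let ?L = "\<Lambda> * C + \<beta> * C + \<sigma>\<^sup>2 / 2 * C"
  have L: "0 \<le> ?L" using C_nonneg \<beta>_nonneg \<Lambda>_nonneg by simp
  have i: "integrable M (\<lambda>\<omega>. Y \<omega> * G (X v \<omega>))" if "0 \<le> v" for v
    using integrable_mult_X[of Y G, OF Y measurable_G G_bounded that] .
  note X = expectation_abs_increment_X[OF assms(3-5)]
  have t: "0 \<le> t" using assms by simp
  have eq: "expectation (\<lambda>\<omega>. Y \<omega> * G (X t \<omega>)) - expectation (\<lambda>\<omega>. Y \<omega> * G (X s \<omega>))
      = expectation (\<lambda>\<omega>. Y \<omega> * G (X t \<omega>) - Y \<omega> * G (X s \<omega>))"
    by (rule Bochner_Integration.integral_diff[symmetric]) (rule i, fact)+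
  have "\<bar>expectation (\<lambda>\<omega>. Y \<omega> * G (X t \<omega>) - Y \<omega> * G (X s \<omega>))\<bar>
      \<le> expectation (\<lambda>\<omega>. \<bar>Y \<omega> * G (X t \<omega>) - Y \<omega> * G (X s \<omega>)\<bar>)"
    by (rule integral_abs_bound)
  also have "\<dots> \<le> expectation (\<lambda>\<omega>. ?L * \<bar>X t \<omega> - X s \<omega>\<bar>)"
  proof (rule integral_mono')
    show "integrable M (\<lambda>\<omega>. ?L * \<bar>X t \<omega> - X s \<omega>\<bar>)" using X(1) by simp
    fix \<omega> assume "\<omega> \<in> space M"
    then have "\<bar>Y \<omega> * (G (X t \<omega>) - G (X s \<omega>))\<bar> \<le> 1 * (?L * \<bar>X t \<omega> - X s \<omega>\<bar>)"
      unfolding abs_mult by (intro mult_mono G_lipschitz Y) auto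
    then show "\<bar>Y \<omega> * G (X t \<omega>) - Y \<omega> * G (X s \<omega>)\<bar> \<le> ?L * \<bar>X t \<omega> - X s \<omega>\<bar>"
      by (simp add: right_diff_distrib)
    show "0 \<le> ?L * \<bar>X t \<omega> - X s \<omega>\<bar>" using L by simp
  qed
  also have "\<dots> = ?L * expectation (\<lambda>\<omega>. \<bar>X t \<omega> - X s \<omega>\<bar>)" by simp
  also have "\<dots> \<le> ?L * ((\<beta> + \<bar>\<sigma>\<bar>) * sqrt (t - s))"
    by (rule mult_left_mono[OF X(2) L])
  finally show ?thesis unfolding eq by (simp only: mult.assoc)
qed

text \<open>Dividing the one-step error of order 3/2 by the step length leaves a square root that
  tends to 0, so no errors have to be summed over a partition. A variable \<open>Y\<close> known at
  time \<open>s\<close> is known at every later time, hence the derivative exists on all of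
  \<open>{s..}\<close>.\<close>

lemma expectation_f_X_derivative:
  assumes s: "0 \<le> s" "s \<le> u"
    and Y: "Y \<in> borel_measurable (F (ennreal s))" and Y1: "\<And>\<omega>. \<omega> \<in> space M \<Longrightarrow> \<bar>Y \<omega>\<bar> \<le> 1"
  shows "((\<lambda>t. expectation (\<lambda>\<omega>. Y \<omega> * f (X t \<omega>))) has_real_derivative
    expectation (\<lambda>\<omega>. Y \<omega> * G (X u \<omega>))) (at u within {s..})"
proof -
  let ?\<nu> = "\<lambda>t. expectation (\<lambda>\<omega>. Y \<omega> * f (X t \<omega>))"
  let ?\<kappa> = "\<lambda>t. expectation (\<lambda>\<omega>. Y \<omega> * G (X t \<omega>))"
  note YM = F_measurable[OF Y]
  have YF: "Y \<in> borel_measurable (F (ennreal t))" if "s \<le> t" for t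
    using that by (intro F_mono[OF _ Y]) (simp add: ennreal_leI)
  define K where "K = C * \<Lambda> * (\<beta> + \<bar>\<sigma>\<bar>) + 4 * C * (\<beta> ^ 3 + 2 * \<bar>\<sigma>\<bar> ^ 3) + C / 2 * (\<beta>\<^sup>2 + 2 * \<beta> * \<bar>\<sigma>\<bar>)"
  define K' where "K' = (\<Lambda> * C + \<beta> * C + \<sigma>\<^sup>2 / 2 * C) * (\<beta> + \<bar>\<sigma>\<bar>)"
  have K'0: "0 \<le> K'" unfolding K'_def using C_nonneg \<beta>_nonneg \<Lambda>_nonneg by simp
  have step: "\<bar>?\<nu> t - ?\<nu> v - (t - v) * ?\<kappa> v\<bar> \<le> K * (sqrt (t - v) * (t - v))"
    if "s \<le> v" "v < t" "t \<le> v + 1" for v t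
  proof -
    have v: "0 \<le> v" "0 \<le> t" using that s by auto
    have ii: "integrable M (\<lambda>\<omega>. Y \<omega> * f (X t \<omega>))" "integrable M (\<lambda>\<omega>. Y \<omega> * f (X v \<omega>))"
      "integrable M (\<lambda>\<omega>. Y \<omega> * G (X v \<omega>))"
      by (rule integrable_mult_X[OF YM Y1 _ _ v(2)] integrable_mult_X[OF YM Y1 _ _ v(1)],
        auto intro: f_bounded G_bounded)+
    have "?\<nu> t - ?\<nu> v - (t - v) * ?\<kappa> v =
      expectation (\<lambda>\<omega>. Y \<omega> * f (X t \<omega>) - Y \<omega> * f (X v \<omega>) - (t - v) * (Y \<omega> * G (X v \<omega>)))"
      using ii by simp
    also have "\<dots> = expectation (\<lambda>\<omega>. Y \<omega> * (f (X t \<omega>) - f (X v \<omega>) - (t - v) * G (X v \<omega>)))"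
      by (simp add: algebra_simps)
    also have "\<bar>\<dots>\<bar> \<le> K * sqrt (t - v) ^ 3"
      unfolding K_def by (rule one_step[OF v(1) that(2,3) YF[OF that(1)] Y1])
    also have "sqrt (t - v) ^ 3 = sqrt (t - v) * (t - v)"
      using that by (simp add: power3_eq_cube)
    finally show ?thesis .
  qed
  have main: "norm ((?\<nu> t - ?\<nu> u) / (t - u) - ?\<kappa> u) \<le> (K + K') * sqrt \<bar>t - u\<bar>"
    if t: "s \<le> t" "t \<noteq> u" "\<bar>t - u\<bar> < 1" for t
  proof -
    have "\<bar>?\<nu> t - ?\<nu> u - (t - u) * ?\<kappa> u\<bar> \<le> ((K + K') * sqrt \<bar>t - u\<bar>) * \<bar>t - u\<bar>"
    proof (cases "u < t")
      case True
      have "0 \<le> K' * (sqrt (t - u) * (t - u))" using K'0 True by simp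
      then show ?thesis using step[of u t] True s t by (simp add: algebra_simps)
    next
      \<comment> \<open>\<open>one_step\<close> is anchored at the left end of the step, here
        \<open>t\<close>. The modulus of \<open>G\<close> moves the expectation from
        \<open>t\<close> to \<open>u\<close> at a cost of the same order.\<close>
      case False
      then have tu: "t < u" using t by simp
      have 1: "\<bar>?\<nu> u - ?\<nu> t - (u - t) * ?\<kappa> t\<bar> \<le> K * (sqrt (u - t) * (u - t))"
        using step[of t u] tu t by simp
      have "\<bar>?\<kappa> u - ?\<kappa> t\<bar> \<le> K' * sqrt (u - t)"
        unfolding K'_def using expectation_G_X_modulus[OF YM Y1, of t u] tu t s by simp
      then have 2: "\<bar>(u - t) * (?\<kappa> u - ?\<kappa> t)\<bar> \<le> K' * (sqrt (u - t) * (u - t))"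
        unfolding abs_mult using tu mult_left_mono[of "\<bar>?\<kappa> u - ?\<kappa> t\<bar>" "K' * sqrt (u - t)" "u - t"] by (simp add: mult_ac)
      have "?\<nu> t - ?\<nu> u - (t - u) * ?\<kappa> u = - (?\<nu> u - ?\<nu> t - (u - t) * ?\<kappa> t) + (u - t) * (?\<kappa> u - ?\<kappa> t)"
        by (simp add: algebra_simps)
      then have "\<bar>?\<nu> t - ?\<nu> u - (t - u) * ?\<kappa> u\<bar> \<le> K * (sqrt (u - t) * (u - t)) + K' * (sqrt (u - t) * (u - t))"
        using 1 2 by linarith
      then show ?thesis using tu by (simp add: algebra_simps)
    qed
    moreover have "(?\<nu> t - ?\<nu> u) / (t - u) - ?\<kappa> u = (?\<nu> t - ?\<nu> u - (t - u) * ?\<kappa> u) / (t - u)"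
      using t(2) by (simp add: diff_divide_distrib)
    ultimately show ?thesis using t(2) by (simp add: abs_divide divide_le_eq)
  qed
  show ?thesis
    unfolding has_field_derivative_iff
  proof (rule LIM_zero_cancel, rule Lim_null_comparison)
    show "\<forall>\<^sub>F t in at u within {s..}. norm ((?\<nu> t - ?\<nu> u) / (t - u) - ?\<kappa> u) \<le> (K + K') * sqrt \<bar>t - u\<bar>"
      unfolding eventually_at by (rule exI[of _ 1]) (use main in \<open>auto simp: dist_real_def\<close>)
    have "((\<lambda>t. (K + K') * sqrt \<bar>t - u\<bar>) \<longlongrightarrow> (K + K') * sqrt \<bar>u - u\<bar>) (at u within {s..})"
      by (intro tendsto_intros)
    then show "((\<lambda>t. (K + K') * sqrt \<bar>t - u\<bar>) \<longlongrightarrow> 0) (at u within {s..})" by simp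
  qed
qed

lemma expectation_G_X_continuous:
  assumes s: "0 \<le> s" and Y: "Y \<in> borel_measurable M" and Y1: "\<And>\<omega>. \<omega> \<in> space M \<Longrightarrow> \<bar>Y \<omega>\<bar> \<le> 1"
  shows "continuous_on {s..t} (\<lambda>u. expectation (\<lambda>\<omega>. Y \<omega> * G (X u \<omega>)))"
  unfolding continuous_on_def
proof (intro ballI)
  let ?\<kappa> = "\<lambda>t. expectation (\<lambda>\<omega>. Y \<omega> * G (X t \<omega>))"
  let ?K = "(\<Lambda> * C + \<beta> * C + \<sigma>\<^sup>2 / 2 * C) * (\<beta> + \<bar>\<sigma>\<bar>)"
  fix u assume u: "u \<in> {s..t}"
  show "(?\<kappa> \<longlongrightarrow> ?\<kappa> u) (at u within {s..t})"
  proof (rule LIM_zero_cancel, rule Lim_null_comparison)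
    show "\<forall>\<^sub>F v in at u within {s..t}. norm (?\<kappa> v - ?\<kappa> u) \<le> ?K * sqrt \<bar>v - u\<bar>"
      unfolding eventually_at
    proof (intro exI[of _ 1] conjI ballI impI)
      fix v assume v: "v \<in> {s..t}" "v \<noteq> u \<and> dist v u < 1"
      show "norm (?\<kappa> v - ?\<kappa> u) \<le> ?K * sqrt \<bar>v - u\<bar>"
      proof (cases "v \<le> u")
        case True
        with expectation_G_X_modulus[OF Y Y1, of v u] u v s show ?thesis
          by (simp add: dist_real_def abs_minus_commute)
      next
        case False
        with expectation_G_X_modulus[OF Y Y1, of u v] u v s show ?thesis
          by (simp add: dist_real_def)
      qed
    qed simp
    have "((\<lambda>v. ?K * sqrt \<bar>v - u\<bar>) \<longlongrightarrow> ?K * sqrt \<bar>u - u\<bar>) (at u within {s..t})"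
      by (intro tendsto_intros)
    then show "((\<lambda>v. ?K * sqrt \<bar>v - u\<bar>) \<longlongrightarrow> 0) (at u within {s..t})" by simp
  qed
qed

end

text \<open>\<open>grid_index \<tau> n \<omega> / n\<close> is \<open>\<tau> \<omega>\<close> rounded up to the grid of mesh \<open>1/n\<close> and truncated at \<open>n\<close>.\<close>

definition grid_index :: "('a \<Rightarrow> ennreal) \<Rightarrow> nat \<Rightarrow> 'a \<Rightarrow> nat" where
  "grid_index \<tau> n \<omega> = (LEAST i. n * n \<le> i \<or> \<tau> \<omega> \<le> ennreal (real i / real n))"

lemma grid_index:
  shows "n * n \<le> grid_index \<tau> n \<omega> \<or> \<tau> \<omega> \<le> ennreal (real (grid_index \<tau> n \<omega>) / real n)"
    and "grid_index \<tau> n \<omega> \<le> n * n"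
    and "i < grid_index \<tau> n \<omega> \<Longrightarrow> ennreal (real i / real n) < \<tau> \<omega>"
proof -
  let ?P = "\<lambda>i. n * n \<le> i \<or> \<tau> \<omega> \<le> ennreal (real i / real n)"
  show "?P (grid_index \<tau> n \<omega>)" unfolding grid_index_def by (rule LeastI[of ?P "n * n"]) simp
  show "grid_index \<tau> n \<omega> \<le> n * n" unfolding grid_index_def by (rule Least_le) simp
  show "i < grid_index \<tau> n \<omega> \<Longrightarrow> ennreal (real i / real n) < \<tau> \<omega>"
    unfolding grid_index_def by (drule not_less_Least) auto
qed

lemma grid_index_bounds:
  assumes "0 < n"
  shows "real (grid_index \<tau> n \<omega>) / real n \<le> real n"
    and "\<tau> \<omega> = \<infinity> \<Longrightarrow> real (grid_index \<tau> n \<omega>) / real n = real n"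
    and "0 \<le> T \<Longrightarrow> \<tau> \<omega> = ennreal T \<Longrightarrow> real (grid_index \<tau> n \<omega>) / real n \<le> T + 1 / real n"
    and "0 \<le> T \<Longrightarrow> T \<le> real n \<Longrightarrow> \<tau> \<omega> = ennreal T \<Longrightarrow> T \<le> real (grid_index \<tau> n \<omega>) / real n"
proof -
  let ?J = "grid_index \<tau> n \<omega>"
  have le: "real ?J \<le> real n * real n" using grid_index(2)[of \<tau> n \<omega>] by (metis of_nat_le_iff of_nat_mult)
  then show "real ?J / real n \<le> real n" using assms by (simp add: divide_le_eq)
  show "real ?J / real n = real n" if "\<tau> \<omega> = \<infinity>"
  proof -
    have "n * n \<le> ?J" using grid_index(1)[of n \<tau> \<omega>] that by (auto simp: top_unique)
    then have "?J = n * n" using grid_index(2)[of \<tau> n \<omega>] by simp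
    then show ?thesis using assms by simp
  qed
  \<comment> \<open>The predecessor of the index still lies strictly before the stopping time, so
    rounding up overshoots by at most one mesh width. Index 0 has no predecessor and is
    trivial.\<close>
  show "real ?J / real n \<le> T + 1 / real n" if T: "0 \<le> T" "\<tau> \<omega> = ennreal T"
  proof (cases "?J")
    case (Suc i)
    then have "ennreal (real i / real n) < ennreal T" using grid_index(3)[of i \<tau> n \<omega>] T by simp
    then have "real i / real n < T" using T by (simp add: ennreal_less_iff)
    then show ?thesis unfolding Suc using assms by (simp add: field_simps)
  qed (use T in simp)
  show "T \<le> real ?J / real n" if T: "0 \<le> T" "T \<le> real n" "\<tau> \<omega> = ennreal T"
    using grid_index(1)[of n \<tau> \<omega>]
  proof
    assume "n * n \<le> ?J"
    then have "?J = n * n" using grid_index(2)[of \<tau> n \<omega>] by simp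
    then show ?thesis using assms T by simp
  next
    assume "\<tau> \<omega> \<le> ennreal (real ?J / real n)"
    then show ?thesis using T by (simp add: ennreal_le_iff)
  qed
qed

lemma grid_index_tendsto:
  assumes "0 \<le> T" "\<tau> \<omega> = ennreal T"
  shows "(\<lambda>n. real (grid_index \<tau> n \<omega>) / real n) \<longlonglongrightarrow> T"
proof (rule tendsto_sandwich[of "\<lambda>_. T" _ _ "\<lambda>n. T + 1 / real n"])
  have "\<forall>\<^sub>F n in sequentially. 0 < n \<and> T \<le> real n"
    using eventually_gt_at_top[of 0] eventually_ge_at_top[of "nat \<lceil>T\<rceil>"]
    by eventually_elim linarith
  then show "\<forall>\<^sub>F n in sequentially. T \<le> real (grid_index \<tau> n \<omega>) / real n"
    by eventually_elim (use grid_index_bounds(4)[of _ T \<tau> \<omega>] assms in auto)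
  show "\<forall>\<^sub>F n in sequentially. real (grid_index \<tau> n \<omega>) / real n \<le> T + 1 / real n"
    using eventually_gt_at_top[of 0] by eventually_elim (use grid_index_bounds(3)[of _ T \<tau> \<omega>] assms in auto)
  have "(\<lambda>n. T + 1 / real n) \<longlonglongrightarrow> T + 0" by (intro tendsto_intros lim_1_over_n)
  then show "(\<lambda>n. T + 1 / real n) \<longlonglongrightarrow> T" by simp
qed simp

locale discounted_test = smooth_test M F W b \<sigma> x X \<beta> \<Lambda> f f' f'' C
  for M :: "'a measure" and F :: "ennreal \<Rightarrow> 'a measure" and W :: "real \<Rightarrow> 'a \<Rightarrow> real"
    and b :: "real \<Rightarrow> real" and \<sigma> x :: real and X :: "real \<Rightarrow> 'a \<Rightarrow> real" and \<beta> \<Lambda>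
    and f f' f'' :: "real \<Rightarrow> real" and C +
  fixes \<alpha> :: real
  assumes \<alpha>_pos: "0 < \<alpha>"
begin

definition q :: "real \<Rightarrow> real" where
  "q y = \<alpha> * f y - G y"

definition Q :: real where
  "Q = \<alpha> * C + (\<beta> * C + \<sigma>\<^sup>2 / 2 * C)"

text \<open>The discounted value of \<open>f\<close> has drift
  \<open>- exp (- \<alpha> * t) * q (X t)\<close>; the integral compensates it, which makes this the
  martingale behind Dynkin's formula.\<close>

definition mart :: "real \<Rightarrow> 'a \<Rightarrow> real" where
  "mart t \<omega> = exp (- \<alpha> * t) * f (X t \<omega>) + (LBINT u:{0..t}. exp (- \<alpha> * u) * q (X (max 0 u) \<omega>))"

lemma q_bounded: "\<bar>q y\<bar> \<le> Q"
proof -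
  have "\<bar>\<alpha> * f y\<bar> \<le> \<alpha> * C" using f_bounded[of y] \<alpha>_pos by (simp add: abs_mult)
  then show ?thesis unfolding q_def Q_def using G_bounded[of y] by linarith
qed

lemma Q_nonneg: "0 \<le> Q" using q_bounded[of 0] by simp

lemma continuous_q: "continuous_on A q"
  unfolding q_def[abs_def] G_def[abs_def]
  by (intro continuous_intros continuous_f continuous_b)

lemma measurable_q [measurable]: "q \<in> borel_measurable borel"
  using continuous_q by (rule borel_measurable_continuous_onI)

lemmas continuous_q_path = continuous_path_integrand[where \<alpha>=\<alpha>, OF continuous_q[of UNIV]]

lemmas q_path_integrable = path_integrand_integrable[OF \<alpha>_pos continuous_q[of UNIV] q_bounded]

lemma mart_bounded:
  assumes "\<omega> \<in> space M" "0 \<le> t"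
  shows "\<bar>mart t \<omega>\<bar> \<le> C + Q / \<alpha>"
proof -
  have "\<bar>exp (- \<alpha> * t) * f (X t \<omega>)\<bar> \<le> 1 * C"
    unfolding abs_mult using f_bounded \<alpha>_pos assms by (intro mult_mono) auto
  then show ?thesis unfolding mart_def
    using q_path_integrable(2)[OF assms(1), of "{0..t}"] by force
qed

lemma measurable_mart [measurable]: "0 \<le> t \<Longrightarrow> mart t \<in> borel_measurable M"
  unfolding mart_def[abs_def] set_lebesgue_integral_def
  using measurable_compose_X[OF measurable_f(1)] by measurable

text \<open>The martingale property, with test variables \<open>Y\<close> in place of conditional
  expectations. The derivative of the discounted expectation of \<open>f\<close> is minus the
  discounted expectation of \<open>q\<close>, so the fundamental theorem of calculus and Fubini make
  the two parts of \<open>mart\<close> cancel.\<close>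

lemma mart_increment:
  assumes s: "0 \<le> s" "s \<le> t"
    and Y: "Y \<in> borel_measurable (F (ennreal s))" and Y1: "\<And>\<omega>. \<omega> \<in> space M \<Longrightarrow> \<bar>Y \<omega>\<bar> \<le> 1"
  shows "expectation (\<lambda>\<omega>. Y \<omega> * (mart t \<omega> - mart s \<omega>)) = 0"
proof -
  note YM = F_measurable[OF Y]
  have t: "0 \<le> t" using s by simp
  let ?\<nu> = "\<lambda>t. expectation (\<lambda>\<omega>. Y \<omega> * f (X t \<omega>))"
  let ?\<kappa> = "\<lambda>t. expectation (\<lambda>\<omega>. Y \<omega> * G (X t \<omega>))"
  have i: "integrable M (\<lambda>\<omega>. Y \<omega> * f (X v \<omega>))" "integrable M (\<lambda>\<omega>. Y \<omega> * G (X v \<omega>))" if "0 \<le> v" for v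
    using integrable_mult_X[of Y f, OF YM Y1 measurable_f(1) f_bounded that]
      integrable_mult_X[of Y G, OF YM Y1 measurable_G G_bounded that] by simp_all
  let ?d = "\<lambda>u. - \<alpha> * exp (- \<alpha> * u) * ?\<nu> u + exp (- \<alpha> * u) * ?\<kappa> u"
  have deriv: "((\<lambda>t. exp (- \<alpha> * t) * ?\<nu> t) has_real_derivative ?d u) (at u within {s..t})" if "s \<le> u" for u
  proof -
    have "(?\<nu> has_real_derivative ?\<kappa> u) (at u within {s..t})"
      by (rule DERIV_subset[OF expectation_f_X_derivative[OF s(1) that Y Y1]]) auto
    then show ?thesis by (auto intro!: derivative_eq_intros)
  qed
  have cont_\<nu>: "continuous_on {s..t} ?\<nu>"
    by (rule DERIV_continuous_on[where D="?\<kappa>"], rule DERIV_subset[OF expectation_f_X_derivative[OF s(1) _ Y Y1]]) auto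
  have cont: "continuous_on {s..t} ?d"
    by (intro continuous_intros cont_\<nu> expectation_G_X_continuous[OF s(1) YM Y1])
  let ?\<phi> = "\<lambda>\<omega> u. Y \<omega> * (exp (- \<alpha> * u) * q (X (max 0 u) \<omega>))"
  have sw: "(LBINT u:{s..t}. expectation (\<lambda>\<omega>. ?\<phi> \<omega> u)) = expectation (\<lambda>\<omega>. LBINT u:{s..t}. ?\<phi> \<omega> u)"
    and iI: "integrable M (\<lambda>\<omega>. LBINT u:{s..t}. ?\<phi> \<omega> u)"
  proof -
    have m: "(\<lambda>(\<omega>, u). ?\<phi> \<omega> u) \<in> borel_measurable (M \<Otimes>\<^sub>M lborel)"
      using YM by measurable
    have b: "\<bar>?\<phi> \<omega> u\<bar> \<le> 1 * (1 * Q)" if "\<omega> \<in> space M" "s \<le> u" "u \<le> t" for \<omega> u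
      unfolding abs_mult using Y1[OF that(1)] q_bounded that s \<alpha>_pos Q_nonneg by (intro mult_mono) auto
    show "(LBINT u:{s..t}. expectation (\<lambda>\<omega>. ?\<phi> \<omega> u)) = expectation (\<lambda>\<omega>. LBINT u:{s..t}. ?\<phi> \<omega> u)"
      by (rule expectation_set_integral_swap(1)[OF m b, symmetric])
    show "integrable M (\<lambda>\<omega>. LBINT u:{s..t}. ?\<phi> \<omega> u)"
      by (rule expectation_set_integral_swap(2)[OF m b])
  qed
  have "(LBINT u. indicator {s..t} u *\<^sub>R ?d u) = exp (- \<alpha> * t) * ?\<nu> t - exp (- \<alpha> * s) * ?\<nu> s"
    by (rule integral_FTC_atLeastAtMost[OF s(2) _ cont])
      (use deriv in \<open>auto simp: has_real_derivative_iff_has_vector_derivative[symmetric]\<close>)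
  also have "(LBINT u. indicator {s..t} u *\<^sub>R ?d u) = (LBINT u:{s..t}. - expectation (\<lambda>\<omega>. ?\<phi> \<omega> u))"
    unfolding set_lebesgue_integral_def
  proof (intro Bochner_Integration.integral_cong refl)
    fix u :: real
    show "indicator {s..t} u *\<^sub>R ?d u = indicator {s..t} u *\<^sub>R - expectation (\<lambda>\<omega>. ?\<phi> \<omega> u)"
    proof (cases "u \<in> {s..t}")
      case True
      then have u: "0 \<le> u" using s by simp
      have "expectation (\<lambda>\<omega>. ?\<phi> \<omega> u) = expectation (\<lambda>\<omega>. exp (- \<alpha> * u) * (\<alpha> * (Y \<omega> * f (X u \<omega>)) - Y \<omega> * G (X u \<omega>)))"
        using u by (simp add: q_def algebra_simps)
      also have "\<dots> = exp (- \<alpha> * u) * (\<alpha> * ?\<nu> u - ?\<kappa> u)"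
        using i[OF u] by simp
      finally show ?thesis using True by (simp add: algebra_simps)
    qed simp
  qed
  also have "\<dots> = - (LBINT u:{s..t}. expectation (\<lambda>\<omega>. ?\<phi> \<omega> u))"
    by (simp add: set_lebesgue_integral_def)
  also note sw
  finally have E: "exp (- \<alpha> * t) * ?\<nu> t - exp (- \<alpha> * s) * ?\<nu> s + expectation (\<lambda>\<omega>. LBINT u:{s..t}. ?\<phi> \<omega> u) = 0" by simp
  have "expectation (\<lambda>\<omega>. Y \<omega> * (mart t \<omega> - mart s \<omega>)) = expectation (\<lambda>\<omega>. exp (- \<alpha> * t) * (Y \<omega> * f (X t \<omega>))
      - exp (- \<alpha> * s) * (Y \<omega> * f (X s \<omega>)) + (LBINT u:{s..t}. ?\<phi> \<omega> u))"
  proof (rule Bochner_Integration.integral_cong[OF refl])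
    fix \<omega> assume w: "\<omega> \<in> space M"
    have "mart t \<omega> - mart s \<omega> = exp (- \<alpha> * t) * f (X t \<omega>) - exp (- \<alpha> * s) * f (X s \<omega>)
        + (LBINT u:{s..t}. exp (- \<alpha> * u) * q (X (max 0 u) \<omega>))"
      unfolding mart_def using set_lebesgue_integral_combine_Icc[OF continuous_q_path[OF w] s] by simp
    note incr = this
    show "Y \<omega> * (mart t \<omega> - mart s \<omega>) = exp (- \<alpha> * t) * (Y \<omega> * f (X t \<omega>))
      - exp (- \<alpha> * s) * (Y \<omega> * f (X s \<omega>)) + (LBINT u:{s..t}. ?\<phi> \<omega> u)"
      unfolding incr by (simp add: distrib_left right_diff_distrib mult.left_commute)
  qed
  also have "\<dots> = exp (- \<alpha> * t) * ?\<nu> t - exp (- \<alpha> * s) * ?\<nu> s + expectation (\<lambda>\<omega>. LBINT u:{s..t}. ?\<phi> \<omega> u)"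
    using i[OF t] i[OF s(1)] iI by simp
  finally show ?thesis using E by simp
qed

text \<open>Optional stopping for a time with values in a finite grid: the increment over step
  \<open>i\<close> enters exactly if \<open>\<tau>\<close> exceeds the left end of the step. This
  event is known at the left end, so every summand of the telescoping sum has mean zero.\<close>

lemma mart_grid:
  assumes \<tau>: "stopping_time F \<tau>"
  shows "(\<lambda>\<omega>. mart (real (grid_index \<tau> n \<omega>) / real n) \<omega>) \<in> borel_measurable M"
    and "expectation (\<lambda>\<omega>. mart (real (grid_index \<tau> n \<omega>) / real n) \<omega>) = expectation (mart 0)"
proof -
  let ?t = "\<lambda>i. real i / real n"
  let ?J = "grid_index \<tau> n"
  let ?Y = "\<lambda>i. indicator {\<omega> \<in> space M. ennreal (?t i) < \<tau> \<omega>} :: 'a \<Rightarrow> real"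
  have YF: "?Y i \<in> borel_measurable (F (ennreal (?t i)))" for i
    using stopping_timeD2[OF \<tau>, of "ennreal (?t i)"] space_F
    by (intro borel_measurable_indicator) (simp add: pred_def)
  have m: "mart (?t i) \<in> borel_measurable M" for i by (rule measurable_mart) simp
  have eq: "mart (?t (?J \<omega>)) \<omega> = mart 0 \<omega> + (\<Sum>i<n * n. ?Y i \<omega> * (mart (?t (Suc i)) \<omega> - mart (?t i) \<omega>))"
    if w: "\<omega> \<in> space M" for \<omega>
  proof -
    have "(\<Sum>i<n * n. ?Y i \<omega> * (mart (?t (Suc i)) \<omega> - mart (?t i) \<omega>))
        = (\<Sum>i<?J \<omega>. ?Y i \<omega> * (mart (?t (Suc i)) \<omega> - mart (?t i) \<omega>))"
    proof (rule sum.mono_neutral_right)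
      show "{..<?J \<omega>} \<subseteq> {..<n * n}" using grid_index(2) by auto
      show "\<forall>i\<in>{..<n * n} - {..<?J \<omega>}. ?Y i \<omega> * (mart (?t (Suc i)) \<omega> - mart (?t i) \<omega>) = 0"
      proof
        fix i assume i: "i \<in> {..<n * n} - {..<?J \<omega>}"
        \<comment> \<open>Since \<open>i < n * n\<close>, the index was stopped by
          \<open>\<tau>\<close> and not by the truncation.\<close>
        then have "\<tau> \<omega> \<le> ennreal (?t (?J \<omega>))" using grid_index(1)[of n \<tau> \<omega>] by auto
        also have "\<dots> \<le> ennreal (?t i)" using i by (intro ennreal_leI divide_right_mono) auto
        finally show "?Y i \<omega> * (mart (?t (Suc i)) \<omega> - mart (?t i) \<omega>) = 0" by (auto simp: indicator_def)
      qed
    qed simp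
    also have "\<dots> = (\<Sum>i<?J \<omega>. mart (?t (Suc i)) \<omega> - mart (?t i) \<omega>)"
      using grid_index(3)[of _ \<tau> n \<omega>] w by (intro sum.cong) auto
    also have "\<dots> = mart (?t (?J \<omega>)) \<omega> - mart 0 \<omega>"
      by (subst sum_lessThan_telescope[of "\<lambda>i. mart (?t i) \<omega>"]) simp
    finally show ?thesis by simp
  qed
  have mY: "?Y i \<in> borel_measurable M" for i using F_measurable[OF YF] .
  have mt: "(\<lambda>\<omega>. ?Y i \<omega> * (mart (?t (Suc i)) \<omega> - mart (?t i) \<omega>)) \<in> borel_measurable M" for i
    by (intro borel_measurable_times borel_measurable_diff mY m)
  have "(\<lambda>\<omega>. mart 0 \<omega> + (\<Sum>i<n * n. ?Y i \<omega> * (mart (?t (Suc i)) \<omega> - mart (?t i) \<omega>))) \<in> borel_measurable M"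
    by (intro borel_measurable_add borel_measurable_sum mt measurable_mart order_refl)
  then show "(\<lambda>\<omega>. mart (?t (?J \<omega>)) \<omega>) \<in> borel_measurable M"
    by (subst measurable_cong[OF eq])
  have it: "integrable M (\<lambda>\<omega>. ?Y i \<omega> * (mart (?t (Suc i)) \<omega> - mart (?t i) \<omega>))" for i
  proof (rule integrable_const_bound[OF _ mt])
    show "AE \<omega> in M. norm (?Y i \<omega> * (mart (?t (Suc i)) \<omega> - mart (?t i) \<omega>)) \<le> 2 * (C + Q / \<alpha>)"
    proof (rule AE_I2)
      fix \<omega> assume w: "\<omega> \<in> space M"
      show "norm (?Y i \<omega> * (mart (?t (Suc i)) \<omega> - mart (?t i) \<omega>)) \<le> 2 * (C + Q / \<alpha>)"
        using mart_bounded[OF w, of "?t i"] mart_bounded[OF w, of "?t (Suc i)"]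
        by (cases "\<omega> \<in> {\<omega> \<in> space M. ennreal (?t i) < \<tau> \<omega>}") auto
    qed
  qed
  have i0: "integrable M (mart 0)"
    by (rule integrable_const_bound[where B="C + Q / \<alpha>"]) (use mart_bounded in auto)
  have "expectation (\<lambda>\<omega>. mart (?t (?J \<omega>)) \<omega>) = expectation (\<lambda>\<omega>. mart 0 \<omega> + (\<Sum>i<n * n. ?Y i \<omega> * (mart (?t (Suc i)) \<omega> - mart (?t i) \<omega>)))"
    by (rule Bochner_Integration.integral_cong[OF refl eq])
  also have "\<dots> = expectation (mart 0) + (\<Sum>i<n * n. expectation (\<lambda>\<omega>. ?Y i \<omega> * (mart (?t (Suc i)) \<omega> - mart (?t i) \<omega>)))"
    by (subst Bochner_Integration.integral_add[OF i0], intro Bochner_Integration.integrable_sum it,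
        subst Bochner_Integration.integral_sum) (auto intro: it simp del: of_nat_Suc)
  also have "\<dots> = expectation (mart 0)"
  proof -
    have "expectation (\<lambda>\<omega>. ?Y i \<omega> * (mart (?t (Suc i)) \<omega> - mart (?t i) \<omega>)) = 0" for i
      by (rule mart_increment[OF _ _ YF]) (auto intro: divide_right_mono simp: indicator_def)
    then show ?thesis by simp
  qed
  finally show "expectation (\<lambda>\<omega>. mart (?t (?J \<omega>)) \<omega>) = expectation (mart 0)" .
qed

abbreviation stopped :: "('a \<Rightarrow> ennreal) \<Rightarrow> 'a \<Rightarrow> real" where
  "stopped \<equiv> discounted_integral \<alpha> q"

text \<open>For finite \<open>\<tau>\<close> the first part converges by path continuity; for
  infinite \<open>\<tau>\<close> the grid time is \<open>n\<close> and the discount removes the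
  bounded \<open>f\<close>. In the integral the indicators are eventually constant at every
  \<open>u\<close>, even at \<open>u = \<tau>\<close>, because times are rounded up.\<close>

lemma mart_grid_tendsto:
  assumes w: "\<omega> \<in> space M"
  shows "(\<lambda>n. mart (real (grid_index \<tau> n \<omega>) / real n) \<omega>)
    \<longlonglongrightarrow> discount \<alpha> (\<tau> \<omega>) * f (X (enn2real (\<tau> \<omega>)) \<omega>) + stopped \<tau> \<omega>"
proof -
  let ?t = "\<lambda>n. real (grid_index \<tau> n \<omega>) / real n"
  let ?g = "\<lambda>u. exp (- \<alpha> * u) * q (X (max 0 u) \<omega>)"
  let ?A = "{u. 0 \<le> u \<and> ennreal u \<le> \<tau> \<omega>}"
  have A: "?A \<in> sets borel" by measurable
  have 1: "(\<lambda>n. exp (- \<alpha> * ?t n) * f (X (?t n) \<omega>)) \<longlonglongrightarrow> discount \<alpha> (\<tau> \<omega>) * f (X (enn2real (\<tau> \<omega>)) \<omega>)"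
  proof (cases "\<tau> \<omega>")
    case (real T)
    note lim = grid_index_tendsto[of T \<tau> \<omega>, OF real]
    have "continuous_on {0..} (\<lambda>t. f (X t \<omega>))"
      by (intro continuous_on_compose2[OF continuous_f(1)[of UNIV]] continuous_X w) auto
    then have "(\<lambda>n. f (X (?t n) \<omega>)) \<longlonglongrightarrow> f (X T \<omega>)"
      by (rule continuous_on_tendsto_compose[OF _ lim]) (use real in auto)
    then have "(\<lambda>n. exp (- \<alpha> * ?t n) * f (X (?t n) \<omega>)) \<longlonglongrightarrow> exp (- \<alpha> * T) * f (X T \<omega>)"
      by (intro tendsto_intros lim)
    then show ?thesis using real by (simp add: discount_def)
  next
    case top
    have "(\<lambda>n. exp (- \<alpha> * ?t n) * f (X (?t n) \<omega>)) \<longlonglongrightarrow> 0"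
    proof (rule Lim_null_comparison)
      show "\<forall>\<^sub>F n in sequentially. norm (exp (- \<alpha> * ?t n) * f (X (?t n) \<omega>)) \<le> exp (- \<alpha> * real n) * C"
        using eventually_gt_at_top[of 0]
      proof eventually_elim
        case (elim n)
        then have "?t n = real n" using grid_index_bounds(2)[of n \<tau> \<omega>] top by (simp add: top_ennreal_def[symmetric] infinity_ennreal_def)
        then show ?case using f_bounded by (simp add: abs_mult)
      qed
      have "((\<lambda>t. exp (- \<alpha> * t)) \<longlongrightarrow> 0) at_top"
        using \<alpha>_pos by real_asymp
      then have "(\<lambda>n. exp (- \<alpha> * real n) * C) \<longlonglongrightarrow> 0 * C"
        by (intro tendsto_intros filterlim_compose[OF _ filterlim_real_sequentially])
      then show "(\<lambda>n. exp (- \<alpha> * real n) * C) \<longlonglongrightarrow> 0" by simp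
    qed
    then show ?thesis using top by (simp add: discount_def)
  qed
  have 2: "(\<lambda>n. LBINT u:{0..?t n}. ?g u) \<longlonglongrightarrow> stopped \<tau> \<omega>"
    unfolding discounted_integral_def set_lebesgue_integral_def
  proof (rule integral_dominated_convergence[where w="\<lambda>u. norm (indicator {0..} u *\<^sub>R ?g u)"])
    show "integrable lborel (\<lambda>u. norm (indicator {0..} u *\<^sub>R ?g u))"
      using q_path_integrable(1)[OF w, of "{0..}"] by (intro integrable_norm) (simp add: set_integrable_def)
    have g: "?g \<in> borel_measurable lborel"
      using borel_measurable_continuous_onI[OF continuous_q_path[OF w]] by simp
    show "(\<lambda>u. indicator ?A u *\<^sub>R ?g u) \<in> borel_measurable lborel"
      using A by (intro borel_measurable_scaleR borel_measurable_indicator g) simp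
    show "(\<lambda>u. indicator {0..?t n} u *\<^sub>R ?g u) \<in> borel_measurable lborel" for n
      by (intro borel_measurable_scaleR borel_measurable_indicator g) simp
    show "AE u in lborel. norm (indicator {0..?t n} u *\<^sub>R ?g u) \<le> norm (indicator {0..} u *\<^sub>R ?g u)" for n
      by (intro AE_I2) (auto simp: indicator_def)
    show "AE u in lborel. (\<lambda>n. indicator {0..?t n} u *\<^sub>R ?g u) \<longlonglongrightarrow> indicator ?A u *\<^sub>R ?g u"
    proof (rule AE_I2, rule tendsto_eventually)
      fix u :: real
      have "\<forall>\<^sub>F n in sequentially. u \<in> {0..?t n} \<longleftrightarrow> u \<in> ?A"
      proof (cases "0 \<le> u")
        case u: True
        show ?thesis
        proof (cases "\<tau> \<omega>")
          case (real T)
          show ?thesis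
          proof (cases "u \<le> T")
            case True
            have "\<forall>\<^sub>F n in sequentially. 0 < n \<and> T \<le> real n"
              using eventually_gt_at_top[of 0] eventually_ge_at_top[of "nat \<lceil>T\<rceil>"]
              by eventually_elim linarith
            then show ?thesis
            proof eventually_elim
              case (elim n)
              with grid_index_bounds(4)[of n T \<tau> \<omega>] real True have "u \<le> ?t n" by simp
              then show ?case using u True real by (simp add: ennreal_leI)
            qed
          next
            case False
            have "\<forall>\<^sub>F n in sequentially. ?t n < u"
              using grid_index_tendsto[of T \<tau> \<omega>, OF real] False by (intro order_tendstoD(2)) auto
            then show ?thesis
              by eventually_elim (use False real u in \<open>auto simp: ennreal_le_iff\<close>)
          qed
        next
          case top
          have "\<forall>\<^sub>F n in sequentially. 0 < n \<and> u \<le> real n"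
            using eventually_gt_at_top[of 0] eventually_ge_at_top[of "nat \<lceil>u\<rceil>"]
            by eventually_elim linarith
          then show ?thesis
          proof eventually_elim
            case (elim n)
            then have "?t n = real n" using grid_index_bounds(2)[of n \<tau> \<omega>] top by (simp add: infinity_ennreal_def)
            then show ?case using u top elim by simp
          qed
        qed
      qed simp
      then show "\<forall>\<^sub>F n in sequentially. indicator {0..?t n} u *\<^sub>R ?g u = indicator ?A u *\<^sub>R ?g u"
        by eventually_elim (simp only: indicator_def)
    qed
  qed
  show ?thesis unfolding mart_def by (rule tendsto_add[OF 1 2])
qed

text \<open>\<open>mart\<close> is bounded by \<open>C + Q / \<alpha>\<close> at all times, so
  dominated convergence leads from grid times to arbitrary \<open>\<tau>\<close>, infinite values
  included. There \<open>enn2real\<close> returns the default value 0, which is harmless because the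
  discount factor is 0.\<close>

lemma dynkin:
  assumes \<tau>: "stopping_time F \<tau>"
  shows "integrable M (\<lambda>\<omega>. discount \<alpha> (\<tau> \<omega>) * f (X (enn2real (\<tau> \<omega>)) \<omega>))"
    and "integrable M (stopped \<tau>)"
    and "expectation (\<lambda>\<omega>. discount \<alpha> (\<tau> \<omega>) * f (X (enn2real (\<tau> \<omega>)) \<omega>)) + expectation (stopped \<tau>) = f x"
proof -
  have m\<tau> [measurable]: "\<tau> \<in> borel_measurable M"
    by (rule measurable_stopping[OF \<tau>])
  let ?D = "\<lambda>\<omega>. discount \<alpha> (\<tau> \<omega>) * f (X (enn2real (\<tau> \<omega>)) \<omega>)"
  have mD [measurable]: "discount \<alpha> \<in> borel_measurable borel"
    unfolding discount_def[abs_def] by measurable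
  have mX: "(\<lambda>\<omega>. X (enn2real (\<tau> \<omega>)) \<omega>) \<in> borel_measurable M"
  proof -
    have "(\<lambda>\<omega>. (\<lambda>(\<omega>, t). X (max 0 t) \<omega>) (\<omega>, enn2real (\<tau> \<omega>))) \<in> borel_measurable M"
      by (rule measurable_compose[OF _ measurable_X_joint]) measurable
    then show ?thesis by simp
  qed
  have mDf: "?D \<in> borel_measurable M"
    using measurable_compose[OF mX measurable_f(1)] by measurable
  have d1: "\<bar>discount \<alpha> t\<bar> \<le> 1" for t
    using \<alpha>_pos by (auto simp: discount_def)
  show iD: "integrable M ?D"
  proof (rule integrable_const_bound[OF _ mDf])
    have "\<bar>?D \<omega>\<bar> \<le> 1 * C" for \<omega> unfolding abs_mult using d1 f_bounded by (intro mult_mono) auto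
    then show "AE \<omega> in M. norm (?D \<omega>) \<le> C" by simp
  qed
  show iS: "integrable M (stopped \<tau>)"
    by (rule discounted_integral_integrable[OF \<tau> \<alpha>_pos continuous_q q_bounded])
  note mS = borel_measurable_integrable[OF iS]
  have "(\<lambda>n. expectation (\<lambda>\<omega>. mart (real (grid_index \<tau> n \<omega>) / real n) \<omega>)) \<longlonglongrightarrow> expectation (\<lambda>\<omega>. ?D \<omega> + stopped \<tau> \<omega>)"
  proof (rule integral_dominated_convergence[where w="\<lambda>_. C + Q / \<alpha>"])
    show "AE \<omega> in M. (\<lambda>n. mart (real (grid_index \<tau> n \<omega>) / real n) \<omega>) \<longlonglongrightarrow> ?D \<omega> + stopped \<tau> \<omega>"
      by (rule AE_I2) (rule mart_grid_tendsto)
    show "AE \<omega> in M. norm (mart (real (grid_index \<tau> n \<omega>) / real n) \<omega>) \<le> C + Q / \<alpha>" for n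
      using mart_bounded by (intro AE_I2) simp
  qed (use mart_grid(1)[OF \<tau>] mDf mS in auto)
  then have "(\<lambda>n::nat. expectation (mart 0)) \<longlonglongrightarrow> expectation (\<lambda>\<omega>. ?D \<omega> + stopped \<tau> \<omega>)"
    by (simp only: mart_grid(2)[OF \<tau>])
  then have "expectation (mart 0) = expectation (\<lambda>\<omega>. ?D \<omega> + stopped \<tau> \<omega>)"
    by (rule LIMSEQ_unique[OF tendsto_const])
  also have "\<dots> = expectation ?D + expectation (stopped \<tau>)" using iD iS by simp
  finally have 1: "expectation ?D + expectation (stopped \<tau>) = expectation (mart 0)" by simp
  have "AE \<omega> in M. mart 0 \<omega> = f x"
    using X_0
  proof eventually_elim
    case (elim \<omega>)
    have "(LBINT u:{0..0::real}. g u) = 0" for g :: "real \<Rightarrow> real"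
      using abs_set_integral_le[of 0 0 g "\<bar>g 0\<bar>"] by simp
    with elim show ?case unfolding mart_def by simp
  qed
  then have "expectation (mart 0) = expectation (\<lambda>_. f x)"
    by (intro integral_cong_AE) auto
  then show "expectation ?D + expectation (stopped \<tau>) = f x" using 1 by (simp add: prob_space)
qed

end

section \<open>The free boundary problem\<close>

text \<open>Left of \<open>a\<close> the set integral is 0, and so is the increment of a primitive
  of \<open>\<phi>\<close>. Both therefore agree on the whole line, and the derivative is two-sided
  even at \<open>a\<close>.\<close>

lemma has_real_derivative_set_integral_upper:
  fixes \<phi> :: "real \<Rightarrow> real"
  assumes cont: "continuous_on UNIV \<phi>" and zero: "\<And>z. z \<le> a \<Longrightarrow> \<phi> z = 0"
  shows "((\<lambda>y. LBINT z:{a..y}. \<phi> z) has_real_derivative \<phi> y) (at y)"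
proof -
  have "\<exists>\<Phi>. \<forall>z::real. -\<infinity> < ereal z \<longrightarrow> ereal z < \<infinity> \<longrightarrow> (\<Phi> has_vector_derivative \<phi> z) (at z)"
    by (rule einterval_antiderivative) (use cont in \<open>auto simp: continuous_on_eq_continuous_at\<close>)
  then obtain \<Phi> where \<Phi>: "\<And>z. (\<Phi> has_real_derivative \<phi> z) (at z)"
    by (auto simp: has_real_derivative_iff_has_vector_derivative)
  have eq: "(LBINT z:{a..y}. \<phi> z) = \<Phi> y - \<Phi> a" for y
  proof (cases "a \<le> y")
    case True
    show ?thesis
      unfolding set_lebesgue_integral_def
      by (rule integral_FTC_atLeastAtMost[OF True])
        (use \<Phi> in \<open>auto simp: has_real_derivative_iff_has_vector_derivative[symmetric]
          intro: has_field_derivative_at_within continuous_on_subset[OF cont]\<close>)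
  next
    case False
    then have "\<Phi> a = \<Phi> y"
      by (intro DERIV_isconst_end[of y a \<Phi>] continuous_at_imp_continuous_on ballI DERIV_isCont[OF \<Phi>])
        (use \<Phi> zero in \<open>auto, metis less_eq_real_def\<close>)
    then show ?thesis using False by (simp add: set_lebesgue_integral_def)
  qed
  show ?thesis unfolding eq by (auto intro!: derivative_eq_intros \<Phi>)
qed

lemma exp_primitive:
  fixes c :: real
  shows "c \<noteq> 0 \<Longrightarrow> ((\<lambda>y. exp (c * y) / c) has_real_derivative exp (c * y)) (at y)"
  by (auto intro!: derivative_eq_intros)

text \<open>\<open>weight_eq\<close> says that \<open>exp (B * y) / cosh (A * y)\<close> and
  \<open>exp (- B * y) / cosh (A * y)\<close> are annihilated by L - \<alpha>. By
  \<open>A < B\<close> the first is unbounded at infinity, and the weight \<open>m\<close> is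
  integrable there.\<close>

locale weight =
  fixes \<alpha> \<sigma> A B :: real
  assumes \<alpha>_pos: "0 < \<alpha>" and \<sigma>_pos: "0 < \<sigma>" and A_pos: "0 < A" and A_less_B: "A < B"
    and weight_eq: "\<sigma>\<^sup>2 * (B\<^sup>2 - A\<^sup>2) = 2 * \<alpha>"
begin

lemma B_pos: "0 < B" using A_pos A_less_B by simp

text \<open>Up to a constant, the decaying solution \<open>exp (- B * z) / cosh (A * z)\<close>
  times the speed density \<open>(cosh (A * z))\<^sup>2\<close> of the diffusion.\<close>

definition m :: "real \<Rightarrow> real" where "m z = exp (- B * z) * cosh (A * z)"

text \<open>The integral of \<open>m\<close> over \<open>{y..}\<close> (see
  \<open>m_integral\<close>), kept as an explicit function so that estimates can compare
  derivatives.\<close>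

definition tail :: "real \<Rightarrow> real" where
  "tail y = (exp (- (B - A) * y) / (B - A) + exp (- (B + A) * y) / (B + A)) / 2"

lemma m_pos: "0 < m z" unfolding m_def by simp

lemma m_eq: "m z = (exp (- (B - A) * z) + exp (- (B + A) * z)) / 2"
proof -
  have "exp (- (B - A) * z) = exp (- B * z) * exp (A * z)" "exp (- (B + A) * z) = exp (- B * z) * exp (- (A * z))"
    by (simp_all add: exp_add[symmetric] algebra_simps)
  then show ?thesis unfolding m_def cosh_def by (simp add: algebra_simps)
qed

lemma continuous_m: "continuous_on S m"
  unfolding m_def[abs_def] by (intro continuous_intros)

lemma tail_deriv: "(tail has_real_derivative - m y) (at y)"
proof -
  have "((\<lambda>y. exp (- c * y) / c) has_real_derivative - exp (- c * y)) (at y)" if "0 < c" for c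
    using exp_primitive[of "- c" y] that DERIV_minus by fastforce
  from this[of "B - A"] this[of "B + A"]
  have "(tail has_real_derivative (- exp (- (B - A) * y) + - exp (- (B + A) * y)) / 2) (at y)"
    unfolding tail_def[abs_def] using A_pos A_less_B by (intro DERIV_cdivide DERIV_add) auto
  moreover have "(- exp (- (B - A) * y) + - exp (- (B + A) * y)) / 2 = - m y"
    unfolding m_eq by (simp add: add_divide_distrib)
  ultimately show ?thesis by simp
qed

text \<open>The growth \<open>cosh (A * y)\<close> allowed here is exactly what passing from
  \<open>u\<close> to \<open>w\<close> divides out.\<close>

lemma tail_le: "exp (B * y) * tail y \<le> cosh (A * y) / (B - A)"
proof -
  have "tail y \<le> (exp (- (B - A) * y) / (B - A) + exp (- (B + A) * y) / (B - A)) / 2"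
    unfolding tail_def using A_pos A_less_B by (intro divide_right_mono add_left_mono divide_left_mono) auto
  also have "\<dots> = m y / (B - A)"
  proof -
    have "(v / c + z / c) / 2 = (v + z) / 2 / c" for v z c :: real
      by (simp add: add_divide_distrib mult.commute)
    then show ?thesis unfolding m_eq .
  qed
  finally have "exp (B * y) * tail y \<le> exp (B * y) * (m y / (B - A))" by (intro mult_left_mono) auto
  also have "\<dots> = cosh (A * y) / (B - A)" unfolding m_def by (simp add: exp_minus)
  finally show ?thesis .
qed

lemma tail_tendsto: "(tail \<longlongrightarrow> 0) at_top"
proof -
  have "((\<lambda>y. exp (- c * y)) \<longlongrightarrow> 0) at_top" if "0 < c" for c :: real
    using that by real_asymp
  note lim = this[of "B - A"] this[of "B + A"]
  have "(tail \<longlongrightarrow> (0 / (B - A) + 0 / (B + A)) / 2) at_top"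
    unfolding tail_def[abs_def] using A_pos A_less_B by (intro tendsto_intros lim) auto
  then show ?thesis by simp
qed

lemma tanh_bounded: "\<bar>tanh (A * y)\<bar> \<le> 1"
  using tanh_real_bounds[of "A * y"] by auto

lemma tanh_lipschitz: "\<bar>tanh (A * y) - tanh (A * z)\<bar> \<le> A * \<bar>y - z\<bar>"
proof -
  have d: "((\<lambda>y. tanh (A * y)) has_real_derivative A * (1 - (tanh (A * y))\<^sup>2)) (at y)" for y
    by (auto intro!: derivative_eq_intros)
  have "\<bar>A * (1 - (tanh (A * y))\<^sup>2)\<bar> \<le> A" for y
    using tanh_bounded[of y] A_pos abs_square_le_1[of "tanh (A * y)"] by (simp add: abs_mult mult_left_le)
  then show ?thesis
    using field_differentiable_bound[of UNIV "\<lambda>y. tanh (A * y)" "\<lambda>y. A * (1 - (tanh (A * y))\<^sup>2)" A y z] d by auto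
qed

end

text \<open>
  For a source \<open>g\<close> that changes sign at most once, from negative to positive, the following locale
  constructs the bounded solution \<open>w\<close> of \<open>L w - \<alpha> w = - g\<close> with \<open>w = w' = 0\<close> at \<open>a\<close>. The equation for
  \<open>u = w cosh (A y)\<close> is \<open>u'' - B\<^sup>2 u = - 2 g cosh (A y) / \<sigma>\<^sup>2\<close>, which is solved by variation of constants;
  the centering of \<open>g\<close> removes the solution that grows like \<open>exp (B y)\<close>.
\<close>

locale source = weight \<alpha> \<sigma> A B for \<alpha> \<sigma> A B :: real +
  fixes g :: "real \<Rightarrow> real" and a D :: real
  assumes g_bounded: "\<bar>g z\<bar> \<le> D" and g_lipschitz: "\<bar>g y - g z\<bar> \<le> D * \<bar>y - z\<bar>"
    and g_zero: "z \<le> a \<Longrightarrow> g z = 0" and g_crossing: "(\<forall>y\<le>z. g y \<le> 0) \<or> (\<forall>y\<ge>z. 0 \<le> g y)"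
    and g_integrable: "set_integrable lborel {a..} (\<lambda>z. m z * g z)"
    and g_centered: "(LBINT z:{a..}. m z * g z) = 0"
begin

lemma D_nonneg: "0 \<le> D" using g_bounded[of 0] by simp

lemma continuous_g: "continuous_on S g"
  by (rule lipschitz_on_continuous_on[of D])
    (auto intro!: lipschitz_onI g_lipschitz D_nonneg simp: dist_real_def)

text \<open>Up to sign and a constant, \<open>K\<close> and \<open>J\<close> are the coefficients of
  \<open>exp (B * y)\<close> and \<open>exp (- B * y)\<close> in the variation of constants formula,
  started with value 0 at \<open>a\<close>.\<close>

definition K :: "real \<Rightarrow> real" where "K y = (LBINT z:{a..y}. m z * g z)"

definition J :: "real \<Rightarrow> real" where "J y = (LBINT z:{a..y}. exp (B * z) * cosh (A * z) * g z)"

lemma K_deriv: "(K has_real_derivative m y * g y) (at y)"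
  unfolding K_def[abs_def]
  by (rule has_real_derivative_set_integral_upper) (auto simp: g_zero intro!: continuous_intros continuous_m continuous_g)

lemma J_deriv: "(J has_real_derivative exp (B * y) * cosh (A * y) * g y) (at y)"
  unfolding J_def[abs_def]
  by (rule has_real_derivative_set_integral_upper) (auto simp: g_zero intro!: continuous_intros continuous_g)

lemma set_integral_Icc_self: "y \<le> a \<Longrightarrow> (LBINT z:{a..y}. \<phi> z * g z) = 0"
  by (cases "y = a") (auto simp: set_lebesgue_integral_def indicator_def g_zero intro!: integral_eq_zero_AE AE_I2)

lemma K_J_zero: "y \<le> a \<Longrightarrow> K y = 0" "y \<le> a \<Longrightarrow> J y = 0"
  unfolding K_def J_def by (rule set_integral_Icc_self, assumption)+

lemma K_tendsto: "(K \<longlongrightarrow> 0) at_top"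
  using tendsto_set_lebesgue_integral_at_top[of a lborel "\<lambda>z. m z * g z"] g_integrable g_centered
  unfolding K_def[abs_def] by simp

text \<open>\<open>K\<close> is 0 at \<open>a\<close> and tends to 0 at infinity by centering, while
  its derivative \<open>m y * g y\<close> changes sign at most once, from negative to positive. So
  \<open>K\<close> first falls and then rises back to 0.\<close>

lemma K_nonpos: "K y \<le> 0"
proof (cases "\<forall>v\<le>y. g v \<le> 0")
  case True
  show ?thesis
  proof (cases "a \<le> y")
    case ay: True
    have "K y \<le> K a"
    proof (rule DERIV_nonpos_imp_nonincreasing[OF ay])
      fix z assume "a \<le> z" "z \<le> y"
      then show "\<exists>d. (K has_real_derivative d) (at z) \<and> d \<le> 0"
        using K_deriv[of z] m_pos[of z] True by (auto simp: mult_le_0_iff intro!: exI)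
    qed
    then show ?thesis by (simp add: K_J_zero)
  qed (simp add: K_J_zero)
next
  case False
  have "\<forall>\<^sub>F z in at_top. K y \<le> K z"
    using eventually_ge_at_top[of y]
  proof eventually_elim
    case (elim z)
    show ?case
    proof (rule DERIV_nonneg_imp_nondecreasing[OF elim])
      fix v assume "y \<le> v" "v \<le> z"
      then show "\<exists>d. (K has_real_derivative d) (at v) \<and> 0 \<le> d"
        using K_deriv[of v] g_crossing[of y] m_pos[of v] False by (auto intro!: exI)
    qed
  qed
  then show ?thesis by (intro tendsto_lowerbound[OF K_tendsto]) auto
qed

lemma J_nonpos:
  assumes "\<And>v. v \<le> y \<Longrightarrow> g v \<le> 0"
  shows "J y \<le> 0"
proof (cases "a \<le> y")
  case ay: True
  have "J y \<le> J a"
  proof (rule DERIV_nonpos_imp_nonincreasing[OF ay])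
    fix z assume "a \<le> z" "z \<le> y"
    then show "\<exists>d. (J has_real_derivative d) (at z) \<and> d \<le> 0"
      using J_deriv[of z] assms[of z] by (auto simp: mult_le_0_iff intro!: exI)
  qed
  then show ?thesis by (simp add: K_J_zero)
qed (simp add: K_J_zero)

text \<open>By centering \<open>K y\<close> is minus the integral over \<open>{y..}\<close>, which
  the tail of \<open>m\<close> controls. In terms of derivatives: \<open>D * tail\<close> plus or
  minus \<open>K\<close> decreases to 0.\<close>

lemma K_bounded: "\<bar>exp (B * y) * K y\<bar> \<le> D / (B - A) * cosh (A * y)"
proof -
  have "\<bar>K y\<bar> \<le> D * tail y"
  proof -
    have *: "0 \<le> D * tail y + c * K y" if c: "c = 1 \<or> c = -1" for c
    proof -
      have "((\<lambda>z. D * tail z + c * K z) \<longlongrightarrow> D * 0 + c * 0) at_top"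
        by (intro tendsto_intros tail_tendsto K_tendsto)
      moreover have "\<forall>\<^sub>F z in at_top. D * tail z + c * K z \<le> D * tail y + c * K y"
        using eventually_ge_at_top[of y]
      proof eventually_elim
        case (elim z)
        show ?case
        proof (rule DERIV_nonpos_imp_nonincreasing[OF elim])
          fix v
          have "((\<lambda>z. D * tail z + c * K z) has_real_derivative D * (- m v) + c * (m v * g v)) (at v)"
            by (intro DERIV_add DERIV_cmult tail_deriv K_deriv)
          moreover have "D * (- m v) + c * (m v * g v) = - (m v * (D - c * g v))" by (simp add: algebra_simps)
          moreover have "0 \<le> D - c * g v" using g_bounded[of v] c by auto
          ultimately show "\<exists>d. ((\<lambda>z. D * tail z + c * K z) has_real_derivative d) (at v) \<and> d \<le> 0"
            using m_pos[of v] by (auto intro!: exI)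
        qed
      qed
      ultimately show ?thesis by (intro tendsto_upperbound[where F=at_top and f="\<lambda>z. D * tail z + c * K z"]) auto
    qed
    from *[of 1] *[of "-1"] show ?thesis by auto
  qed
  then have "\<bar>exp (B * y) * K y\<bar> \<le> D * (exp (B * y) * tail y)"
    by (simp add: abs_mult mult.left_commute)
  also have "\<dots> \<le> D * (cosh (A * y) / (B - A))"
    by (intro mult_left_mono tail_le D_nonneg)
  finally show ?thesis by simp
qed

text \<open>Here the comparison runs forward from \<open>a\<close>, where \<open>J\<close> vanishes:
  \<open>D * \<Theta>\<close> plus or minus \<open>J\<close> increases from a nonnegative value,
  with \<open>\<Theta>\<close> the positive primitive of
  \<open>exp (B * z) * cosh (A * z)\<close>.\<close>

lemma J_bounded: "\<bar>exp (- B * y) * J y\<bar> \<le> D / (B - A) * cosh (A * y)"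
proof (cases "a \<le> y")
  case True
  define \<Theta> where "\<Theta> z = (exp ((B + A) * z) / (B + A) + exp ((B - A) * z) / (B - A)) / 2" for z
  have d\<Theta>: "(\<Theta> has_real_derivative exp (B * z) * cosh (A * z)) (at z)" for z
  proof -
    have "exp ((B + A) * z) = exp (B * z) * exp (A * z)" "exp ((B - A) * z) = exp (B * z) * exp (- (A * z))"
      by (simp_all add: exp_add[symmetric] algebra_simps)
    then have eq: "exp (B * z) * cosh (A * z) = (exp ((B + A) * z) + exp ((B - A) * z)) / 2"
      unfolding cosh_def by (simp add: algebra_simps)
    have "(\<Theta> has_real_derivative (exp ((B + A) * z) + exp ((B - A) * z)) / 2) (at z)"
      unfolding \<Theta>_def[abs_def] using A_pos A_less_B
      by (intro DERIV_cdivide DERIV_add exp_primitive) auto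
    then show ?thesis unfolding eq .
  qed
  have *: "0 \<le> D * \<Theta> y + c * J y" if c: "c = 1 \<or> c = -1" for c
  proof -
    have "0 \<le> D * \<Theta> a + c * J a"
      using A_pos A_less_B D_nonneg by (simp add: K_J_zero \<Theta>_def)
    also have "\<dots> \<le> D * \<Theta> y + c * J y"
    proof (rule DERIV_nonneg_imp_nondecreasing[OF True])
      fix v
      have "((\<lambda>z. D * \<Theta> z + c * J z) has_real_derivative D * (exp (B * v) * cosh (A * v)) + c * (exp (B * v) * cosh (A * v) * g v)) (at v)"
        by (intro DERIV_add DERIV_cmult d\<Theta> J_deriv)
      moreover have "D * (exp (B * v) * cosh (A * v)) + c * (exp (B * v) * cosh (A * v) * g v)
          = (exp (B * v) * cosh (A * v)) * (D + c * g v)" by (simp add: algebra_simps)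
      moreover have "0 \<le> D + c * g v" using g_bounded[of v] c by auto
      ultimately show "\<exists>d. ((\<lambda>z. D * \<Theta> z + c * J z) has_real_derivative d) (at v) \<and> 0 \<le> d"
        by (auto intro!: exI)
    qed
    finally show ?thesis .
  qed
  from *[of 1] *[of "-1"] have "\<bar>J y\<bar> \<le> D * \<Theta> y" by auto
  then have "\<bar>exp (- B * y) * J y\<bar> \<le> D * (exp (- B * y) * \<Theta> y)"
    by (simp add: abs_mult mult.left_commute)
  also have "exp (- B * y) * \<Theta> y \<le> cosh (A * y) / (B - A)"
  proof -
    have "\<Theta> y \<le> (exp ((B + A) * y) / (B - A) + exp ((B - A) * y) / (B - A)) / 2"
      unfolding \<Theta>_def using A_pos A_less_B by (intro divide_right_mono add_right_mono divide_left_mono) auto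
    then have "exp (- B * y) * \<Theta> y \<le> exp (- B * y) * ((exp ((B + A) * y) / (B - A) + exp ((B - A) * y) / (B - A)) / 2)"
      by (intro mult_left_mono) auto
    also have "\<dots> = (exp (- B * y) * exp ((B + A) * y) + exp (- B * y) * exp ((B - A) * y)) / (2 * (B - A))"
    proof -
      have "e * ((v / c + z / c) / 2) = (e * v + e * z) / (2 * c)" for e v z c :: real
        by (simp add: add_divide_distrib distrib_left mult.commute)
      then show ?thesis .
    qed
    also have "\<dots> = cosh (A * y) / (B - A)"
      unfolding exp_add[symmetric] cosh_def using A_less_B by (simp add: field_simps)
    finally show ?thesis .
  qed
  finally show ?thesis using D_nonneg by (simp add: mult_left_mono)
next
  case False
  then show ?thesis using D_nonneg A_less_B by (simp add: K_J_zero)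
qed

text \<open>For \<open>y\<close> beyond \<open>a\<close> this is
  \<open>- 2 / (\<sigma>\<^sup>2 * B)\<close> times the integral of
  \<open>sinh (B * (y - z)) * cosh (A * z) * g z\<close> over \<open>{a..y}\<close>.\<close>

definition u :: "real \<Rightarrow> real" where "u y = (exp (- B * y) * J y - exp (B * y) * K y) / (\<sigma>\<^sup>2 * B)"

definition u' :: "real \<Rightarrow> real" where "u' y = - (exp (- B * y) * J y + exp (B * y) * K y) / \<sigma>\<^sup>2"

lemma eJ_deriv: "((\<lambda>y. exp (- B * y) * J y) has_real_derivative
    cosh (A * y) * g y - B * (exp (- B * y) * J y)) (at y)"
proof -
  have "((\<lambda>y. exp (- B * y)) has_real_derivative exp (- B * y) * (- B)) (at y)"
    by (auto intro!: derivative_eq_intros)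
  from DERIV_mult[OF this J_deriv] show ?thesis
    by (simp add: exp_minus algebra_simps)
qed

lemma eK_deriv: "((\<lambda>y. exp (B * y) * K y) has_real_derivative
    cosh (A * y) * g y + B * (exp (B * y) * K y)) (at y)"
proof -
  have "((\<lambda>y. exp (B * y)) has_real_derivative exp (B * y) * B) (at y)"
    by (auto intro!: derivative_eq_intros)
  from DERIV_mult[OF this K_deriv] show ?thesis
    by (simp add: m_def exp_minus algebra_simps)
qed

lemma u_deriv: "(u has_real_derivative u' y) (at y)"
proof -
  \<comment> \<open>\<open>c\<close> is the source term: it enters the derivatives of both products
    and cancels in their difference.\<close>
  have "(c - B * v - (c + B * z)) / (s * B) = - (v + z) / s" if "s \<noteq> 0" for c v z s
    using B_pos that by (simp add: field_simps)
  note eq = this[of "\<sigma>\<^sup>2" "cosh (A * y) * g y" "exp (- B * y) * J y" "exp (B * y) * K y"]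
  have "\<sigma>\<^sup>2 \<noteq> 0" using \<sigma>_pos by simp
  from DERIV_cdivide[OF DERIV_diff[OF eJ_deriv eK_deriv], of "\<sigma>\<^sup>2 * B" y] show ?thesis
    unfolding u_def[abs_def] u'_def eq[OF \<open>\<sigma>\<^sup>2 \<noteq> 0\<close>] .
qed

lemma u'_deriv: "(u' has_real_derivative B\<^sup>2 * u y - 2 * (cosh (A * y) * g y) / \<sigma>\<^sup>2) (at y)"
proof -
  \<comment> \<open>In the sum the two copies of the source term add up and become the inhomogeneity
    of the second-order equation.\<close>
  have "- (c - B * v + (c + B * z)) / s = B\<^sup>2 * ((v - z) / (s * B)) - 2 * c / s" if "s \<noteq> 0" for c v z s
    using B_pos that by (simp add: field_simps power2_eq_square)
  note eq = this[of "\<sigma>\<^sup>2" "cosh (A * y) * g y" "exp (- B * y) * J y" "exp (B * y) * K y"]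
  have "\<sigma>\<^sup>2 \<noteq> 0" using \<sigma>_pos by simp
  from DERIV_cdivide[OF DERIV_minus[OF DERIV_add[OF eJ_deriv eK_deriv]], of "\<sigma>\<^sup>2" y] show ?thesis
    unfolding u'_def[abs_def] u_def eq[OF \<open>\<sigma>\<^sup>2 \<noteq> 0\<close>] .
qed

text \<open>The operator of second order factors, and \<open>u' y + B * u y\<close> is
  \<open>- 2 * exp (B * y) * K y / \<sigma>\<^sup>2\<close>, which \<open>K_nonpos\<close> makes
  nonnegative. Hence \<open>u y * exp (B * y)\<close> increases from 0 at \<open>a\<close>.\<close>

lemma u_nonneg: "0 \<le> u y"
proof (cases "a \<le> y")
  case True
  have "u a * exp (B * a) \<le> u y * exp (B * y)"
  proof (rule DERIV_nonneg_imp_nondecreasing[OF True])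
    fix v
    have "((\<lambda>z. u z * exp (B * z)) has_real_derivative (u' v + B * u v) * exp (B * v)) (at v)"
      by (auto intro!: derivative_eq_intros u_deriv simp: algebra_simps)
    moreover have "0 \<le> u' v + B * u v"
    proof -
      have "u' v + B * u v = - (2 * exp (B * v) * K v) / \<sigma>\<^sup>2"
        unfolding u_def u'_def using B_pos \<sigma>_pos by (simp add: field_simps)
      also have "\<dots> \<ge> 0" using K_nonpos[of v] by (simp add: divide_le_0_iff mult_le_0_iff)
      finally show ?thesis .
    qed
    ultimately show "\<exists>d. ((\<lambda>z. u z * exp (B * z)) has_real_derivative d) (at v) \<and> 0 \<le> d"
      by (auto intro!: exI)
  qed
  moreover have "u a = 0" by (simp add: u_def K_J_zero)
  ultimately show ?thesis by (simp add: zero_le_mult_iff)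
qed (simp add: u_def K_J_zero)

definition w :: "real \<Rightarrow> real" where "w y = u y / cosh (A * y)"

definition w' :: "real \<Rightarrow> real" where "w' y = u' y / cosh (A * y) - A * tanh (A * y) * w y"

text \<open>The second derivative is read off the equation \<open>L w - \<alpha> w = - g\<close>.\<close>

definition w'' :: "real \<Rightarrow> real" where
  "w'' y = 2 / \<sigma>\<^sup>2 * (\<alpha> * w y - g y) - 2 * A * tanh (A * y) * w' y"

lemma w_deriv: "(w has_real_derivative w' y) (at y)"
proof -
  have "(w has_real_derivative (u' y * cosh (A * y) - u y * (sinh (A * y) * A)) / (cosh (A * y) * cosh (A * y))) (at y)"
    unfolding w_def[abs_def] by (rule DERIV_divide[OF u_deriv]) (auto intro!: derivative_eq_intros)
  moreover have "(u' y * cosh (A * y) - u y * (sinh (A * y) * A)) / (cosh (A * y) * cosh (A * y)) = w' y"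
    unfolding w'_def w_def tanh_def by (simp add: field_simps)
  ultimately show ?thesis by simp
qed

text \<open>Here the function read off the equation is confirmed to be a second derivative: the
  squares of \<open>tanh\<close> cancel, and the coefficient of \<open>w\<close> becomes
  \<open>B\<^sup>2 - A\<^sup>2\<close>, that is
  \<open>2 * \<alpha> / \<sigma>\<^sup>2\<close>.\<close>

lemma w'_deriv: "(w' has_real_derivative w'' y) (at y)"
proof -
  let ?c = "cosh (A * y)" and ?t = "tanh (A * y)"
  have t: "((\<lambda>y. A * tanh (A * y)) has_real_derivative A * A * (1 - ?t\<^sup>2)) (at y)"
    by (auto intro!: derivative_eq_intros)
  have "((\<lambda>y. u' y / cosh (A * y)) has_real_derivative
      ((B\<^sup>2 * u y - 2 * (?c * g y) / \<sigma>\<^sup>2) * ?c - u' y * (sinh (A * y) * A)) / (?c * ?c)) (at y)"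
    by (rule DERIV_divide[OF u'_deriv]) (auto intro!: derivative_eq_intros)
  moreover have "((B\<^sup>2 * u y - 2 * (?c * g y) / \<sigma>\<^sup>2) * ?c - u' y * (sinh (A * y) * A)) / (?c * ?c)
      = B\<^sup>2 * w y - 2 * g y / \<sigma>\<^sup>2 - A * ?t * (u' y / ?c)"
    unfolding w_def tanh_def using \<sigma>_pos by (simp add: field_simps)
  ultimately have "(w' has_real_derivative (B\<^sup>2 * w y - 2 * g y / \<sigma>\<^sup>2 - A * ?t * (u' y / ?c))
      - (A * A * (1 - ?t\<^sup>2) * w y + w' y * (A * ?t))) (at y)"
    unfolding w'_def[abs_def] using DERIV_diff[OF _ DERIV_mult[OF t w_deriv]] by (simp add: w'_def)
  moreover have "(B\<^sup>2 * w y - 2 * g y / \<sigma>\<^sup>2 - A * ?t * (u' y / ?c)) - (A * A * (1 - ?t\<^sup>2) * w y + w' y * (A * ?t)) = w'' y"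
  proof -
    have 1: "u' y / ?c = w' y + A * ?t * w y" unfolding w'_def by simp
    have 2: "2 / \<sigma>\<^sup>2 * \<alpha> = B\<^sup>2 - A\<^sup>2" using weight_eq \<sigma>_pos by (simp add: field_simps)
    have "w'' y = (2 / \<sigma>\<^sup>2 * \<alpha>) * w y - 2 * g y / \<sigma>\<^sup>2 - 2 * A * ?t * w' y"
      unfolding w''_def by (simp add: algebra_simps)
    then show ?thesis unfolding 1 2 by (simp add: power2_eq_square algebra_simps)
  qed
  ultimately show ?thesis by simp
qed

lemma generator_w: "\<sigma>\<^sup>2 * A * tanh (A * y) * w' y + \<sigma>\<^sup>2 / 2 * w'' y = \<alpha> * w y - g y"
  unfolding w''_def using \<sigma>_pos by (simp add: field_simps)

lemma w_nonneg: "0 \<le> w y" unfolding w_def using u_nonneg by simp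

lemma w_zero: "y \<le> a \<Longrightarrow> w y = 0" unfolding w_def u_def by (simp add: K_J_zero)

text \<open>The other factor \<open>u' - B * u\<close> is governed by \<open>J\<close>, which is
  nonpositive as long as \<open>g\<close> has not become positive; and the logarithmic derivative
  \<open>A * tanh (A * y)\<close> of the divisor stays below \<open>B\<close>. The lemma compares
  the start of the process with a lower passage level.\<close>

lemma w_mono:
  assumes "y \<le> z" "\<And>v. v \<le> z \<Longrightarrow> g v \<le> 0"
  shows "w y \<le> w z"
proof (rule DERIV_nonneg_imp_nondecreasing[OF assms(1)])
  fix v assume v: "y \<le> v" "v \<le> z"
  have "u' v - B * u v = - (2 * exp (- B * v) * J v) / \<sigma>\<^sup>2"
    unfolding u_def u'_def using B_pos \<sigma>_pos by (simp add: field_simps)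
  also have "\<dots> \<ge> 0" using J_nonpos[of v] v assms by (simp add: divide_le_0_iff mult_le_0_iff)
  finally have 1: "B * u v \<le> u' v" by simp
  have "A * tanh (A * v) \<le> B" using tanh_real_lt_1[of "A * v"] A_pos A_less_B
    by (smt (verit) mult_left_le)
  then have "A * tanh (A * v) * u v \<le> B * u v" using u_nonneg by (rule mult_right_mono)
  then have "0 \<le> (u' v - A * tanh (A * v) * u v) / cosh (A * v)" using 1 by simp
  also have "\<dots> = w' v" unfolding w'_def w_def by (simp add: diff_divide_distrib)
  finally show "\<exists>d. (w has_real_derivative d) (at v) \<and> 0 \<le> d" using w_deriv by blast
qed

text \<open>The bounds on \<open>J\<close> and \<open>K\<close> are multiples of
  \<open>cosh (A * y)\<close>, which cancels in \<open>w\<close> and \<open>w'\<close>. The equation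
  then bounds \<open>w''\<close> and passes the Lipschitz constant of \<open>g\<close> on to
  it.\<close>

lemma w_bounds:
  obtains C where "\<And>y. \<bar>w y\<bar> \<le> C" "\<And>y. \<bar>w' y\<bar> \<le> C" "\<And>y. \<bar>w'' y\<bar> \<le> C"
    "\<And>y z. \<bar>w'' y - w'' z\<bar> \<le> C * \<bar>y - z\<bar>"
proof -
  define d where "d = D / (B - A)"
  define E where "E = 2 * d"
  note JK = J_bounded[folded d_def] K_bounded[folded d_def]
  have E0: "0 \<le> E" unfolding E_def d_def using D_nonneg A_less_B by simp
  define C0 where "C0 = E / (\<sigma>\<^sup>2 * B)"
  define C1 where "C1 = E / \<sigma>\<^sup>2 + A * C0"
  define C2 where "C2 = 2 / \<sigma>\<^sup>2 * (\<alpha> * C0 + D) + 2 * A * C1"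
  define C3 where "C3 = 2 / \<sigma>\<^sup>2 * (\<alpha> * C1 + D) + 2 * A * (A * C1 + C2)"
  have C0: "0 \<le> C0" unfolding C0_def using E0 B_pos by simp
  have C1: "0 \<le> C1" unfolding C1_def using E0 C0 A_pos by simp
  have C2: "0 \<le> C2" unfolding C2_def using C0 C1 A_pos D_nonneg \<alpha>_pos by simp
  have C3: "0 \<le> C3" unfolding C3_def using C1 C2 A_pos D_nonneg \<alpha>_pos by simp
  have b0: "\<bar>w y\<bar> \<le> C0" for y
  proof -
    have "\<bar>exp (- B * y) * J y - exp (B * y) * K y\<bar> \<le> E * cosh (A * y)"
      unfolding E_def mult.assoc using JK(1)[of y] JK(2)[of y] by linarith
    then show ?thesis unfolding w_def u_def C0_def using B_pos \<sigma>_pos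
      by (simp add: abs_divide abs_mult field_simps)
  qed
  have b1: "\<bar>w' y\<bar> \<le> C1" for y
  proof -
    have "\<bar>exp (- B * y) * J y + exp (B * y) * K y\<bar> \<le> E * cosh (A * y)"
      unfolding E_def mult.assoc using JK(1)[of y] JK(2)[of y] by linarith
    then have "\<bar>u' y / cosh (A * y)\<bar> \<le> E / \<sigma>\<^sup>2"
      unfolding u'_def using \<sigma>_pos by (simp add: abs_divide field_simps)
    moreover have "\<bar>A * tanh (A * y) * w y\<bar> \<le> A * 1 * C0"
      unfolding abs_mult using A_pos C0 tanh_bounded b0 by (intro mult_mono) auto
    ultimately show ?thesis unfolding w'_def C1_def by linarith
  qed
  have b2: "\<bar>w'' y\<bar> \<le> C2" for y
  proof -
    have "\<bar>\<alpha> * w y - g y\<bar> \<le> \<alpha> * C0 + D"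
      using b0[of y] g_bounded[of y] \<alpha>_pos by (intro order.trans[OF abs_triangle_ineq4] add_mono) (auto simp: abs_mult)
    then have "\<bar>2 / \<sigma>\<^sup>2 * (\<alpha> * w y - g y)\<bar> \<le> 2 / \<sigma>\<^sup>2 * (\<alpha> * C0 + D)"
      unfolding abs_mult by (intro mult_mono) auto
    moreover have "\<bar>2 * A * tanh (A * y) * w' y\<bar> \<le> 2 * A * 1 * C1"
      unfolding abs_mult using A_pos C1 tanh_bounded b1 by (intro mult_mono) auto
    ultimately show ?thesis unfolding w''_def C2_def by linarith
  qed
  have l0: "\<bar>w y - w z\<bar> \<le> C1 * \<bar>y - z\<bar>" for y z
    using field_differentiable_bound[of UNIV w w' C1 y z] w_deriv b1 by auto
  have l1: "\<bar>w' y - w' z\<bar> \<le> C2 * \<bar>y - z\<bar>" for y z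
    using field_differentiable_bound[of UNIV w' w'' C2 y z] w'_deriv b2 by auto
  have l2: "\<bar>w'' y - w'' z\<bar> \<le> C3 * \<bar>y - z\<bar>" for y z
  proof -
    have "w'' y - w'' z = 2 / \<sigma>\<^sup>2 * (\<alpha> * (w y - w z) - (g y - g z))
        - 2 * A * ((tanh (A * y) - tanh (A * z)) * w' y + tanh (A * z) * (w' y - w' z))"
      unfolding w''_def by (simp add: algebra_simps)
    moreover have "\<bar>2 / \<sigma>\<^sup>2 * (\<alpha> * (w y - w z) - (g y - g z))\<bar> \<le> 2 / \<sigma>\<^sup>2 * (\<alpha> * (C1 * \<bar>y - z\<bar>) + D * \<bar>y - z\<bar>)"
    proof -
      have "\<bar>\<alpha> * (w y - w z)\<bar> \<le> \<alpha> * (C1 * \<bar>y - z\<bar>)"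
        using l0[of y z] \<alpha>_pos by (simp add: abs_mult)
      then have "\<bar>\<alpha> * (w y - w z) - (g y - g z)\<bar> \<le> \<alpha> * (C1 * \<bar>y - z\<bar>) + D * \<bar>y - z\<bar>"
        using g_lipschitz[of y z] by linarith
      then show ?thesis unfolding abs_mult[of "2 / \<sigma>\<^sup>2"] by (intro mult_mono) auto
    qed
    moreover have "\<bar>2 * A * ((tanh (A * y) - tanh (A * z)) * w' y + tanh (A * z) * (w' y - w' z))\<bar>
        \<le> 2 * A * ((A * \<bar>y - z\<bar>) * C1 + 1 * (C2 * \<bar>y - z\<bar>))"
    proof -
      have "\<bar>(tanh (A * y) - tanh (A * z)) * w' y\<bar> \<le> (A * \<bar>y - z\<bar>) * C1"
        unfolding abs_mult using A_pos by (intro mult_mono tanh_lipschitz b1) auto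
      moreover have "\<bar>tanh (A * z) * (w' y - w' z)\<bar> \<le> 1 * (C2 * \<bar>y - z\<bar>)"
        unfolding abs_mult by (intro mult_mono tanh_bounded l1) auto
      ultimately show ?thesis
        unfolding abs_mult[of "2 * A"] using A_pos by (intro mult_mono order.trans[OF abs_triangle_ineq] add_mono) auto
    qed
    moreover have "C3 * \<bar>y - z\<bar> = 2 / \<sigma>\<^sup>2 * (\<alpha> * (C1 * \<bar>y - z\<bar>) + D * \<bar>y - z\<bar>)
        + 2 * A * ((A * \<bar>y - z\<bar>) * C1 + 1 * (C2 * \<bar>y - z\<bar>))"
      unfolding C3_def by (simp add: algebra_simps add_divide_distrib)
    ultimately show ?thesis by linarith
  qed
  let ?C = "C0 + C1 + C2 + C3"
  show ?thesis
  proof (rule that[of ?C])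
    show "\<bar>w y\<bar> \<le> ?C" "\<bar>w' y\<bar> \<le> ?C" "\<bar>w'' y\<bar> \<le> ?C" for y
      using b0[of y] b1[of y] b2[of y] C0 C1 C2 C3 by linarith+
    show "\<bar>w'' y - w'' z\<bar> \<le> ?C * \<bar>y - z\<bar>" for y z
    proof (rule order.trans[OF l2])
      show "C3 * \<bar>y - z\<bar> \<le> ?C * \<bar>y - z\<bar>" using C0 C1 C2 by (intro mult_right_mono) auto
    qed
  qed
qed

end

section \<open>The index as a weighted average of the reward\<close>

lemma set_integrable_exp_mult:
  fixes \<phi> :: "real \<Rightarrow> real"
  assumes c: "0 < c" and \<phi>: "\<phi> \<in> borel_measurable borel" "\<And>y. \<bar>\<phi> y\<bar> \<le> D"
  shows "set_integrable lborel {a..} (\<lambda>z. exp (- c * z) * \<phi> z)"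
proof -
  have D: "0 \<le> D" using \<phi>(2)[of 0] by simp
  have "integrable lborel (\<lambda>z. D * (indicator {a..} z * exp (- c * z)))"
    using set_integral_exp_Ici(1)[OF c, of a] by (simp add: set_integrable_def)
  then have "integrable lborel (\<lambda>z. indicator {a..} z * (exp (- c * z) * \<phi> z))"
  proof (rule Bochner_Integration.integrable_bound)
    show "(\<lambda>z. indicator {a..} z * (exp (- c * z) * \<phi> z)) \<in> borel_measurable lborel"
      using \<phi>(1) by simp
    show "AE z in lborel. norm (indicator {a..} z * (exp (- c * z) * \<phi> z)) \<le> norm (D * (indicator {a..} z * exp (- c * z)))"
      using \<phi>(2) D by (intro AE_I2) (auto simp: indicator_def abs_mult mult.commute[of D] intro!: mult_left_mono)
  qed
  then show ?thesis by (simp add: set_integrable_def)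
qed

text \<open>The substitution \<open>z = x + s / c\<close>; the rates \<open>c = B - A\<close> and
  \<open>c = B + A\<close> produce the two integrals of the claim.\<close>

lemma shifted_exponential_integral:
  fixes h :: "real \<Rightarrow> real"
  assumes c: "0 < c"
  shows "(LBINT z:{x..}. exp (- c * z) * h z) = exp (- c * x) / c * (LBINT s:{0..}. h (x + s / c) * exp (- s))"
proof -
  have "(LBINT z:{x..}. exp (- c * z) * h z) = \<bar>1 / c\<bar> *\<^sub>R
      (LBINT s. indicator {x..} (x + 1 / c * s) *\<^sub>R (exp (- c * (x + 1 / c * s)) * h (x + 1 / c * s)))"
    unfolding set_lebesgue_integral_def using c by (intro lborel_integral_real_affine) simp
  also have "(LBINT s. indicator {x..} (x + 1 / c * s) *\<^sub>R (exp (- c * (x + 1 / c * s)) * h (x + 1 / c * s)))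
      = (LBINT s. exp (- c * x) * (indicator {0..} s *\<^sub>R (h (x + s / c) * exp (- s))))"
  proof (intro Bochner_Integration.integral_cong refl)
    fix s
    have "- c * (x + 1 / c * s) = - c * x + - s" using c by (simp add: field_simps)
    then have "exp (- c * (x + 1 / c * s)) = exp (- c * x) * exp (- s)" by (simp only: exp_add)
    moreover have "indicator {x..} (x + 1 / c * s) = (indicator {0..} s :: real)"
      using c by (auto simp: indicator_def zero_le_divide_iff divide_less_0_iff)
    ultimately show "indicator {x..} (x + 1 / c * s) *\<^sub>R (exp (- c * (x + 1 / c * s)) * h (x + 1 / c * s))
      = exp (- c * x) * (indicator {0..} s *\<^sub>R (h (x + s / c) * exp (- s)))" by simp
  qed
  finally show ?thesis using c by (simp add: set_lebesgue_integral_def)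
qed

definition ramp :: "real \<Rightarrow> real \<Rightarrow> real \<Rightarrow> real" where
  "ramp a e z = min 1 (max 0 ((z - a) / e))"

lemma ramp_bounds: "0 \<le> ramp a e z" "ramp a e z \<le> 1" "\<bar>ramp a e z\<bar> \<le> 1"
  unfolding ramp_def by auto

lemma ramp_zero: "0 < e \<Longrightarrow> z \<le> a \<Longrightarrow> ramp a e z = 0"
  using divide_nonpos_pos[of "z - a" e] unfolding ramp_def by simp

lemma ramp_one: "0 < e \<Longrightarrow> a + e \<le> z \<Longrightarrow> ramp a e z = 1"
  unfolding ramp_def by (simp add: min_def max_def field_simps)

lemma ramp_lipschitz:
  assumes "0 < e"
  shows "\<bar>ramp a e y - ramp a e z\<bar> \<le> 1 / e * \<bar>y - z\<bar>"
proof -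
  have "\<bar>ramp a e y - ramp a e z\<bar> \<le> \<bar>(y - a) / e - (z - a) / e\<bar>"
    unfolding ramp_def by (auto simp: min_def max_def abs_if)
  also have "(y - a) / e - (z - a) / e = (y - z) / e" by (simp add: diff_divide_distrib)
  finally show ?thesis using assms by (simp add: abs_divide)
qed

lemma measurable_ramp [measurable]: "ramp a e \<in> borel_measurable borel"
  unfolding ramp_def[abs_def] by measurable

lemma ramp_mult_bounded:
  assumes "\<bar>\<phi> z\<bar> \<le> D"
  shows "\<bar>ramp a e z * \<phi> z\<bar> \<le> (D::real)"
proof -
  have "\<bar>ramp a e z * \<phi> z\<bar> \<le> 1 * D" unfolding abs_mult using assms ramp_bounds by (intro mult_mono) auto
  then show ?thesis by simp
qed

context weight
begin

text \<open>Expanding \<open>cosh\<close> splits \<open>m\<close> into exponentials of rates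
  \<open>B - A\<close> and \<open>B + A\<close>; this is the origin of the two summands in the final
  formula.\<close>

lemma m_mult_integrable:
  assumes \<phi>: "\<phi> \<in> borel_measurable borel" "\<And>y. \<bar>\<phi> y\<bar> \<le> D"
  shows "set_integrable lborel {a..} (\<lambda>z. m z * (\<phi> z :: real))"
    and "(LBINT z:{a..}. m z * \<phi> z) =
      ((LBINT z:{a..}. exp (- (B - A) * z) * \<phi> z) + (LBINT z:{a..}. exp (- (B + A) * z) * \<phi> z)) / 2"
proof -
  have i: "set_integrable lborel {a..} (\<lambda>z. exp (- (B - A) * z) * \<phi> z)"
    "set_integrable lborel {a..} (\<lambda>z. exp (- (B + A) * z) * \<phi> z)"
    by (rule set_integrable_exp_mult[OF _ \<phi>], use A_pos A_less_B in simp)+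
  have eq: "m z * \<phi> z = (exp (- (B - A) * z) * \<phi> z + exp (- (B + A) * z) * \<phi> z) / 2" for z
    unfolding m_eq by (simp add: distrib_right)
  show "set_integrable lborel {a..} (\<lambda>z. m z * \<phi> z)"
    unfolding eq by (rule set_integrable_divide[OF set_integral_add(1)[OF i]])
  show "(LBINT z:{a..}. m z * \<phi> z) =
      ((LBINT z:{a..}. exp (- (B - A) * z) * \<phi> z) + (LBINT z:{a..}. exp (- (B + A) * z) * \<phi> z)) / 2"
    unfolding eq set_integral_divide_zero set_integral_add(2)[OF i] ..
qed

lemma m_integrable: "set_integrable lborel {a..} m" and m_integral: "(LBINT z:{a..}. m z) = tail a"
  using m_mult_integrable[of "\<lambda>_. 1" 1 a] set_integral_exp_Ici(2)[of "B - A" a] set_integral_exp_Ici(2)[of "B + A" a]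
    A_pos A_less_B unfolding tail_def by simp_all

lemma tail_pos: "0 < tail a"
  unfolding tail_def using A_pos A_less_B by (simp add: add_pos_pos)

text \<open>At every \<open>z\<close> other than \<open>x\<close> the integrand is eventually
  constant in \<open>n\<close>. The common lower bound \<open>d\<close> is needed for a majorant, as
  \<open>m\<close> grows exponentially to the left.\<close>

lemma ramp_integral_tendsto:
  fixes a e :: "nat \<Rightarrow> real"
  assumes a: "a \<longlonglongrightarrow> x" and e: "e \<longlonglongrightarrow> 0" and pos: "\<And>n. 0 < e n" and ge: "\<And>n. d \<le> a n"
    and \<phi>: "\<phi> \<in> borel_measurable borel" "\<And>y. \<bar>\<phi> y\<bar> \<le> D"
  shows "(\<lambda>n. LBINT z:{a n..}. m z * (ramp (a n) (e n) z * \<phi> z)) \<longlonglongrightarrow> (LBINT z:{x..}. m z * \<phi> z)"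
  unfolding set_lebesgue_integral_def
proof (rule integral_dominated_convergence[where w="\<lambda>z. D * (indicator {d..} z * m z)"])
  have [measurable]: "m \<in> borel_measurable borel" "\<phi> \<in> borel_measurable borel"
    using \<phi>(1) borel_measurable_continuous_onI[OF continuous_m] by auto
  have D: "0 \<le> D" using \<phi>(2)[of 0] by simp
  show "integrable lborel (\<lambda>z. D * (indicator {d..} z * m z))"
    using m_integrable[of d] by (simp add: set_integrable_def)
  show "AE z in lborel. norm (indicator {a n..} z *\<^sub>R (m z * (ramp (a n) (e n) z * \<phi> z))) \<le> D * (indicator {d..} z * m z)" for n
  proof (rule AE_I2)
    fix z
    have "\<bar>m z * (ramp (a n) (e n) z * \<phi> z)\<bar> \<le> m z * D"
      unfolding abs_mult[of "m z"] using m_pos[of z] ramp_mult_bounded[of \<phi> z D, OF \<phi>(2)] by (intro mult_mono) auto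
    then show "norm (indicator {a n..} z *\<^sub>R (m z * (ramp (a n) (e n) z * \<phi> z))) \<le> D * (indicator {d..} z * m z)"
      using ge[of n] D m_pos[of z] by (auto simp: indicator_def mult.commute)
  qed
  show "AE z in lborel. (\<lambda>n. indicator {a n..} z *\<^sub>R (m z * (ramp (a n) (e n) z * \<phi> z))) \<longlonglongrightarrow> indicator {x..} z *\<^sub>R (m z * \<phi> z)"
    using AE_lborel_singleton[of x]
  proof eventually_elim
    case (elim z)
    show ?case
    proof (rule tendsto_eventually)
      show "\<forall>\<^sub>F n in sequentially. indicator {a n..} z *\<^sub>R (m z * (ramp (a n) (e n) z * \<phi> z)) = indicator {x..} z *\<^sub>R (m z * \<phi> z)"
      proof (cases "z < x")
        case True
        show ?thesis
          using order_tendstoD(1)[OF a True] by eventually_elim (use True in simp)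
      next
        case False
        then have xz: "x < z" using elim by simp
        have "(\<lambda>n. a n + e n) \<longlonglongrightarrow> x + 0" by (intro tendsto_add a e)
        then have "\<forall>\<^sub>F n in sequentially. a n + e n < z" using xz by (intro order_tendstoD(2)) auto
        then show ?thesis
        proof eventually_elim
          case (elim n)
          then have "a n < z" using pos[of n] by linarith
          then show ?case using elim ramp_one[OF pos[of n], of "a n" z] xz by simp
        qed
      qed
    qed
  qed
  show "(\<lambda>z. indicator {x..} z *\<^sub>R (m z * \<phi> z)) \<in> borel_measurable lborel" by simp
  show "(\<lambda>z. indicator {a n..} z *\<^sub>R (m z * (ramp (a n) (e n) z * \<phi> z))) \<in> borel_measurable lborel" for n by simp
qed

text \<open>The ramp is full beyond \<open>a + e\<close>, where \<open>m\<close> still has mass. The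
  factor 1 keeps the shape of \<open>ramp_integral_tendsto\<close> for a constant function.\<close>

lemma ramp_mass_pos:
  assumes "0 < e"
  shows "0 < (LBINT z:{a..}. m z * (ramp a e z * 1))"
proof -
  have "0 < tail (a + e)" by (rule tail_pos)
  also have "\<dots> = (LBINT z. indicator {a + e..} z * m z)"
    using m_integral[of "a + e"] by (simp add: set_lebesgue_integral_def)
  also have "\<dots> \<le> (LBINT z. indicator {a..} z * (m z * (ramp a e z * 1)))"
  proof (rule integral_mono)
    show "integrable lborel (\<lambda>z. indicator {a + e..} z * m z)"
      using m_integrable[of "a + e"] by (simp add: set_integrable_def)
    show "integrable lborel (\<lambda>z. indicator {a..} z * (m z * (ramp a e z * 1)))"
      using m_mult_integrable(1)[of "ramp a e" 1 a] ramp_bounds by (simp add: set_integrable_def)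
    fix z show "indicator {a + e..} z * m z \<le> indicator {a..} z * (m z * (ramp a e z * 1))"
      using assms m_pos[of z] ramp_bounds(1)[of a e z] ramp_one[OF assms, of a z]
      by (cases "a + e \<le> z") (auto simp: indicator_def)
  qed
  finally show ?thesis by (simp add: set_lebesgue_integral_def)
qed

end

locale reward = weight \<alpha> \<sigma> A B for \<alpha> \<sigma> A B :: real +
  fixes h :: "real \<Rightarrow> real" and H :: real
  assumes h_strict_mono: "strict_mono h" and h_bounded: "\<bar>h y\<bar> \<le> H"
    and h_lipschitz: "\<bar>h y - h z\<bar> \<le> H * \<bar>y - z\<bar>"
begin

lemma H_nonneg: "0 \<le> H" using h_bounded[of 0] by simp

lemma continuous_h: "continuous_on S h"
  by (rule lipschitz_on_continuous_on[of H])
    (auto intro!: lipschitz_onI h_lipschitz H_nonneg simp: dist_real_def)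

lemma measurable_h [measurable]: "h \<in> borel_measurable borel"
  using continuous_h by (rule borel_measurable_continuous_onI)

text \<open>
  \<open>\<alpha> * smoothed_index a e\<close> is the constant that centers the source
  \<open>ramp a e z * (h z - \<alpha> * smoothed_index a e)\<close> with respect to the weight \<open>m\<close>.
\<close>

definition smoothed_index :: "real \<Rightarrow> real \<Rightarrow> real" where
  "smoothed_index a e = (LBINT z:{a..}. m z * (ramp a e z * h z)) / (\<alpha> * (LBINT z:{a..}. m z * (ramp a e z * 1)))"

definition index :: "real \<Rightarrow> real" where
  "index x = (LBINT z:{x..}. m z * h z) / (\<alpha> * tail x)"

lemma smoothed_index_tendsto:
  fixes a e :: "nat \<Rightarrow> real"
  assumes a: "a \<longlonglongrightarrow> x" and e: "e \<longlonglongrightarrow> 0" and pos: "\<And>n. 0 < e n" and ge: "\<And>n. d \<le> a n"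
  shows "(\<lambda>n. smoothed_index (a n) (e n)) \<longlonglongrightarrow> index x"
proof -
  have "(\<lambda>n. LBINT z:{a n..}. m z * (ramp (a n) (e n) z * 1)) \<longlonglongrightarrow> (LBINT z:{x..}. m z * 1)"
    by (rule ramp_integral_tendsto[OF a e pos ge, of "\<lambda>_. 1" 1]) auto
  moreover have "(LBINT z:{x..}. m z * 1) = tail x" using m_integral by simp
  moreover have "(\<lambda>n. LBINT z:{a n..}. m z * (ramp (a n) (e n) z * h z)) \<longlonglongrightarrow> (LBINT z:{x..}. m z * h z)"
    by (rule ramp_integral_tendsto[OF a e pos ge measurable_h h_bounded])
  ultimately show ?thesis
    unfolding smoothed_index_def index_def using tail_pos[of x] \<alpha>_pos
    by (intro tendsto_divide tendsto_mult tendsto_const) auto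
qed

text \<open>Monotonicity gains at least \<open>h (x + 1) - h x\<close> beyond \<open>x + 1\<close>,
  on a set of positive weight. Strictness is the room that lets the sign conditions survive when the
  index is replaced by its smoothed version.\<close>

lemma h_less_index: "h x < \<alpha> * index x"
proof -
  have hx: "h x < h (x + 1)" using h_strict_mono by (simp add: strict_mono_def)
  have i: "integrable lborel (\<lambda>z. indicator {x..} z * (m z * h z))"
    using m_mult_integrable(1)[OF measurable_h h_bounded, of x] by (simp add: set_integrable_def)
  have im: "integrable lborel (\<lambda>z. indicator {v..} z * m z)" for v
    using m_integrable[of v] by (simp add: set_integrable_def)
  have Im: "(LBINT z. indicator {v..} z * m z) = tail v" for v
    using m_integral[of v] by (simp add: set_lebesgue_integral_def)
  have "(LBINT z. h x * (indicator {x..} z * m z) + (h (x + 1) - h x) * (indicator {x + 1..} z * m z))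
      \<le> (LBINT z. indicator {x..} z * (m z * h z))"
  proof (rule integral_mono[OF _ i])
    show "integrable lborel (\<lambda>z. h x * (indicator {x..} z * m z) + (h (x + 1) - h x) * (indicator {x + 1..} z * m z))"
      using im by simp
    fix z
    show "h x * (indicator {x..} z * m z) + (h (x + 1) - h x) * (indicator {x + 1..} z * m z) \<le> indicator {x..} z * (m z * h z)"
    proof (cases "x + 1 \<le> z")
      case True
      then have "h (x + 1) \<le> h z" using h_strict_mono by (simp add: strict_mono_less_eq)
      then have "m z * h (x + 1) \<le> m z * h z" using m_pos[of z] by simp
      then show ?thesis using True by (simp add: algebra_simps)
    next
      case False
      show ?thesis
      proof (cases "x \<le> z")
        case True
        then have "h x \<le> h z" using h_strict_mono by (simp add: strict_mono_less_eq)
        then have "m z * h x \<le> m z * h z" using m_pos[of z] by simp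
        then show ?thesis using True False by (simp add: mult.commute)
      qed (use False in simp)
    qed
  qed
  also have "(LBINT z. h x * (indicator {x..} z * m z) + (h (x + 1) - h x) * (indicator {x + 1..} z * m z))
      = h x * tail x + (h (x + 1) - h x) * tail (x + 1)"
    using im Im by simp
  finally have "h x * tail x + (h (x + 1) - h x) * tail (x + 1) \<le> (LBINT z:{x..}. m z * h z)"
    by (simp add: set_lebesgue_integral_def)
  moreover have "0 < (h (x + 1) - h x) * tail (x + 1)" using hx tail_pos by simp
  ultimately have "h x * tail x < (LBINT z:{x..}. m z * h z)" by linarith
  then show ?thesis unfolding index_def using tail_pos[of x] \<alpha>_pos by (simp add: field_simps)
qed

text \<open>The sign of the source follows the increasing function
  \<open>h z - \<alpha> * l\<close>, which gives the single crossing. The slope of the ramp makes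
  \<open>D\<close> grow like \<open>1 / e\<close>; this is harmless, since \<open>D\<close> does not
  enter the inequalities for the index.\<close>

lemma source_ramp:
  fixes a e :: real
  assumes e: "0 < e"
  defines "l \<equiv> smoothed_index a e"
  shows "\<exists>D. source \<alpha> \<sigma> A B (\<lambda>z. ramp a e z * (h z - \<alpha> * l)) a D"
proof -
  let ?g = "\<lambda>z. ramp a e z * (h z - \<alpha> * l)"
  define E where "E = H + \<bar>\<alpha> * l\<bar>"
  have b: "\<bar>h z - \<alpha> * l\<bar> \<le> E" for z using h_bounded[of z] unfolding E_def by linarith
  have E0: "0 \<le> E" using b[of 0] by linarith
  define D where "D = E + 1 / e * E + H"
  have D: "E \<le> D" "1 / e * E + H \<le> D" unfolding D_def using E0 e H_nonneg by auto
  have gb: "\<bar>?g z\<bar> \<le> E" for z using ramp_mult_bounded[of "\<lambda>z. h z - \<alpha> * l" z E] b by simp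
  have mg: "?g \<in> borel_measurable borel" by measurable
  have "source \<alpha> \<sigma> A B ?g a D"
  proof
    show "\<bar>?g z\<bar> \<le> D" for z using gb[of z] D by linarith
    show "\<bar>?g y - ?g z\<bar> \<le> D * \<bar>y - z\<bar>" for y z
    proof -
      have "?g y - ?g z = (ramp a e y - ramp a e z) * (h y - \<alpha> * l) + ramp a e z * (h y - h z)"
        by (simp add: algebra_simps)
      moreover have "\<bar>(ramp a e y - ramp a e z) * (h y - \<alpha> * l)\<bar> \<le> (1 / e * \<bar>y - z\<bar>) * E"
        unfolding abs_mult using e by (intro mult_mono ramp_lipschitz b) auto
      moreover have "\<bar>ramp a e z * (h y - h z)\<bar> \<le> 1 * (H * \<bar>y - z\<bar>)"
        unfolding abs_mult by (intro mult_mono ramp_bounds h_lipschitz) auto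
      ultimately have "\<bar>?g y - ?g z\<bar> \<le> (1 / e * \<bar>y - z\<bar>) * E + H * \<bar>y - z\<bar>" by linarith
      also have "\<dots> = (1 / e * E + H) * \<bar>y - z\<bar>" by (simp add: algebra_simps)
      also have "\<dots> \<le> D * \<bar>y - z\<bar>" using D by (intro mult_right_mono) auto
      finally show ?thesis .
    qed
    show "?g z = 0" if "z \<le> a" for z using ramp_zero[OF e that] by simp
    show "(\<forall>y\<le>z. ?g y \<le> 0) \<or> (\<forall>y\<ge>z. 0 \<le> ?g y)" for z
    proof (cases "h z \<le> \<alpha> * l")
      case True
      have "?g y \<le> 0" if "y \<le> z" for y
      proof -
        have "h y \<le> h z" using that h_strict_mono by (simp add: strict_mono_less_eq)
        then show ?thesis using True ramp_bounds(1)[of a e y] by (intro mult_nonneg_nonpos) auto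
      qed
      then show ?thesis by blast
    next
      case False
      have "0 \<le> ?g y" if "z \<le> y" for y
      proof -
        have "h z \<le> h y" using that h_strict_mono by (simp add: strict_mono_less_eq)
        then show ?thesis using False ramp_bounds(1)[of a e y] by (intro mult_nonneg_nonneg) auto
      qed
      then show ?thesis by blast
    qed
    show "set_integrable lborel {a..} (\<lambda>z. m z * ?g z)" by (rule m_mult_integrable(1)[OF mg gb])
    have i1: "set_integrable lborel {a..} (\<lambda>z. m z * (ramp a e z * h z))"
      by (rule m_mult_integrable(1)[where D=H]) (auto intro: ramp_mult_bounded h_bounded)
    have i2: "set_integrable lborel {a..} (\<lambda>z. m z * (ramp a e z * 1))"
      by (rule m_mult_integrable(1)[where D=1]) (auto simp: ramp_bounds)
    have "(LBINT z:{a..}. m z * ?g z) = (LBINT z:{a..}. m z * (ramp a e z * h z) - (\<alpha> * l) * (m z * (ramp a e z * 1)))"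
      by (simp add: algebra_simps)
    also have "\<dots> = (LBINT z:{a..}. m z * (ramp a e z * h z)) - (\<alpha> * l) * (LBINT z:{a..}. m z * (ramp a e z * 1))"
      using i1 i2 by (subst set_integral_diff(2)) auto
    also have "\<dots> = 0" unfolding l_def smoothed_index_def using ramp_mass_pos[OF e, of a] \<alpha>_pos by simp
    finally show "(LBINT z:{a..}. m z * ?g z) = 0" .
  qed
  then show ?thesis by blast
qed

text \<open>With \<open>p = B - A\<close> and \<open>q = B + A\<close>, \<open>weight_eq\<close>
  reads \<open>2 * \<alpha> = \<sigma>\<^sup>2 * (p * q)\<close>, and \<open>exp (2 * A * x)\<close>
  is the ratio \<open>e1 / e2\<close>. Multiplied by \<open>\<alpha>\<close>, the two coefficients
  are the shares of the two exponentials in \<open>tail x\<close>.\<close>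

lemma index_formula:
  "index x = 2 / (2 * \<alpha> + \<sigma>\<^sup>2 * (B - A)\<^sup>2 * exp (- 2 * A * x)) * (LBINT s:{0..}. h (x + s / (B - A)) * exp (- s))
    + 2 / (2 * \<alpha> + \<sigma>\<^sup>2 * (B + A)\<^sup>2 * exp (2 * A * x)) * (LBINT s:{0..}. h (x + s / (B + A)) * exp (- s))"
proof -
  define p q where "p = B - A" and "q = B + A"
  have pq: "0 < p" "0 < q" using A_pos A_less_B by (auto simp: p_def q_def)
  have \<alpha>: "2 * \<alpha> = \<sigma>\<^sup>2 * (p * q)"
    unfolding weight_eq[symmetric] p_def q_def by (simp add: power2_eq_square algebra_simps)
  let ?S1 = "LBINT s:{0..}. h (x + s / p) * exp (- s)" and ?S2 = "LBINT s:{0..}. h (x + s / q) * exp (- s)"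
  define e1 e2 where "e1 = exp (- p * x)" and "e2 = exp (- q * x)"
  have pos: "0 < e1" "0 < e2" by (auto simp: e1_def e2_def)
  have E: "exp (- 2 * A * x) = e2 / e1" "exp (2 * A * x) = e1 / e2"
    unfolding e1_def e2_def exp_diff[symmetric] p_def q_def by (simp_all add: algebra_simps)
  have "(LBINT z:{x..}. m z * h z) = (e1 / p * ?S1 + e2 / q * ?S2) / 2"
    unfolding m_mult_integrable(2)[OF measurable_h h_bounded] p_def[symmetric] q_def[symmetric]
      shifted_exponential_integral[OF pq(1)] shifted_exponential_integral[OF pq(2)] e1_def e2_def ..
  then have "index x = (e1 / p * ?S1 + e2 / q * ?S2) / 2 / (\<alpha> * ((e1 / p + e2 / q) / 2))"
    unfolding index_def tail_def p_def[symmetric] q_def[symmetric] e1_def[symmetric] e2_def[symmetric] by (simp only:)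
  also have "\<dots> = (e1 / p) / (\<alpha> * (e1 / p + e2 / q)) * ?S1 + (e2 / q) / (\<alpha> * (e1 / p + e2 / q)) * ?S2"
  proof -
    have "(u * S + v * T) / 2 / (a * (w / 2)) = u / (a * w) * S + v / (a * w) * T" for u v S T a w :: real
      by (simp add: add_divide_distrib)
    then show ?thesis .
  qed
  also have "(e1 / p) / (\<alpha> * (e1 / p + e2 / q)) = 2 / (2 * \<alpha> + \<sigma>\<^sup>2 * p\<^sup>2 * (e2 / e1))"
  proof -
    have "2 / (2 * \<alpha> + \<sigma>\<^sup>2 * p\<^sup>2 * (e2 / e1)) = 2 / (2 * \<alpha> * (1 + p / q * (e2 / e1)))"
    proof -
      have "\<sigma>\<^sup>2 * p\<^sup>2 = 2 * \<alpha> * (p / q)" unfolding \<alpha> using pq by (simp add: power2_eq_square)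
      then show ?thesis by (simp add: distrib_left mult.assoc)
    qed
    also have "\<dots> = 1 / (\<alpha> * (1 + p / q * (e2 / e1)))" by (simp add: mult.assoc)
    also have "\<dots> = (e1 / p) / (e1 / p * (\<alpha> * (1 + p / q * (e2 / e1))))" using pos pq by simp
    also have "e1 / p * (\<alpha> * (1 + p / q * (e2 / e1))) = \<alpha> * (e1 / p + e2 / q)"
      using pos pq by (simp add: field_simps)
    finally show ?thesis by simp
  qed
  also have "(e2 / q) / (\<alpha> * (e1 / p + e2 / q)) = 2 / (2 * \<alpha> + \<sigma>\<^sup>2 * q\<^sup>2 * (e1 / e2))"
  proof -
    have "2 / (2 * \<alpha> + \<sigma>\<^sup>2 * q\<^sup>2 * (e1 / e2)) = 2 / (2 * \<alpha> * (1 + q / p * (e1 / e2)))"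
    proof -
      have "\<sigma>\<^sup>2 * q\<^sup>2 = 2 * \<alpha> * (q / p)" unfolding \<alpha> using pq by (simp add: power2_eq_square)
      then show ?thesis by (simp add: distrib_left mult.assoc)
    qed
    also have "\<dots> = 1 / (\<alpha> * (1 + q / p * (e1 / e2)))" by (simp add: mult.assoc)
    also have "\<dots> = (e2 / q) / (e2 / q * (\<alpha> * (1 + q / p * (e1 / e2))))" using pos pq by simp
    also have "e2 / q * (\<alpha> * (1 + q / p * (e1 / e2))) = \<alpha> * (e1 / p + e2 / q)"
      using pos pq by (simp add: field_simps)
    finally show ?thesis by simp
  qed
  finally show ?thesis unfolding E[symmetric] p_def q_def by simp
qed

end

section \<open>The Gittins index of the diffusion\<close>

locale gittins_diffusion = reward \<alpha> \<sigma> A B h H + diffusion M F W "\<lambda>y. \<sigma>\<^sup>2 * A * tanh (A * y)" \<sigma> x X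
  for \<alpha> \<sigma> A B :: real and h :: "real \<Rightarrow> real" and H :: real
    and M :: "'a measure" and F :: "ennreal \<Rightarrow> 'a measure" and W :: "real \<Rightarrow> 'a \<Rightarrow> real"
    and x :: real and X :: "real \<Rightarrow> 'a \<Rightarrow> real"
begin

sublocale regular_diffusion M F W "\<lambda>y. \<sigma>\<^sup>2 * A * tanh (A * y)" \<sigma> x X "\<sigma>\<^sup>2 * A" "\<sigma>\<^sup>2 * A * A"
proof
  fix y z
  have 0: "0 \<le> \<sigma>\<^sup>2 * A" using A_pos by simp
  show "\<bar>\<sigma>\<^sup>2 * A * tanh (A * y)\<bar> \<le> \<sigma>\<^sup>2 * A"
    unfolding abs_mult[of "\<sigma>\<^sup>2 * A"] using mult_left_mono[OF tanh_bounded[of y] 0] 0 by simp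
  have "\<bar>\<sigma>\<^sup>2 * A * (tanh (A * y) - tanh (A * z))\<bar> \<le> \<sigma>\<^sup>2 * A * (A * \<bar>y - z\<bar>)"
    unfolding abs_mult[of "\<sigma>\<^sup>2 * A"] using mult_left_mono[OF tanh_lipschitz[of y z] 0] 0 by simp
  then show "\<bar>\<sigma>\<^sup>2 * A * tanh (A * y) - \<sigma>\<^sup>2 * A * tanh (A * z)\<bar> \<le> \<sigma>\<^sup>2 * A * A * \<bar>y - z\<bar>"
    by (simp add: right_diff_distrib mult.assoc)
qed

lemma discount_bounds: "0 \<le> discount \<alpha> t" "discount \<alpha> t \<le> 1"
  using \<alpha>_pos by (auto simp: discount_def)

lemma discount_integrable:
  assumes "stopping_time F \<tau>"
  shows "integrable M (\<lambda>\<omega>. discount \<alpha> (\<tau> \<omega>))"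
proof (rule integrable_const_bound[where B=1])
  have "discount \<alpha> \<in> borel_measurable borel"
    unfolding discount_def[abs_def] by measurable
  then show "(\<lambda>\<omega>. discount \<alpha> (\<tau> \<omega>)) \<in> borel_measurable M"
    by (rule measurable_compose[OF measurable_stopping[OF assms]])
qed (use discount_bounds in auto)

text \<open>\<open>1 - discount \<alpha> t\<close> is nonnegative and vanishes only at 0, so the
  denominators in the index are positive.\<close>

lemma discount_less_1:
  assumes \<tau>: "stopping_time F \<tau>" and "\<not> (AE \<omega> in M. \<tau> \<omega> = 0)"
  shows "expectation (\<lambda>\<omega>. discount \<alpha> (\<tau> \<omega>)) < 1"
proof (rule ccontr)
  assume "\<not> ?thesis"
  note i = discount_integrable[OF \<tau>]
  have e: "expectation (\<lambda>\<omega>. 1 - discount \<alpha> (\<tau> \<omega>)) = 1 - expectation (\<lambda>\<omega>. discount \<alpha> (\<tau> \<omega>))"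
    using i by (simp add: prob_space)
  have "0 \<le> expectation (\<lambda>\<omega>. 1 - discount \<alpha> (\<tau> \<omega>))"
    using discount_bounds by (intro Bochner_Integration.integral_nonneg) auto
  with e \<open>\<not> ?thesis\<close> have "expectation (\<lambda>\<omega>. 1 - discount \<alpha> (\<tau> \<omega>)) = 0" by simp
  then have "AE \<omega> in M. 1 - discount \<alpha> (\<tau> \<omega>) = 0"
    using i discount_bounds by (subst (asm) integral_nonneg_eq_0_iff_AE) auto
  then have "AE \<omega> in M. \<tau> \<omega> = 0"
  proof eventually_elim
    case (elim \<omega>)
    then show ?case using \<alpha>_pos
      by (cases "\<tau> \<omega>") (auto simp: discount_def split: if_splits)
  qed
  then show False using assms by simp
qed

text \<open>Dynkin's formula for \<open>w + l\<close>: the constant shifts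
  \<open>\<alpha> * f - G\<close> by \<open>\<alpha> * l\<close> and contributes \<open>l\<close>
  times the denominator of the Gittins quotient. At this point \<open>l\<close> is free.\<close>

lemma source_dynkin:
  assumes "source \<alpha> \<sigma> A B g a D"
  obtains v where "\<And>y. 0 \<le> v y" "\<And>y. y \<le> a \<Longrightarrow> v y = 0"
    "\<And>y z. y \<le> z \<Longrightarrow> (\<And>t. t \<le> z \<Longrightarrow> g t \<le> 0) \<Longrightarrow> v y \<le> v z"
    "\<And>\<tau>. stopping_time F \<tau> \<Longrightarrow> integrable M (\<lambda>\<omega>. discount \<alpha> (\<tau> \<omega>) * v (X (enn2real (\<tau> \<omega>)) \<omega>))"
    "\<And>\<tau> l. stopping_time F \<tau> \<Longrightarrow> expectation (discounted_integral \<alpha> (\<lambda>y. g y + \<alpha> * l) \<tau>) =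
      v x + l * (1 - expectation (\<lambda>\<omega>. discount \<alpha> (\<tau> \<omega>)))
      - expectation (\<lambda>\<omega>. discount \<alpha> (\<tau> \<omega>) * v (X (enn2real (\<tau> \<omega>)) \<omega>))"
proof -
  interpret S: source \<alpha> \<sigma> A B g a D by fact
  obtain C where C: "\<And>y. \<bar>S.w y\<bar> \<le> C" "\<And>y. \<bar>S.w' y\<bar> \<le> C" "\<And>y. \<bar>S.w'' y\<bar> \<le> C"
    "\<And>y z. \<bar>S.w'' y - S.w'' z\<bar> \<le> C * \<bar>y - z\<bar>" using S.w_bounds by blast
  have test: "discounted_test M F W (\<lambda>y. \<sigma>\<^sup>2 * A * tanh (A * y)) \<sigma> x X (\<sigma>\<^sup>2 * A) (\<sigma>\<^sup>2 * A * A)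
      (\<lambda>y. S.w y + l) S.w' S.w'' (C + \<bar>l\<bar>) \<alpha>" for l
  proof
    fix y z
    show "((\<lambda>y. S.w y + l) has_real_derivative S.w' y) (at y)"
      using DERIV_add[OF S.w_deriv DERIV_const] by simp
    show "(S.w' has_real_derivative S.w'' y) (at y)" by (rule S.w'_deriv)
    show "\<bar>S.w y + l\<bar> \<le> C + \<bar>l\<bar>" "\<bar>S.w' y\<bar> \<le> C + \<bar>l\<bar>" "\<bar>S.w'' y\<bar> \<le> C + \<bar>l\<bar>"
      using C(1-3)[of y] by linarith+
    have "C * \<bar>y - z\<bar> \<le> (C + \<bar>l\<bar>) * \<bar>y - z\<bar>" by (intro mult_right_mono) auto
    then show "\<bar>S.w'' y - S.w'' z\<bar> \<le> (C + \<bar>l\<bar>) * \<bar>y - z\<bar>" using C(4)[of y z] by linarith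
    show "0 < \<alpha>" by (rule \<alpha>_pos)
  qed
  have i: "integrable M (\<lambda>\<omega>. discount \<alpha> (\<tau> \<omega>) * S.w (X (enn2real (\<tau> \<omega>)) \<omega>))" if "stopping_time F \<tau>" for \<tau>
    using discounted_test.dynkin(1)[OF test[of 0] that] by simp
  have e: "expectation (discounted_integral \<alpha> (\<lambda>y. g y + \<alpha> * l) \<tau>) =
      S.w x + l * (1 - expectation (\<lambda>\<omega>. discount \<alpha> (\<tau> \<omega>)))
      - expectation (\<lambda>\<omega>. discount \<alpha> (\<tau> \<omega>) * S.w (X (enn2real (\<tau> \<omega>)) \<omega>))" if \<tau>: "stopping_time F \<tau>" for \<tau> l
  proof -
    interpret T: discounted_test M F W "\<lambda>y. \<sigma>\<^sup>2 * A * tanh (A * y)" \<sigma> x X "\<sigma>\<^sup>2 * A" "\<sigma>\<^sup>2 * A * A"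
      "\<lambda>y. S.w y + l" S.w' S.w'' "C + \<bar>l\<bar>" \<alpha> by (rule test)
    have q: "T.q = (\<lambda>y. g y + \<alpha> * l)"
      unfolding T.q_def[abs_def] T.G_def S.generator_w by (simp add: algebra_simps)
    have "expectation (\<lambda>\<omega>. discount \<alpha> (\<tau> \<omega>) * (S.w (X (enn2real (\<tau> \<omega>)) \<omega>) + l))
        = expectation (\<lambda>\<omega>. discount \<alpha> (\<tau> \<omega>) * S.w (X (enn2real (\<tau> \<omega>)) \<omega>)) + l * expectation (\<lambda>\<omega>. discount \<alpha> (\<tau> \<omega>))"
      using i[OF \<tau>] discount_integrable[OF \<tau>] by (simp add: distrib_left mult.commute)
    with T.dynkin(3)[OF \<tau>] show ?thesis unfolding q by (simp add: algebra_simps)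
  qed
  show ?thesis
    by (rule that[of S.w]) (use S.w_nonneg S.w_zero S.w_mono i e in auto)
qed

lemma ramp_reward_bounded:
  "\<bar>ramp a e y * (h y - \<alpha> * l) + \<alpha> * l\<bar> \<le> H + \<bar>\<alpha> * l\<bar> + \<bar>\<alpha> * l\<bar>"
  using ramp_mult_bounded[of "\<lambda>z. h z - \<alpha> * l" y "H + \<bar>\<alpha> * l\<bar>" a e] h_bounded[of y] by linarith

lemma continuous_ramp_reward: "0 < e \<Longrightarrow> continuous_on UNIV (\<lambda>y. ramp a e y * (h y - \<alpha> * l) + \<alpha> * l)"
  unfolding ramp_def[abs_def] by (intro continuous_intros continuous_h) auto

text \<open>With the ramp starting at \<open>x\<close>, the test function vanishes at the start and
  is nonnegative at the end. Where the ramp is below 1, \<open>h y - \<alpha> * l\<close> is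
  nonpositive by hypothesis, so damping it only raises the reward.\<close>

lemma discounted_reward_le:
  assumes e: "0 < e" and h: "h (x + e) \<le> \<alpha> * smoothed_index x e" and \<tau>: "stopping_time F \<tau>"
  shows "expectation (discounted_integral \<alpha> h \<tau>)
    \<le> smoothed_index x e * (1 - expectation (\<lambda>\<omega>. discount \<alpha> (\<tau> \<omega>)))"
proof -
  define l where "l = smoothed_index x e"
  let ?g = "\<lambda>y. ramp x e y * (h y - \<alpha> * l)"
  obtain D where "source \<alpha> \<sigma> A B ?g x D" using source_ramp[OF e] unfolding l_def by blast
  then obtain v where v: "\<And>y. 0 \<le> v y" "\<And>y. y \<le> x \<Longrightarrow> v y = 0"
    and dynkin: "\<And>\<tau> l. stopping_time F \<tau> \<Longrightarrow> expectation (discounted_integral \<alpha> (\<lambda>y. ?g y + \<alpha> * l) \<tau>) =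
      v x + l * (1 - expectation (\<lambda>\<omega>. discount \<alpha> (\<tau> \<omega>)))
      - expectation (\<lambda>\<omega>. discount \<alpha> (\<tau> \<omega>) * v (X (enn2real (\<tau> \<omega>)) \<omega>))"
    by (rule source_dynkin) blast
  note cr = continuous_ramp_reward[OF e, of x l]
  have le: "h y \<le> ?g y + \<alpha> * l" for y
  proof (cases "x + e \<le> y")
    case True
    then show ?thesis using ramp_one[OF e] by simp
  next
    case False
    then have "h y \<le> h (x + e)" using h_strict_mono by (simp add: strict_mono_less_eq)
    then have "h y - \<alpha> * l \<le> 0" using h l_def by simp
    then have "1 * (h y - \<alpha> * l) \<le> ?g y" by (intro mult_right_mono_neg ramp_bounds)
    then show ?thesis by simp
  qed
  have "expectation (discounted_integral \<alpha> h \<tau>) \<le> expectation (discounted_integral \<alpha> (\<lambda>y. ?g y + \<alpha> * l) \<tau>)"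
    by (intro integral_mono discounted_integral_integrable[OF \<tau> \<alpha>_pos continuous_h h_bounded]
        discounted_integral_integrable[OF \<tau> \<alpha>_pos cr ramp_reward_bounded]
        discounted_integral_mono[OF \<alpha>_pos _ continuous_h h_bounded cr ramp_reward_bounded] le)
  also have "\<dots> \<le> l * (1 - expectation (\<lambda>\<omega>. discount \<alpha> (\<tau> \<omega>)))"
  proof -
    have "0 \<le> expectation (\<lambda>\<omega>. discount \<alpha> (\<tau> \<omega>) * v (X (enn2real (\<tau> \<omega>)) \<omega>))"
      using v(1) discount_bounds by (intro Bochner_Integration.integral_nonneg) auto
    then show ?thesis unfolding dynkin[OF \<tau>] using v(2)[of x] by simp
  qed
  finally show ?thesis unfolding l_def .
qed

text \<open>The ramp is complete at \<open>x - e\<close>, so the true reward is collected until the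
  passage. The source is nonpositive up to \<open>x\<close> by hypothesis, hence the test function
  at the passage level is at most its value at the start, and the boundary terms of Dynkin's formula
  leave a nonnegative balance.\<close>

lemma discounted_reward_hit_ge:
  assumes e: "0 < e" and h: "h x \<le> \<alpha> * smoothed_index (x - 2 * e) e"
  defines "\<tau> \<equiv> hit (x - e)"
  shows "smoothed_index (x - 2 * e) e * (1 - expectation (\<lambda>\<omega>. discount \<alpha> (\<tau> \<omega>)))
    \<le> expectation (discounted_integral \<alpha> h \<tau>)"
    and "\<not> (AE \<omega> in M. \<tau> \<omega> = 0)"
proof -
  define a where "a = x - 2 * e"
  define l where "l = smoothed_index a e"
  let ?g = "\<lambda>y. ramp a e y * (h y - \<alpha> * l)"
  have \<tau>: "stopping_time F \<tau>" unfolding \<tau>_def by (rule hit_stopping_time)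
  obtain D where "source \<alpha> \<sigma> A B ?g a D" using source_ramp[OF e] unfolding l_def by blast
  then obtain v where v: "\<And>y. 0 \<le> v y" "\<And>y z. y \<le> z \<Longrightarrow> (\<And>t. t \<le> z \<Longrightarrow> ?g t \<le> 0) \<Longrightarrow> v y \<le> v z"
    and i: "\<And>\<tau>. stopping_time F \<tau> \<Longrightarrow> integrable M (\<lambda>\<omega>. discount \<alpha> (\<tau> \<omega>) * v (X (enn2real (\<tau> \<omega>)) \<omega>))"
    and dynkin: "\<And>\<tau> l. stopping_time F \<tau> \<Longrightarrow> expectation (discounted_integral \<alpha> (\<lambda>y. ?g y + \<alpha> * l) \<tau>) =
      v x + l * (1 - expectation (\<lambda>\<omega>. discount \<alpha> (\<tau> \<omega>)))
      - expectation (\<lambda>\<omega>. discount \<alpha> (\<tau> \<omega>) * v (X (enn2real (\<tau> \<omega>)) \<omega>))"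
    by (rule source_dynkin) blast
  note cr = continuous_ramp_reward[OF e, of a l]
  have start: "AE \<omega> in M. x - e < X 0 \<omega>" using X_0 by eventually_elim (use e in simp)
  have vx: "v (x - e) \<le> v x"
  proof (rule v(2))
    fix t assume "t \<le> x"
    then have "h t \<le> h x" using h_strict_mono by (simp add: strict_mono_less_eq)
    then have "h t - \<alpha> * l \<le> 0" using h unfolding l_def a_def by simp
    then show "?g t \<le> 0" using ramp_bounds(1) by (intro mult_nonneg_nonpos)
  qed (use e in simp)
  have "AE \<omega> in M. discount \<alpha> (\<tau> \<omega>) * v (X (enn2real (\<tau> \<omega>)) \<omega>) \<le> v x"
    using start AE_space
  proof eventually_elim
    case (elim \<omega>)
    show ?case
    proof (cases "\<tau> \<omega> = \<infinity>")
      case True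
      then show ?thesis using v(1) by (simp add: discount_def)
    next
      case False
      then have "X (enn2real (\<tau> \<omega>)) \<omega> = x - e" using hit_facts(2)[OF elim(2,1)] unfolding \<tau>_def by simp
      then have "discount \<alpha> (\<tau> \<omega>) * v (X (enn2real (\<tau> \<omega>)) \<omega>) \<le> 1 * v x"
        using vx v(1) discount_bounds by (intro mult_mono) auto
      then show ?thesis by simp
    qed
  qed
  then have "expectation (\<lambda>\<omega>. discount \<alpha> (\<tau> \<omega>) * v (X (enn2real (\<tau> \<omega>)) \<omega>)) \<le> expectation (\<lambda>_. v x)"
    by (intro integral_mono_AE i \<tau>) auto
  then have "l * (1 - expectation (\<lambda>\<omega>. discount \<alpha> (\<tau> \<omega>))) \<le> expectation (discounted_integral \<alpha> (\<lambda>y. ?g y + \<alpha> * l) \<tau>)"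
    unfolding dynkin[OF \<tau>] by (simp add: prob_space)
  also have "\<dots> \<le> expectation (discounted_integral \<alpha> h \<tau>)"
  proof (intro integral_mono_AE discounted_integral_integrable[OF \<tau> \<alpha>_pos continuous_h h_bounded]
        discounted_integral_integrable[OF \<tau> \<alpha>_pos cr ramp_reward_bounded])
    show "AE \<omega> in M. discounted_integral \<alpha> (\<lambda>y. ?g y + \<alpha> * l) \<tau> \<omega> \<le> discounted_integral \<alpha> h \<tau> \<omega>"
      using start AE_space
    proof eventually_elim
      case (elim \<omega>)
      show ?case
      proof (rule discounted_integral_mono[OF \<alpha>_pos elim(2) cr ramp_reward_bounded continuous_h h_bounded])
        fix u assume u: "0 \<le> u" "ennreal u \<le> \<tau> \<omega>"
        then have "a + e \<le> X u \<omega>" using hit_facts(3)[OF elim(2,1), of u] unfolding \<tau>_def a_def by simp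
        then show "?g (X u \<omega>) + \<alpha> * l \<le> h (X u \<omega>)" using ramp_one[OF e] by simp
      qed
    qed
  qed
  finally show "smoothed_index (x - 2 * e) e * (1 - expectation (\<lambda>\<omega>. discount \<alpha> (\<tau> \<omega>)))
    \<le> expectation (discounted_integral \<alpha> h \<tau>)" unfolding l_def a_def .
  have "AE \<omega> in M. \<tau> \<omega> \<noteq> 0"
    using start AE_space by eventually_elim (use hit_facts(1) in \<open>auto simp: \<tau>_def\<close>)
  show "\<not> (AE \<omega> in M. \<tau> \<omega> = 0)"
  proof
    assume "AE \<omega> in M. \<tau> \<omega> = 0"
    with \<open>AE \<omega> in M. \<tau> \<omega> \<noteq> 0\<close> have "AE \<omega> in M. False" by eventually_elim simp
    then show False by simp
  qed
qed

lemma gittins_value: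
  "(SUP \<tau> \<in> {\<tau>. stopping_time F \<tau> \<and> \<not> (AE \<omega> in M. \<tau> \<omega> = 0)}.
    expectation (discounted_integral \<alpha> h \<tau>) / (1 - expectation (\<lambda>\<omega>. discount \<alpha> (\<tau> \<omega>)))) = index x"
proof -
  let ?T = "{\<tau>. stopping_time F \<tau> \<and> \<not> (AE \<omega> in M. \<tau> \<omega> = 0)}"
  let ?r = "\<lambda>\<tau>. expectation (discounted_integral \<alpha> h \<tau>) / (1 - expectation (\<lambda>\<omega>. discount \<alpha> (\<tau> \<omega>)))"
  let ?e = "\<lambda>n. 1 / real (Suc n)"
  have e: "?e \<longlonglongrightarrow> 0" using LIMSEQ_inverse_real_of_nat by (simp add: inverse_eq_divide)
  have pos: "0 < ?e n" "?e n \<le> 1" for n by auto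
  have a: "(\<lambda>n. x - 2 * ?e n) \<longlonglongrightarrow> x - 2 * 0" by (intro tendsto_intros e)
  have up: "(\<lambda>n. smoothed_index x (?e n)) \<longlonglongrightarrow> index x"
    by (rule smoothed_index_tendsto[OF tendsto_const e pos(1), of x]) simp
  have low: "(\<lambda>n. smoothed_index (x - 2 * ?e n) (?e n)) \<longlonglongrightarrow> index x"
  proof (rule smoothed_index_tendsto[OF _ e pos(1)])
    show "(\<lambda>n. x - 2 * ?e n) \<longlonglongrightarrow> x" using a by simp
    show "x - 2 \<le> x - 2 * ?e n" for n using pos(2)[of n] by linarith
  qed
  have "isCont h (x + 0)" using continuous_h[of UNIV] by (simp add: continuous_on_eq_continuous_at)
  then have hlim: "(\<lambda>n. h (x + ?e n)) \<longlonglongrightarrow> h (x + 0)"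
    by (rule isCont_tendsto_compose) (intro tendsto_intros e)
  \<comment> \<open>The hypothesis of \<open>discounted_reward_le\<close> holds eventually, as both
    of its sides converge and \<open>h_less_index\<close> orders the limits strictly.\<close>
  have "\<forall>\<^sub>F n in sequentially. 0 < \<alpha> * smoothed_index x (?e n) - h (x + ?e n)"
    using h_less_index[of x] hlim
    by (intro order_tendstoD(1)[OF tendsto_diff[OF tendsto_mult[OF tendsto_const up] hlim]]) auto
  then have up_ev: "\<forall>\<^sub>F n in sequentially. h (x + ?e n) \<le> \<alpha> * smoothed_index x (?e n)"
    by eventually_elim simp
  have low_ev: "\<forall>\<^sub>F n in sequentially. h x \<le> \<alpha> * smoothed_index (x - 2 * ?e n) (?e n)"
    using order_tendstoD(1)[OF tendsto_mult[OF tendsto_const low] h_less_index[of x]]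
    by eventually_elim simp
  have le: "?r \<tau> \<le> index x" if \<tau>: "\<tau> \<in> ?T" for \<tau>
  proof (rule tendsto_lowerbound[OF up])
    have d: "0 < 1 - expectation (\<lambda>\<omega>. discount \<alpha> (\<tau> \<omega>))" using discount_less_1 \<tau> by simp
    show "\<forall>\<^sub>F n in sequentially. ?r \<tau> \<le> smoothed_index x (?e n)"
      using up_ev
    proof eventually_elim
      case (elim n)
      show ?case using discounted_reward_le[OF pos(1) elim, of \<tau>] \<tau> d by (simp add: divide_le_eq)
    qed
  qed simp
  have bdd: "bdd_above (?r ` ?T)" using le by (intro bdd_aboveI[of _ "index x"]) auto
  \<comment> \<open>Nonemptiness is carried along because \<open>cSUP_least\<close> requires it; the
    passage times are the witnesses.\<close>
  have ge: "\<forall>\<^sub>F n in sequentially. smoothed_index (x - 2 * ?e n) (?e n) \<le> (SUP \<tau> \<in> ?T. ?r \<tau>) \<and> ?T \<noteq> {}"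
    using low_ev
  proof eventually_elim
    case (elim n)
    let ?\<tau> = "hit (x - ?e n)"
    have \<tau>: "?\<tau> \<in> ?T" using discounted_reward_hit_ge(2)[OF pos(1) elim] hit_stopping_time by simp
    have "0 < 1 - expectation (\<lambda>\<omega>. discount \<alpha> (?\<tau> \<omega>))" using discount_less_1 \<tau> by simp
    then have "smoothed_index (x - 2 * ?e n) (?e n) \<le> ?r ?\<tau>"
      using discounted_reward_hit_ge(1)[OF pos(1) elim] by (simp add: le_divide_eq)
    also have "\<dots> \<le> (SUP \<tau> \<in> ?T. ?r \<tau>)" by (rule cSUP_upper[OF \<tau> bdd])
    finally show ?case using \<tau> by blast
  qed
  show ?thesis
  proof (rule antisym)
    have "?T \<noteq> {}" using eventually_happens[OF ge] by auto
    then show "(SUP \<tau> \<in> ?T. ?r \<tau>) \<le> index x" using le by (rule cSUP_least)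
    show "index x \<le> (SUP \<tau> \<in> ?T. ?r \<tau>)"
      by (rule tendsto_upperbound[OF low]) (use ge in \<open>auto elim: eventually_mono\<close>)
  qed
qed

end

lemma admissible_reward_bounds:
  assumes "admissible_reward h \<alpha> k K"
  obtains H where "\<And>y. \<bar>h y\<bar> \<le> H" "\<And>y z. \<bar>h y - h z\<bar> \<le> H * \<bar>y - z\<bar>"
proof -
  from assms have r: "range h \<subseteq> {\<alpha> * k..\<alpha> * K}" and d: "\<And>y. h field_differentiable at y"
    and "bounded (range (deriv h))"
    unfolding admissible_reward_def by auto
  then obtain H' where H': "\<And>y. \<bar>deriv h y\<bar> \<le> H'" by (auto simp: bounded_iff)
  define H where "H = max H' (\<bar>\<alpha> * k\<bar> + \<bar>\<alpha> * K\<bar>)"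
  show ?thesis
  proof (rule that[of H])
    show "\<bar>h y\<bar> \<le> H" for y
    proof -
      have "h y \<in> {\<alpha> * k..\<alpha> * K}" using r rangeI[of h y] by blast
      then show ?thesis unfolding H_def by auto
    qed
    have "(h has_real_derivative deriv h y) (at y)" for y
      using d[of y] by (simp add: field_differentiable_derivI)
    moreover have "\<bar>deriv h y\<bar> \<le> H" for y using H'[of y] by (simp add: H_def)
    ultimately show "\<bar>h y - h z\<bar> \<le> H * \<bar>y - z\<bar>" for y z
      by (rule lipschitz_of_bounded_derivative)
  qed
qed

theorem corollary3p5:
  fixes h :: "real \<Rightarrow> real" and \<alpha> k K \<Gamma> \<sigma> A B :: real
    and P :: "real \<Rightarrow> 'a measure" and F :: "real \<Rightarrow> ennreal \<Rightarrow> 'a measure"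
    and W X :: "real \<Rightarrow> real \<Rightarrow> 'a \<Rightarrow> real"
    and \<rho>\<^sub>m \<rho>\<^sub>p S\<^sub>m S\<^sub>p :: "real \<Rightarrow> real"
  assumes "admissible_reward h \<alpha> k K"
    and "0 < \<Gamma>" and "0 < \<sigma>" and "\<Gamma> < \<alpha> / 2"
    and "A = sqrt (2 * \<Gamma>) / \<sigma>"
    and "B = sqrt (2 * (\<alpha> + \<Gamma>)) / \<sigma>"
    and "\<And>x. diffusion (P x) (F x) (W x) (\<lambda>y. \<sigma>\<^sup>2 * A * tanh (A * y)) \<sigma> x (X x)"
    and "\<And>x. \<rho>\<^sub>m x = 2 / (2 * \<alpha> + \<sigma>\<^sup>2 * (B - A)\<^sup>2 * exp (- 2 * A * x))"
    and "\<And>x. \<rho>\<^sub>p x = 2 / (2 * \<alpha> + \<sigma>\<^sup>2 * (B + A)\<^sup>2 * exp (2 * A * x))"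
    and "\<And>x. S\<^sub>m x = (LBINT s:{0..}. h (x + s / (B - A)) * exp (- s))"
    and "\<And>x. S\<^sub>p x = (LBINT s:{0..}. h (x + s / (B + A)) * exp (- s))"
  shows "\<forall>x. gittins_index P F X h \<alpha> x = \<rho>\<^sub>m x * S\<^sub>m x + \<rho>\<^sub>p x * S\<^sub>p x"
proof
  fix x
  have \<alpha>: "0 < \<alpha>" and mono: "strict_mono h" using assms(1) by (auto simp: admissible_reward_def)
  obtain H where H: "\<And>y. \<bar>h y\<bar> \<le> H" "\<And>y z. \<bar>h y - h z\<bar> \<le> H * \<bar>y - z\<bar>"
    using admissible_reward_bounds[OF assms(1)] by blast
  \<comment> \<open>The terms with \<open>\<Gamma>\<close> cancel in
    \<open>B\<^sup>2 - A\<^sup>2\<close>, which leaves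
    \<open>2 * \<alpha> / \<sigma>\<^sup>2\<close>.\<close>
  have "weight \<alpha> \<sigma> A B"
  proof
    show "0 < \<alpha>" "0 < \<sigma>" by fact+
    show "0 < A" using assms(2,3,5) by simp
    have "sqrt (2 * \<Gamma>) < sqrt (2 * (\<alpha> + \<Gamma>))" using \<alpha> by simp
    then show "A < B" unfolding assms(5,6) using assms(3) by (rule divide_strict_right_mono)
    have "A\<^sup>2 = 2 * \<Gamma> / \<sigma>\<^sup>2" "B\<^sup>2 = 2 * (\<alpha> + \<Gamma>) / \<sigma>\<^sup>2"
      unfolding assms(5,6) using \<alpha> assms(2) by (simp_all add: power_divide)
    then show "\<sigma>\<^sup>2 * (B\<^sup>2 - A\<^sup>2) = 2 * \<alpha>" using assms(3) by (simp add: field_simps)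
  qed
  then have "gittins_diffusion \<alpha> \<sigma> A B h H (P x) (F x) (W x) x (X x)"
    by (intro gittins_diffusion.intro reward.intro reward_axioms.intro mono H assms(7))
  then interpret gittins_diffusion \<alpha> \<sigma> A B h H "P x" "F x" "W x" x "X x" .
  have "(LBINT s:{s. 0 \<le> s \<and> ennreal s \<le> \<tau> \<omega>}. h (X x s \<omega>) * exp (- \<alpha> * s)) = discounted_integral \<alpha> h \<tau> \<omega>" for \<tau> \<omega>
    unfolding discounted_integral_def set_lebesgue_integral_def
    by (intro Bochner_Integration.integral_cong) (auto simp: indicator_def)
  then have "gittins_index P F X h \<alpha> x = index x"
    unfolding gittins_index_def gittins_value[symmetric] by (simp only:)
  then show "gittins_index P F X h \<alpha> x = \<rho>\<^sub>m x * S\<^sub>m x + \<rho>\<^sub>p x * S\<^sub>p x"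
    unfolding assms(8-11) index_formula .
qed

end
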